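(* For every $K\ge2$, $$\nu\big(F_{2K+1}(\tau_{2K+1})\big)\ge 2K+3,$$ and for every $M\ge1$, $$\nu\big(F_{2K+1}(\tau_{2K+1}+M)\big)\ge 2K+M+2.$$
   Context: Let $E(q)=\prod_{m\ge1}(1-q^m)$. $PDO(n)$ is the number of partitions of $n$ into odd parts with designated summands (for each distinct part size, exactly one occurrence is designated); $\sum_{n\ge0}PDO(n)q^n=\frac{E(q^4)E(q^6)^2}{E(q)E(q^3)E(q^{12})}$. Define $$\gamma(q)=\frac{E(q)^5E(q^2)^5E(q^6)^5}{E(q^3)^{15}},\quad \xi=\xi(q)=\frac{E(q^2)^5E(q^6)}{E(q)E(q^3)^5},$$ and for $k\ge3$, $\Phi_k=\gamma(q)^{2^k}\left(\sum_{n\ge0}PDO(2^{k+2}n)q^n-\sum_{n\ge0}PDO(2^kn)q^n\right)$. It is known that $\Phi_k$ equals (as a formal power series in $q$) a polynomial in $\xi$ with integer coefficients; $F_k(m)$ denote these coefficients, $\Phi_k=\sum_m F_k(m)\xi^m$. For $K\ge2$, $\tau_{2K+1}=7\cdot 2^{2K-1}-\tfrac23\left(4^{K-1}-1\right)$. $\nu(n)$ is the $2$-adic valuation of an integer $n$ (largest $\alpha\ge0$ with $2^\alpha\mid n$), with $\nu(0)=\infty$. *)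

theory Defs
  imports "HOL-Computational_Algebra.Computational_Algebra" "HOL-Library.Multiset"
    "HOL-Library.Extended_Nat"
begin

text \<open>E(q^a) = prod_{m>=1} (1 - q^(a m)) as a formal power series over the rationals:
  the n-th coefficient is the n-th coefficient of the finite product over m = 1..n
  (which stabilises for a >= 1).\<close>
definition Eul :: "nat \<Rightarrow> rat fps" where
  "Eul a = Abs_fps (\<lambda>n. fps_nth (\<Prod>m\<in>{1..n}. (1 - fps_X ^ (a * m))) n)"

text \<open>PDO(n): partitions of n into odd parts (multisets of odd positive integers summing
  to n), where for each distinct part size one occurrence is designated; hence each
  partition contributes the product of the multiplicities of its distinct parts.\<close>
definition PDO :: "nat \<Rightarrow> nat" where
  "PDO n = (\<Sum>M\<in>{M :: nat multiset. (\<forall>x\<in>#M. odd x) \<and> sum_mset M = n}.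
              \<Prod>x\<in>set_mset M. count M x)"

definition gamma :: "rat fps" where
  "gamma = Eul 1 ^ 5 * Eul 2 ^ 5 * Eul 6 ^ 5 / Eul 3 ^ 15"

definition xi :: "rat fps" where
  "xi = Eul 2 ^ 5 * Eul 6 / (Eul 1 * Eul 3 ^ 5)"

definition Phi :: "nat \<Rightarrow> rat fps" where
  "Phi k = gamma ^ (2 ^ k) *
     Abs_fps (\<lambda>n. of_nat (PDO (2 ^ (k + 2) * n)) - of_nat (PDO (2 ^ k * n)))"

definition F :: "nat \<Rightarrow> nat \<Rightarrow> int" where
  "F k m = coeff (THE p :: int poly. poly (map_poly (\<lambda>c. fps_const (of_int c)) p) xi = Phi k) m"

definition tau :: "nat \<Rightarrow> nat" where
  "tau K = 7 * 2 ^ (2 * K - 1) - (2 * (4 ^ (K - 1) - 1)) div 3"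

definition nu :: "int \<Rightarrow> enat" where
  "nu n = (if n = 0 then \<infinity> else enat (multiplicity (2::int) n))"

end

theory Submission
  imports Defs
begin

text \<open>
  Put \<open>g = E(q) E(q^2) E(q^6) / E(q^3)^3\<close>, so that \<open>\<gamma> = g^5\<close>, and let \<open>U\<close> be the operator
  \<open>\<Sum>a(n) q^n \<mapsto> \<Sum>a(2n) q^n\<close>. Since \<open>\<rho> = g(q^2)^2 / g(q)\<close> satisfies \<open>\<rho>^2 - 2 y \<rho> + y = 0\<close> over \<open>y = \<xi>(q^2)\<close>,
  with conjugate root \<open>\<rho>(-q)\<close>, and since \<open>\<xi> = 8 y - 8 y^2 + (4 y - 3) \<rho>\<close>, the recursion
  \<open>\<Phi>_{k+1} = U(\<rho>^(5 * 2^k) \<Phi>_k)\<close> takes place inside polynomials in \<open>\<xi>\<close>: write the argument as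
  \<open>A(y) + B(y) \<rho>\<close> and read off \<open>A(\<xi>) + B(\<xi>) \<xi>\<close>. The quadratic equation amounts to the two halves of
  the 2-dissection of \<open>E(q^3)^3 / E(q)\<close>; this quotient is a Lambert series (the case \<open>a = z\<close> of
  Ramanujan's \<open>1\<psi>1\<close> sum), whose coefficients are values of a divisor function that the dissection
  respects.

  In terms of \<open>X = 2 \<xi>\<close> the theorem says that \<open>\<Phi>_{2K+1} = 2^(2K+2) \<xi>^\<tau> (X - 2) w(X)\<close> for an
  integer polynomial \<open>w\<close>. The factor \<open>X - 2\<close> comes for free, because \<open>\<Phi>_k\<close> vanishes at \<open>q = 0\<close>,
  where \<open>\<xi> = 1\<close>. Two steps of the recursion, carried out in the lattice \<open>\<int>[Y] + \<int>[Y] R\<close> with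
  \<open>Y = 2 y\<close>, \<open>R = 2 \<rho>\<close>, \<open>R^2 = 2 Y (R - 1)\<close>, gain a factor 4, and \<open>K = 1\<close> is an explicit computation.
\<close>

subsection \<open>Formal infinite products\<close>

text \<open>The substitution X = 2 \<xi> contributes 2^M to the coefficient of \<xi>^(\<tau> + M),
  and for M = 0 the factor X - 2 contributes one more 2; hence the two bounds.

  The growing powers of \<rho> are controlled by \<rho>^6 \<xi>^2 = y^4 T, where T is 1 modulo 4 in
  the lattice. Since 5 * 2^k is 4 modulo 6 for odd k and 2 modulo 6 for even k >= 2, all but a
  bounded power of \<rho> turns into powers of y and T. Over two steps the exponent of \<xi> runs
  through 2a+2, 4a+3, 8a+6, where 6a+4 = 5 * 2^(2K+1), and \<tau> is 2a+2.

  One step at a time does not work: an odd step gains no power of 2, it only makes the cofactor of X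
  - 2 constant modulo 2. That is exactly what the even step needs in order to gain 4.

  The norm of \<rho> is a comparison of exponents; its trace is the only arithmetic input, and the
  reason for the Lambert series. Norm and trace show one after another that 2\<rho>-1, \<rho>-1,
  4\<rho>-3 and 3-2\<rho> are eta quotients up to a power of q. Later eta-quotient identities then
  reduce to adding exponents and to rational identities in \<rho>.\<close>

declare One_nat_def [simp del]

text \<open>Congruence modulo \<open>fps_X ^ (n + 1)\<close>. Limits of power series are handled by
  proving such congruences for every \<open>n\<close>.\<close>

definition fps_agree :: "nat \<Rightarrow> 'a::comm_ring_1 fps \<Rightarrow> 'a fps \<Rightarrow> bool" where
  "fps_agree n f g \<longleftrightarrow> (\<forall>i\<le>n. fps_nth f i = fps_nth g i)"

lemma fps_agree_refl [simp]: "fps_agree n f f"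
  by (simp add: fps_agree_def)

lemma fps_agree_sym: "fps_agree n f g \<Longrightarrow> fps_agree n g f"
  by (simp add: fps_agree_def)

lemma fps_agree_trans [trans]: "fps_agree n f g \<Longrightarrow> fps_agree n g h \<Longrightarrow> fps_agree n f h"
  by (simp add: fps_agree_def)

lemma fps_agree_mono: "fps_agree n f g \<Longrightarrow> m \<le> n \<Longrightarrow> fps_agree m f g"
  by (simp add: fps_agree_def)

lemma fps_agree_nth: "fps_agree n f g \<Longrightarrow> i \<le> n \<Longrightarrow> fps_nth f i = fps_nth g i"
  by (simp add: fps_agree_def)

lemma fps_agree_imp_eq: "(\<And>n. fps_agree n f g) \<Longrightarrow> f = g"
  by (auto simp: fps_agree_def fps_eq_iff)

lemma fps_agree_mult:
  assumes "fps_agree n f g" "fps_agree n f' g'"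
  shows "fps_agree n (f * f') (g * g')"
  using assms by (auto simp: fps_agree_def fps_mult_nth intro!: sum.cong)

lemma fps_agree_diff:
  "fps_agree n f g \<Longrightarrow> fps_agree n f' g' \<Longrightarrow> fps_agree n (f - f') (g - g')"
  by (simp add: fps_agree_def)

lemma fps_agree_sum:
  "(\<And>j. j \<in> S \<Longrightarrow> fps_agree n (f j) (g j)) \<Longrightarrow> fps_agree n (sum f S) (sum g S)"
  by (auto simp: fps_agree_def fps_sum_nth intro!: sum.cong)

lemma fps_agree_cancel:
  fixes u :: "'a::field fps"
  assumes "fps_agree n (u * f) (u * g)" "fps_nth u 0 \<noteq> 0"
  shows "fps_agree n f g"
proof -
  have "fps_agree n (inverse u * (u * f)) (inverse u * (u * g))"
    by (rule fps_agree_mult[OF fps_agree_refl assms(1)])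
  then show ?thesis
    by (simp only: mult.assoc[symmetric] inverse_mult_eq_1[OF assms(2)] mult_1_left)
qed

text \<open>The \<open>m\<close>-th factor is 1 + O(q^m), so coefficient \<open>n\<close> of the
  partial products is constant from the \<open>n\<close>-th one on. This makes the diagonal
  definition of \<open>fps_infprod\<close>, which has the shape of \<open>Eul\<close>, a genuine
  limit.\<close>

definition fps_admissible :: "(nat \<Rightarrow> 'a::comm_ring_1 fps) \<Rightarrow> bool" where
  "fps_admissible f \<longleftrightarrow> (\<forall>m\<ge>1. fps_agree (m - 1) (f m) 1)"

definition fps_infprod :: "(nat \<Rightarrow> 'a::comm_ring_1 fps) \<Rightarrow> 'a fps" where
  "fps_infprod f = Abs_fps (\<lambda>n. fps_nth (\<Prod>m\<in>{1..n}. f m) n)"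

lemma fps_admissible_mult:
  "fps_admissible f \<Longrightarrow> fps_admissible g \<Longrightarrow> fps_admissible (\<lambda>m. f m * g m)"
  unfolding fps_admissible_def using fps_agree_mult[where g = 1 and g' = 1] by fastforce

lemma fps_agree_one_minus_X_power:
  "m \<le> e \<Longrightarrow> 1 \<le> m \<Longrightarrow> fps_agree (m - 1) (1 - fps_X ^ e) 1"
  "m \<le> e \<Longrightarrow> 1 \<le> m \<Longrightarrow> fps_agree (m - 1) (1 + fps_X ^ e) 1"
  by (auto simp: fps_agree_def fps_X_power_nth)

lemma fps_admissible_one_minus:
  "(\<And>m. m \<ge> 1 \<Longrightarrow> e m \<ge> m) \<Longrightarrow> fps_admissible (\<lambda>m. 1 - fps_X ^ e m)"
  "(\<And>m. m \<ge> 1 \<Longrightarrow> e m \<ge> m) \<Longrightarrow> fps_admissible (\<lambda>m. 1 + fps_X ^ e m)"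
  unfolding fps_admissible_def using fps_agree_one_minus_X_power by blast+

lemma fps_agree_prod_mono:
  assumes "fps_admissible f" "n \<le> N" "n \<le> M"
  shows "fps_agree n (\<Prod>m\<in>{1..N}. f m) (\<Prod>m\<in>{1..M}. f m)"
proof -
  have "fps_agree n (\<Prod>m\<in>{1..N}. f m) (\<Prod>m\<in>{1..n}. f m)" if "n \<le> N" for N
    using that
  proof (induction N rule: dec_induct)
    case (step k)
    have "fps_agree n (f (Suc k)) 1"
      using assms(1) step unfolding fps_admissible_def
      by (metis One_nat_def Suc_le_mono diff_Suc_1 fps_agree_mono le0)
    then have "fps_agree n ((\<Prod>m\<in>{1..k}. f m) * f (Suc k)) ((\<Prod>m\<in>{1..n}. f m) * 1)"
      using step by (intro fps_agree_mult) auto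
    then show ?case by simp
  qed simp
  from this[OF assms(2)] this[OF assms(3)] show ?thesis
    by (blast intro: fps_agree_trans fps_agree_sym)
qed

lemma fps_agree_infprod:
  assumes "fps_admissible f" "n \<le> N"
  shows "fps_agree n (fps_infprod f) (\<Prod>m\<in>{1..N}. f m)"
  unfolding fps_agree_def
proof (intro allI impI)
  fix i assume "i \<le> n"
  then show "fps_nth (fps_infprod f) i = fps_nth (\<Prod>m\<in>{1..N}. f m) i"
    using fps_agree_nth[OF fps_agree_prod_mono[OF assms(1), of i i N]] assms(2)
    by (simp add: fps_infprod_def)
qed

lemma fps_infprod_eqI:
  assumes "\<And>n. \<exists>N\<ge>n. fps_agree n g (\<Prod>m\<in>{1..N}. f m)" "fps_admissible f"
  shows "fps_infprod f = g"
proof (rule fps_agree_imp_eq)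
  fix n
  from assms(1)[of n] obtain N where "N \<ge> n" "fps_agree n g (\<Prod>m\<in>{1..N}. f m)" by blast
  with fps_agree_infprod[OF assms(2), of n N] show "fps_agree n (fps_infprod f) g"
    by (blast intro: fps_agree_trans fps_agree_sym)
qed

lemma fps_infprod_mult:
  assumes "fps_admissible f" "fps_admissible g"
  shows "fps_infprod (\<lambda>m. f m * g m) = fps_infprod f * fps_infprod g"
proof (rule fps_infprod_eqI)
  fix n
  show "\<exists>N\<ge>n. fps_agree n (fps_infprod f * fps_infprod g) (\<Prod>m\<in>{1..N}. f m * g m)"
    using fps_agree_mult[OF fps_agree_infprod[OF assms(1), of n n] fps_agree_infprod[OF assms(2), of n n]]
    by (auto simp: prod.distrib)
qed (rule fps_admissible_mult[OF assms])

lemma fps_admissible_prod: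
  "finite S \<Longrightarrow> (\<And>i. i \<in> S \<Longrightarrow> fps_admissible (f i)) \<Longrightarrow> fps_admissible (\<lambda>m. \<Prod>i\<in>S. f i m)"
proof (induction S rule: finite_induct)
  case (insert i S)
  then have "fps_admissible (\<lambda>m. f i m * (\<Prod>i\<in>S. f i m))"
    by (intro fps_admissible_mult) auto
  then show ?case using insert by simp
qed (simp add: fps_admissible_def)

lemma fps_infprod_prod:
  "finite S \<Longrightarrow> (\<And>i. i \<in> S \<Longrightarrow> fps_admissible (f i)) \<Longrightarrow>
    fps_infprod (\<lambda>m. \<Prod>i\<in>S. f i m) = (\<Prod>i\<in>S. fps_infprod (f i))"
proof (induction S rule: finite_induct)
  case (insert i S)
  then have "fps_infprod (\<lambda>m. f i m * (\<Prod>i\<in>S. f i m)) = fps_infprod (f i) * fps_infprod (\<lambda>m. \<Prod>i\<in>S. f i m)"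
    by (intro fps_infprod_mult fps_admissible_prod) auto
  then show ?case using insert by simp
qed (simp add: fps_infprod_def fps_eq_iff)

lemma fps_infprod_cong:
  "(\<And>m. m \<ge> 1 \<Longrightarrow> f m = g m) \<Longrightarrow> fps_infprod f = fps_infprod g"
  by (auto simp: fps_infprod_def intro!: arg_cong[where f = Abs_fps] ext arg_cong2[where f = fps_nth] prod.cong)

lemma prod_blocks:
  fixes f :: "nat \<Rightarrow> 'a::comm_monoid_mult"
  shows "(\<Prod>m\<in>{1..b * N}. f m) = (\<Prod>u\<in>{1..N}. \<Prod>i\<in>{1..b}. f (b * (u - 1) + i))"
proof (induction N)
  case (Suc N)
  have "(\<Prod>m\<in>{1..b * Suc N}. f m) = (\<Prod>m\<in>{1..b * N}. f m) * (\<Prod>m\<in>{b * N + 1..b * N + b}. f m)"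
    using prod.ub_add_nat[of 1 "b * N" f b] by (simp add: add.commute)
  also have "(\<Prod>m\<in>{b * N + 1..b * N + b}. f m) = (\<Prod>i\<in>{1..b}. f (b * N + i))"
    using prod.shift_bounds_cl_nat_ivl[of f 1 "b * N" b] by (simp add: add.commute)
  finally show ?case using Suc by simp
qed simp

text \<open>The \<open>n\<close>-th partial product of the grouped factors is the
  \<open>(b * n)\<close>-th one of \<open>f\<close>. The splittings of Euler products by residue
  classes are instances.\<close>

lemma fps_infprod_blocks:
  assumes "fps_admissible f" "b \<ge> 1" "fps_admissible g"
    "\<And>u. u \<ge> 1 \<Longrightarrow> g u = (\<Prod>i\<in>{1..b}. f (b * (u - 1) + i))"
  shows "fps_infprod g = fps_infprod f"
proof (rule fps_infprod_eqI)
  fix n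
  have "n \<le> b * n" using assms(2) by simp
  from fps_agree_infprod[OF assms(1) this]
  have "fps_agree n (fps_infprod f) (\<Prod>u\<in>{1..n}. \<Prod>i\<in>{1..b}. f (b * (u - 1) + i))"
    by (simp add: prod_blocks)
  also have "(\<Prod>u\<in>{1..n}. \<Prod>i\<in>{1..b}. f (b * (u - 1) + i)) = (\<Prod>u\<in>{1..n}. g u)"
    using assms(4) by (intro prod.cong) auto
  finally show "\<exists>N\<ge>n. fps_agree n (fps_infprod f) (\<Prod>m\<in>{1..N}. g m)" by blast
qed fact

lemma fps_infprod_nth_0 [simp]: "fps_nth (fps_infprod f) 0 = 1"
  by (simp add: fps_infprod_def)

section \<open>The substitutions q -> -q and q -> q^2, and the operator U
  (\<open>fps_bisect\<close>)\<close>

definition fps_reflect :: "'a::comm_ring_1 fps \<Rightarrow> 'a fps" where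
  "fps_reflect f = f oo (- fps_X)"

definition fps_dilate :: "'a::idom fps \<Rightarrow> 'a fps" where
  "fps_dilate f = f oo (fps_X ^ 2)"

definition fps_bisect :: "'a fps \<Rightarrow> 'a fps" where
  "fps_bisect f = Abs_fps (\<lambda>n. fps_nth f (2 * n))"

lemma fps_reflect_nth: "fps_nth (fps_reflect f) n = (-1) ^ n * fps_nth f n"
  by (simp add: fps_reflect_def fps_compose_uminus')

lemma fps_dilate_nth: "fps_nth (fps_dilate f) n = (if even n then fps_nth f (n div 2) else 0)"
proof -
  have "fps_nth (fps_dilate f) n = (\<Sum>i = 0..n. fps_nth f i * (if n = 2 * i then 1 else 0))"
    by (simp add: fps_dilate_def fps_compose_nth power_mult[symmetric] fps_X_power_nth)
  also have "\<dots> = (\<Sum>i = 0..n. if i = n div 2 then (if even n then fps_nth f i else 0) else 0)"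
    by (rule sum.cong) auto
  finally show ?thesis by (simp add: sum.delta)
qed

lemma fps_bisect_nth [simp]: "fps_nth (fps_bisect f) n = fps_nth f (2 * n)"
  by (simp add: fps_bisect_def)

lemma fps_reflect_mult [simp]: "fps_reflect (f * g) = fps_reflect f * fps_reflect (g :: 'a::idom fps)"
  by (simp add: fps_reflect_def fps_compose_mult_distrib)

lemma fps_reflect_power [simp]: "fps_reflect (f ^ n) = fps_reflect (f :: 'a::idom fps) ^ n"
  by (simp add: fps_reflect_def fps_compose_power)

lemma fps_reflect_simps [simp]:
  "fps_reflect (f + g) = fps_reflect f + fps_reflect g"
  "fps_reflect (f - g) = fps_reflect f - fps_reflect g"
  "fps_reflect (- f) = - fps_reflect f"
  "fps_reflect 0 = 0" "fps_reflect 1 = 1" "fps_reflect (numeral k) = numeral k"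
  "fps_reflect fps_X = - fps_X"
  by (simp_all add: fps_reflect_def fps_compose_add_distrib fps_compose_sub_distrib fps_compose_uminus)

lemma fps_reflect_prod: "fps_reflect (prod f S) = (\<Prod>j\<in>S. fps_reflect (f j :: 'a::idom fps))"
  by (induction S rule: infinite_finite_induct) auto

lemma fps_dilate_mult [simp]: "fps_dilate (f * g) = fps_dilate f * fps_dilate g"
  by (simp add: fps_dilate_def fps_compose_mult_distrib)

lemma fps_dilate_power [simp]: "fps_dilate (f ^ n) = fps_dilate f ^ n"
  by (simp add: fps_dilate_def fps_compose_power)

lemma fps_dilate_simps [simp]:
  "fps_dilate (f + g) = fps_dilate f + fps_dilate g"
  "fps_dilate (f - g) = fps_dilate f - fps_dilate g"
  "fps_dilate (- f) = - fps_dilate f"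
  "fps_dilate 0 = 0" "fps_dilate 1 = 1" "fps_dilate (numeral k) = numeral k"
  "fps_dilate fps_X = fps_X ^ 2"
  by (simp_all add: fps_dilate_def fps_compose_add_distrib fps_compose_sub_distrib fps_compose_uminus)

lemma fps_dilate_prod: "fps_dilate (prod f S) = (\<Prod>j\<in>S. fps_dilate (f j))"
  by (induction S rule: infinite_finite_induct) auto

lemma fps_dilate_eq_iff [simp]: "fps_dilate f = fps_dilate g \<longleftrightarrow> f = g"
proof
  assume *: "fps_dilate f = fps_dilate g"
  show "f = g"
  proof (rule fps_ext)
    fix n show "fps_nth f n = fps_nth g n"
      using arg_cong[OF *, of "\<lambda>h. fps_nth h (2 * n)"] by (simp add: fps_dilate_nth)
  qed
qed simp

lemma fps_reflect_dilate [simp]: "fps_reflect (fps_dilate f) = fps_dilate f"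
  by (rule fps_ext) (simp add: fps_reflect_nth fps_dilate_nth)

text \<open>Describes U through f(q) + f(-q), so that bisections can be computed from product
  formulas without looking at coefficients.\<close>

lemma fps_dilate_bisect: "2 * fps_dilate (fps_bisect f) = f + fps_reflect f"
  by (rule fps_ext) (simp add: fps_reflect_nth fps_dilate_nth numeral_fps_const)

lemma fps_bisect_dilate [simp]: "fps_bisect (fps_dilate f) = f"
  by (rule fps_ext) (simp add: fps_dilate_nth)

text \<open>A series in q^2 is fixed by q -> -q and therefore passes through U.\<close>

lemma fps_bisect_dilate_mult: "fps_bisect (fps_dilate f * g) = f * fps_bisect (g :: 'a::{idom,ring_char_0} fps)"
proof -
  have "2 * fps_dilate (fps_bisect (fps_dilate f * g)) = 2 * fps_dilate (f * fps_bisect g)"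
    by (simp add: fps_dilate_bisect mult.left_commute[of 2] distrib_left)
  then have "fps_dilate (fps_bisect (fps_dilate f * g)) = fps_dilate (f * fps_bisect g)"
    by (simp del: fps_dilate_mult)
  then show ?thesis by (simp only: fps_dilate_eq_iff)
qed

lemma fps_bisect_simps [simp]:
  "fps_bisect (f + g) = fps_bisect f + fps_bisect g"
  "fps_bisect (f - g) = fps_bisect f - (fps_bisect g :: 'a::ring_1 fps)"
  by (auto intro!: fps_ext)

lemma fps_bisect_eqI:
  fixes f g :: "'a::{idom,ring_char_0} fps"
  assumes "f + fps_reflect f = 2 * fps_dilate g"
  shows "fps_bisect f = g"
  using assms fps_dilate_bisect[of f] by simp

section \<open>Euler products: odd factors, dilation and change of sign\<close>

lemma Eul_eq_infprod: "Eul a = fps_infprod (\<lambda>m. 1 - fps_X ^ (a * m))"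
  by (simp add: Eul_def fps_infprod_def)

lemma Eul_admissible: "a \<ge> 1 \<Longrightarrow> fps_admissible (\<lambda>m. 1 - fps_X ^ (a * m))"
  by (rule fps_admissible_one_minus) simp

lemma Eul_nth_0 [simp]: "fps_nth (Eul a) 0 = 1"
  by (simp add: Eul_eq_infprod)

text \<open>The q-Pochhammer symbol with first exponent \<open>a\<close> and step
  \<open>2 * a\<close>.\<close>

definition Odd_prod :: "nat \<Rightarrow> rat fps" where
  "Odd_prod a = fps_infprod (\<lambda>m. 1 - fps_X ^ (a * (2 * m - 1)))"

lemma Odd_prod_nth_0 [simp]: "fps_nth (Odd_prod a) 0 = 1"
  by (simp add: Odd_prod_def)

lemma le_mult_odd: "a \<ge> 1 \<Longrightarrow> m \<ge> 1 \<Longrightarrow> m \<le> a * (2 * m - 1)" for a m :: nat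
  using mult_le_mono[of 1 a m "2 * m - 1"] by simp

lemma Odd_prod_admissible: "a \<ge> 1 \<Longrightarrow> fps_admissible (\<lambda>m. 1 - fps_X ^ (a * (2 * m - 1)))"
  by (rule fps_admissible_one_minus) (rule le_mult_odd)

lemma Eul_odd_even: "a \<ge> 1 \<Longrightarrow> Eul a = Odd_prod a * Eul (2 * a)"
proof -
  assume a: "a \<ge> 1"
  have "fps_infprod (\<lambda>m. (1 - fps_X ^ (a * (2 * m - 1))) * (1 - fps_X ^ (2 * a * m)))
      = (fps_infprod (\<lambda>m. 1 - fps_X ^ (a * m)) :: rat fps)"
  proof (rule fps_infprod_blocks[where b = 2])
    show "fps_admissible (\<lambda>m. 1 - fps_X ^ (a * m))" using a by (rule Eul_admissible)
    show "fps_admissible (\<lambda>m. (1 - fps_X ^ (a * (2 * m - 1))) * (1 - fps_X ^ (2 * a * m)))"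
      using a by (intro fps_admissible_mult Odd_prod_admissible Eul_admissible) auto
    fix u :: nat assume "u \<ge> 1"
    then have "2 * (u - 1) + 1 = 2 * u - 1" "2 * (u - 1) + 2 = 2 * u" by auto
    moreover have "{1..2::nat} = {1, 2}" by auto
    ultimately show "(1 - fps_X ^ (a * (2 * u - 1))) * (1 - fps_X ^ (2 * a * u)) =
      (\<Prod>i\<in>{1..2}. 1 - fps_X ^ (a * (2 * (u - 1) + i)) :: rat fps)"
      by (simp add: mult_ac)
  qed auto
  moreover have "fps_infprod (\<lambda>m. (1 - fps_X ^ (a * (2 * m - 1))) * (1 - fps_X ^ (2 * a * m)))
      = (Odd_prod a * Eul (2 * a) :: rat fps)"
    unfolding Odd_prod_def Eul_eq_infprod
    using a by (intro fps_infprod_mult Odd_prod_admissible Eul_admissible) auto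
  ultimately show ?thesis by (simp add: Eul_eq_infprod)
qed

lemma fps_agree_reflect: "fps_agree n f g \<Longrightarrow> fps_agree n (fps_reflect f) (fps_reflect g)"
  by (simp add: fps_agree_def fps_reflect_nth)

lemma fps_agree_dilate: "fps_agree n f g \<Longrightarrow> fps_agree n (fps_dilate f) (fps_dilate g)"
  by (auto simp: fps_agree_def fps_dilate_nth)

lemma fps_reflect_infprod:
  fixes f :: "nat \<Rightarrow> 'a::idom fps"
  assumes "fps_admissible f"
  shows "fps_reflect (fps_infprod f) = fps_infprod (\<lambda>m. fps_reflect (f m))"
proof (rule sym, rule fps_infprod_eqI)
  fix n
  show "\<exists>N\<ge>n. fps_agree n (fps_reflect (fps_infprod f)) (\<Prod>m\<in>{1..N}. fps_reflect (f m))"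
    using fps_agree_reflect[OF fps_agree_infprod[OF assms, of n n]] by (auto simp: fps_reflect_prod)
  show "fps_admissible (\<lambda>m. fps_reflect (f m))"
    using assms fps_agree_reflect by (fastforce simp: fps_admissible_def)
qed

lemma fps_dilate_infprod:
  fixes f :: "nat \<Rightarrow> 'a::idom fps"
  assumes "fps_admissible f"
  shows "fps_dilate (fps_infprod f) = fps_infprod (\<lambda>m. fps_dilate (f m))"
proof (rule sym, rule fps_infprod_eqI)
  fix n
  show "\<exists>N\<ge>n. fps_agree n (fps_dilate (fps_infprod f)) (\<Prod>m\<in>{1..N}. fps_dilate (f m))"
    using fps_agree_dilate[OF fps_agree_infprod[OF assms, of n n]] by (auto simp: fps_dilate_prod)
  show "fps_admissible (\<lambda>m. fps_dilate (f m))"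
    using assms fps_agree_dilate by (fastforce simp: fps_admissible_def)
qed

lemma fps_dilate_Eul: "a \<ge> 1 \<Longrightarrow> fps_dilate (Eul a) = Eul (2 * a)"
  by (simp add: Eul_eq_infprod fps_dilate_infprod Eul_admissible power_mult[symmetric] mult.assoc mult.left_commute)

lemma fps_reflect_Odd_prod:
  assumes "odd a"
  shows "fps_reflect (Odd_prod a) = fps_infprod (\<lambda>m. 1 + fps_X ^ (a * (2 * m - 1)))"
proof -
  have a: "a \<ge> 1" using assms by (cases a) auto
  have "fps_reflect (Odd_prod a) = fps_infprod (\<lambda>m. fps_reflect (1 - fps_X ^ (a * (2 * m - 1))))"
    unfolding Odd_prod_def using a by (intro fps_reflect_infprod Odd_prod_admissible)
  also have "\<dots> = fps_infprod (\<lambda>m. 1 + fps_X ^ (a * (2 * m - 1)))"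
    using assms by (intro fps_infprod_cong) (auto simp: power_minus_odd)
  finally show ?thesis .
qed

lemma one_plus_square: "(1 + x ^ e) * (1 - x ^ e) = 1 - x ^ (2 * e)" for x :: "'a::comm_ring_1"
  by (simp add: algebra_simps mult_2_right power_add)

lemma fps_reflect_Odd_prod_mult:
  assumes "odd a"
  shows "fps_reflect (Odd_prod a) * Odd_prod a = Odd_prod (2 * a)"
proof -
  have a: "a \<ge> 1" using assms by (cases a) auto
  have "fps_reflect (Odd_prod a) * Odd_prod a =
      fps_infprod (\<lambda>m. (1 + fps_X ^ (a * (2 * m - 1))) * (1 - fps_X ^ (a * (2 * m - 1))))"
    unfolding fps_reflect_Odd_prod[OF assms] unfolding Odd_prod_def using a
    by (intro fps_infprod_mult [symmetric] fps_admissible_one_minus le_mult_odd)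
  also have "\<dots> = Odd_prod (2 * a)"
    unfolding Odd_prod_def
    by (intro fps_infprod_cong) (simp add: one_plus_square mult.assoc)
  finally show ?thesis .
qed

lemma fps_reflect_Eul_even: "even a \<Longrightarrow> a \<ge> 1 \<Longrightarrow> fps_reflect (Eul a) = Eul a"
  by (metis fps_dilate_Eul fps_reflect_dilate One_nat_def Suc_leI dvdE gr0I mult_is_0 not_one_le_zero)

text \<open>Only the factors with odd index change under q -> -q, and they pair up by (1 + x)(1 - x)
  = 1 - x^2. This is E(-q) = E(q^2)^3 / (E(q) E(q^4)) without the division.\<close>

lemma fps_reflect_Eul_odd:
  assumes "odd a"
  shows "fps_reflect (Eul a) * (Eul a * Eul (4 * a)) = Eul (2 * a) ^ 3"
proof -
  have a: "a \<ge> 1" using assms by (cases a) auto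
  have 1: "Eul a = Odd_prod a * Eul (2 * a)" using Eul_odd_even[OF a] .
  have 2: "Eul (2 * a) = Odd_prod (2 * a) * Eul (4 * a)" using Eul_odd_even[of "2 * a"] a by simp
  have "fps_reflect (Eul a) * (Eul a * Eul (4 * a)) =
     (fps_reflect (Odd_prod a) * Odd_prod a) * Eul (4 * a) * Eul (2 * a) * Eul (2 * a)"
    using a by (simp add: 1 fps_reflect_Eul_even)
  also have "\<dots> = Eul (2 * a) ^ 3"
    by (simp add: fps_reflect_Odd_prod_mult[OF assms] 2[symmetric] power3_eq_cube)
  finally show ?thesis .
qed

subsection \<open>The generating function of PDO\<close>

definition msets_over :: "nat set \<Rightarrow> nat \<Rightarrow> nat multiset set" where
  "msets_over S n = {M. set_mset M \<subseteq> S \<and> sum_mset M = n}"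

definition desig_sum :: "nat set \<Rightarrow> nat \<Rightarrow> nat" where
  "desig_sum S n = (\<Sum>M\<in>msets_over S n. \<Prod>x\<in>set_mset M. count M x)"

text \<open>The series x / (1 - x)^2 at x = q^j: a part \<open>j\<close> that occurs k >= 1 times
  has weight k. Absence of the part, of weight 1, is the 1 in
  \<open>1 + mult_series j\<close>.\<close>

definition mult_series :: "nat \<Rightarrow> rat fps" where
  "mult_series j = Abs_fps (\<lambda>n. if j dvd n then of_nat (n div j) else 0)"

lemma msets_over_empty: "msets_over {} n = (if n = 0 then {{#}} else {})"
  by (auto simp: msets_over_def)

lemma msets_over_insert:
  assumes "x \<notin> S"
  shows "msets_over (insert x S) n =
    (\<Union>k\<in>{k. k * x \<le> n}. (\<lambda>M. M + replicate_mset k x) ` msets_over S (n - k * x))"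
proof (intro equalityI subsetI)
  fix M assume M: "M \<in> msets_over (insert x S) n"
  define M' where "M' = filter_mset (\<lambda>y. y \<noteq> x) M"
  have eq: "M = M' + replicate_mset (count M x) x"
    by (rule multiset_eqI) (auto simp: M'_def)
  have "sum_mset M = sum_mset M' + count M x * x"
    by (subst eq) (simp add: sum_mset_replicate_mset)
  then have "count M x * x \<le> n" "sum_mset M' = n - count M x * x"
    using M by (auto simp: msets_over_def)
  moreover have "set_mset M' \<subseteq> S" using M by (auto simp: M'_def msets_over_def)
  ultimately show "M \<in> (\<Union>k\<in>{k. k * x \<le> n}. (\<lambda>M. M + replicate_mset k x) ` msets_over S (n - k * x))"
    using eq by (auto simp: msets_over_def)
qed (auto simp: msets_over_def sum_mset_replicate_mset split: if_splits)

lemma finite_multiples_le: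
  assumes "x > 0"
  shows "finite {k. k * x \<le> (n::nat)}"
proof (rule finite_subset[of _ "{..n}"])
  show "{k. k * x \<le> n} \<subseteq> {..n}" using assms by (cases x) auto
qed simp

lemma finite_msets_over: "finite S \<Longrightarrow> 0 \<notin> S \<Longrightarrow> finite (msets_over S n)"
proof (induction S arbitrary: n rule: finite_induct)
  case (insert x S)
  then show ?case by (subst msets_over_insert) (auto simp: finite_multiples_le)
qed (simp add: msets_over_empty)

text \<open>The multisets are sorted by the multiplicity \<open>k\<close> of \<open>x\<close>. For k
  = 0 the weight is 1, not 0, because an absent part contributes no factor to the product.\<close>

lemma desig_sum_insert:
  assumes "finite S" "x \<notin> S" "0 \<notin> insert x S"
  shows "desig_sum (insert x S) n =
    (\<Sum>k\<in>{k. k * x \<le> n}. (if k = 0 then 1 else k) * desig_sum S (n - k * x))"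
proof -
  have x0: "x > 0" using assms(3) by auto
  have cnt: "count M x = 0" if "M \<in> msets_over S m" for M m
    using that assms(2) by (auto simp: msets_over_def count_eq_zero_iff)
  have "desig_sum (insert x S) n = (\<Sum>k\<in>{k. k * x \<le> n}.
     \<Sum>M\<in>(\<lambda>M. M + replicate_mset k x) ` msets_over S (n - k * x). \<Prod>x\<in>set_mset M. count M x)"
    unfolding desig_sum_def msets_over_insert[OF assms(2)]
  proof (rule sum.UNION_disjoint)
    show "\<forall>i\<in>{k. k * x \<le> n}. \<forall>j\<in>{k. k * x \<le> n}. i \<noteq> j \<longrightarrow>
      (\<lambda>M. M + replicate_mset i x) ` msets_over S (n - i * x) \<inter>
      (\<lambda>M. M + replicate_mset j x) ` msets_over S (n - j * x) = {}"
    proof (intro ballI impI equals0I)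
      fix i j M assume "i \<noteq> j" "M \<in> (\<lambda>M. M + replicate_mset i x) ` msets_over S (n - i * x) \<inter>
        (\<lambda>M. M + replicate_mset j x) ` msets_over S (n - j * x)"
      then obtain A B where AB: "M = A + replicate_mset i x" "M = B + replicate_mset j x"
        "A \<in> msets_over S (n - i * x)" "B \<in> msets_over S (n - j * x)" by blast
      have "count M x = i" using cnt[OF AB(3)] by (subst AB(1)) simp
      moreover have "count M x = j" using cnt[OF AB(4)] by (subst AB(2)) simp
      ultimately have "i = j" by simp
      with \<open>i \<noteq> j\<close> show False by simp
    qed
  qed (use assms x0 in \<open>auto simp: finite_multiples_le finite_msets_over\<close>)
  also have "\<dots> = (\<Sum>k\<in>{k. k * x \<le> n}. (if k = 0 then 1 else k) * desig_sum S (n - k * x))"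
  proof (rule sum.cong[OF refl])
    fix k assume "k \<in> {k. k * x \<le> n}"
    have "(\<Sum>M\<in>(\<lambda>M. M + replicate_mset k x) ` msets_over S (n - k * x). \<Prod>x\<in>set_mset M. count M x)
       = (\<Sum>M\<in>msets_over S (n - k * x). \<Prod>y\<in>set_mset (M + replicate_mset k x). count (M + replicate_mset k x) y)"
      by (subst sum.reindex) (auto simp: inj_on_def)
    also have "\<dots> = (\<Sum>M\<in>msets_over S (n - k * x). (if k = 0 then 1 else k) * (\<Prod>y\<in>set_mset M. count M y))"
    proof (rule sum.cong[OF refl])
      fix M assume M: "M \<in> msets_over S (n - k * x)"
      have nin: "x \<notin> set_mset M" using M assms(2) by (auto simp: msets_over_def)
      show "(\<Prod>y\<in>set_mset (M + replicate_mset k x). count (M + replicate_mset k x) y) =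
        (if k = 0 then 1 else k) * (\<Prod>y\<in>set_mset M. count M y)"
      proof (cases "k = 0")
        case False
        then have "set_mset (M + replicate_mset k x) = insert x (set_mset M)" by auto
        moreover have "(\<Prod>y\<in>set_mset M. count (M + replicate_mset k x) y) = (\<Prod>y\<in>set_mset M. count M y)"
          using nin by (intro prod.cong) auto
        ultimately show ?thesis using False nin cnt[OF M] by simp
      qed simp
    qed
    finally show "(\<Sum>M\<in>(\<lambda>M. M + replicate_mset k x) ` msets_over S (n - k * x). \<Prod>x\<in>set_mset M. count M x)
      = (if k = 0 then 1 else k) * desig_sum S (n - k * x)"
      by (simp add: desig_sum_def sum_distrib_left)
  qed
  finally show ?thesis .
qed

lemma one_plus_mult_series_nth:
  "j > 0 \<Longrightarrow> fps_nth (1 + mult_series j) n = (if j dvd n then of_nat (if n = 0 then 1 else n div j) else 0)"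
  by (auto simp: mult_series_def)

lemma desig_sum_gf:
  "finite S \<Longrightarrow> 0 \<notin> S \<Longrightarrow> Abs_fps (\<lambda>n. of_nat (desig_sum S n)) = (\<Prod>j\<in>S. 1 + mult_series j)"
proof (induction S rule: finite_induct)
  case empty
  show ?case by (rule fps_ext) (auto simp: desig_sum_def msets_over_empty)
next
  case (insert x S)
  then have x0: "x > 0" by auto
  have "Abs_fps (\<lambda>n. of_nat (desig_sum (insert x S) n)) =
      (1 + mult_series x) * Abs_fps (\<lambda>n. of_nat (desig_sum S n))"
  proof (rule fps_ext)
    fix n
    have "fps_nth ((1 + mult_series x) * Abs_fps (\<lambda>n. of_nat (desig_sum S n))) n =
      (\<Sum>i\<in>{0..n}. if x dvd i then of_nat (if i = 0 then 1 else i div x) * of_nat (desig_sum S (n - i)) else 0)"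
      unfolding fps_mult_nth one_plus_mult_series_nth[OF x0] by (intro sum.cong) auto
    also have "\<dots> = (\<Sum>i\<in>{i\<in>{0..n}. x dvd i}. of_nat (if i = 0 then 1 else i div x) * of_nat (desig_sum S (n - i)))"
      by (rule sum.inter_filter[symmetric]) simp
    also have "\<dots> = (\<Sum>k\<in>{k. k * x \<le> n}. of_nat (if k = 0 then 1 else k) * of_nat (desig_sum S (n - k * x)))"
      by (rule sum.reindex_bij_witness[of _ "\<lambda>k. k * x" "\<lambda>i. i div x"]) (use x0 in auto)
    also have "\<dots> = of_nat (desig_sum (insert x S) n)"
      using insert by (subst desig_sum_insert) auto
    finally show "fps_nth (Abs_fps (\<lambda>n. of_nat (desig_sum (insert x S) n))) n =
       fps_nth ((1 + mult_series x) * Abs_fps (\<lambda>n. of_nat (desig_sum S n))) n" by simp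
  qed
  then show ?case using insert by simp
qed

definition PDO_gf :: "rat fps" where
  "PDO_gf = Abs_fps (\<lambda>n. of_nat (PDO n))"

text \<open>No part exceeds \<open>n\<close>, so the odd numbers up to 2n - 1 suffice; they are also
  the parts seen by the \<open>n\<close>-th partial product.\<close>

lemma PDO_eq_desig_sum: "PDO n = desig_sum ((\<lambda>m. 2 * m - 1) ` {1..n}) n"
proof -
  have "(\<forall>x\<in>#M. odd x) \<longleftrightarrow> set_mset M \<subseteq> (\<lambda>m. 2 * m - 1) ` {1..n}"
    if sum: "sum_mset M = n" for M :: "nat multiset"
  proof
    assume odd: "\<forall>x\<in>#M. odd x"
    show "set_mset M \<subseteq> (\<lambda>m. 2 * m - 1) ` {1..n}"
    proof
      fix x assume "x \<in># M"
      with odd obtain m where m: "x = 2 * m + 1" by (blast elim: oddE)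
      have "x \<le> n" using \<open>x \<in># M\<close> sum by (metis sum_mset.remove le_add1)
      then show "x \<in> (\<lambda>m. 2 * m - 1) ` {1..n}" using m by (intro image_eqI[of _ _ "Suc m"]) auto
    qed
  qed auto
  then have "{M :: nat multiset. (\<forall>x\<in>#M. odd x) \<and> sum_mset M = n} = msets_over ((\<lambda>m. 2 * m - 1) ` {1..n}) n"
    unfolding msets_over_def by blast
  then show ?thesis by (simp add: PDO_def desig_sum_def)
qed

lemma mult_series_admissible: "fps_admissible (\<lambda>m. 1 + mult_series (2 * m - 1))"
  unfolding fps_admissible_def fps_agree_def
proof (intro allI impI)
  fix m i :: nat assume "m \<ge> 1" "i \<le> m - 1"
  then have "i < 2 * m - 1" by auto
  then show "fps_nth (1 + mult_series (2 * m - 1)) i = fps_nth 1 i"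
    by (auto simp: mult_series_def dest: dvd_imp_le)
qed

lemma PDO_gf_infprod: "PDO_gf = fps_infprod (\<lambda>m. 1 + mult_series (2 * m - 1))"
proof (rule fps_ext)
  fix n
  have "fps_nth PDO_gf n = fps_nth (Abs_fps (\<lambda>k. of_nat (desig_sum ((\<lambda>m. 2 * m - 1) ` {1..n}) k))) n"
    by (simp add: PDO_gf_def PDO_eq_desig_sum)
  also have "\<dots> = fps_nth (\<Prod>j\<in>(\<lambda>m. 2 * m - 1) ` {1..n}. 1 + mult_series j) n"
    by (subst desig_sum_gf) auto
  also have "(\<Prod>j\<in>(\<lambda>m. 2 * m - 1) ` {1..n}. 1 + mult_series j) = (\<Prod>m\<in>{1..n}. 1 + mult_series (2 * m - 1))"
    by (subst prod.reindex) (auto simp: inj_on_def)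
  finally show "fps_nth PDO_gf n = fps_nth (fps_infprod (\<lambda>m. 1 + mult_series (2 * m - 1))) n"
    by (simp add: fps_infprod_def)
qed

lemma one_minus_X_power_mult_nth:
  "fps_nth ((1 - fps_X ^ j) * f) n = fps_nth f n - (if n < j then 0 else fps_nth f (n - j) :: rat)"
  by (simp add: left_diff_distrib fps_X_power_mult_nth)

text \<open>Multiplication by 1 - q^j takes differences at distance j: the coefficients k at q^(jk)
  become 1, and a second difference leaves only the first of them.\<close>

lemma mult_series_eq:
  assumes "j > 0"
  shows "(1 - fps_X ^ j) * ((1 - fps_X ^ j) * mult_series j) = fps_X ^ j"
proof -
  have 1: "(1 - fps_X ^ j) * mult_series j = Abs_fps (\<lambda>n. if j dvd n \<and> n > 0 then 1 else 0)"
  proof (rule fps_ext)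
    fix n
    show "fps_nth ((1 - fps_X ^ j) * mult_series j) n = fps_nth (Abs_fps (\<lambda>n. if j dvd n \<and> n > 0 then 1 else 0)) n"
    proof (cases "n < j")
      case True
      then show ?thesis by (auto simp: one_minus_X_power_mult_nth mult_series_def)
    next
      case False
      then obtain k where "n = j + k" by (metis le_add_diff_inverse not_less)
      then show ?thesis using assms by (auto simp: one_minus_X_power_mult_nth mult_series_def)
    qed
  qed
  show ?thesis
  proof (rule fps_ext)
    fix n
    show "fps_nth ((1 - fps_X ^ j) * ((1 - fps_X ^ j) * mult_series j)) n = fps_nth (fps_X ^ j) n"
    proof (cases "n < j")
      case True
      then show ?thesis by (auto simp: 1 one_minus_X_power_mult_nth fps_X_power_nth dest: dvd_imp_le)
    next
      case False
      then obtain k where "n = j + k" by (metis le_add_diff_inverse not_less)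
      then show ?thesis using assms by (auto simp: 1 one_minus_X_power_mult_nth fps_X_power_nth)
    qed
  qed
qed

text \<open>With x = q^(2m-1), the local factor is 1 + x/(1-x)^2 = (1 - x + x^2)/(1-x)^2 = (1 +
  x^3)/((1-x)^2 (1+x)). The factors 1 + x and 1 + x^3 are reflections of \<open>Odd_prod 1\<close>
  and \<open>Odd_prod 3\<close> and are removed by \<open>fps_reflect_Odd_prod_mult\<close>.\<close>

lemma PDO_gf_Odd_prod: "Odd_prod 1 * Odd_prod 2 * Odd_prod 3 * PDO_gf = Odd_prod 6"
proof -
  let ?j = "\<lambda>m::nat. 2 * m - 1"
  have adm: "fps_admissible (\<lambda>m. 1 - fps_X ^ ?j m :: rat fps)" "fps_admissible (\<lambda>m. 1 + fps_X ^ ?j m :: rat fps)"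
    by (rule fps_admissible_one_minus; simp)+
  have "Odd_prod 1 * (Odd_prod 1 * (fps_reflect (Odd_prod 1) * PDO_gf)) =
     fps_infprod (\<lambda>m. (1 - fps_X ^ ?j m) * ((1 - fps_X ^ ?j m) * ((1 + fps_X ^ ?j m) * (1 + mult_series (?j m)))))"
    using adm mult_series_admissible
    by (simp add: fps_infprod_mult fps_admissible_mult fps_reflect_Odd_prod PDO_gf_infprod)
       (simp add: Odd_prod_def)
  also have "\<dots> = fps_infprod (\<lambda>m. 1 + fps_X ^ (3 * ?j m))"
  proof (rule fps_infprod_cong)
    fix m :: nat assume "m \<ge> 1"
    define X :: "rat fps" where "X = fps_X ^ ?j m"
    have e1: "(1 - X) * ((1 - X) * mult_series (?j m)) = X"
      unfolding X_def using \<open>m \<ge> 1\<close> by (intro mult_series_eq) auto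
    have e2: "(1 - X) * ((1 - X) * ((1 + X) * (1 + w))) = (1 + X) * ((1 - X) * (1 - X) + (1 - X) * ((1 - X) * w))"
      for w by (simp add: algebra_simps)
    have e3: "(1 + X) * ((1 - X) * (1 - X) + X) = 1 + X ^ 3" by (simp add: algebra_simps power3_eq_cube)
    have "(1 - X) * ((1 - X) * ((1 + X) * (1 + mult_series (?j m)))) = 1 + X ^ 3"
      by (simp only: e2 e1 e3)
    then show "(1 - fps_X ^ ?j m) * ((1 - fps_X ^ ?j m) * ((1 + fps_X ^ ?j m) * (1 + mult_series (?j m)))) =
        1 + fps_X ^ (3 * ?j m)"
      by (simp add: X_def power_mult[symmetric] mult.commute)
  qed
  also have "\<dots> = fps_reflect (Odd_prod 3)" by (simp add: fps_reflect_Odd_prod)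
  finally have "Odd_prod 1 * (Odd_prod 1 * (fps_reflect (Odd_prod 1) * PDO_gf)) = fps_reflect (Odd_prod 3)" .
  then have "Odd_prod 1 * (fps_reflect (Odd_prod 1) * Odd_prod 1) * PDO_gf * Odd_prod 3 = fps_reflect (Odd_prod 3) * Odd_prod 3"
    by (metis mult.commute mult.left_commute)
  then show ?thesis
    by (simp add: fps_reflect_Odd_prod_mult) (simp add: mult_ac)
qed

lemma PDO_gf_Eul: "PDO_gf * (Eul 1 * Eul 3 * Eul 12) = Eul 4 * Eul 6 ^ 2"
proof -
  have o: "Eul 1 = Odd_prod 1 * Eul 2" "Eul 2 = Odd_prod 2 * Eul 4" "Eul 3 = Odd_prod 3 * Eul 6"
    "Eul 6 = Odd_prod 6 * Eul 12"
    using Eul_odd_even[of 1] Eul_odd_even[of 2] Eul_odd_even[of 3] Eul_odd_even[of 6] by simp_all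
  have "PDO_gf * (Eul 1 * Eul 3 * Eul 12) =
     (Odd_prod 1 * Odd_prod 2 * Odd_prod 3 * PDO_gf) * Eul 12 * Eul 4 * Eul 6"
    unfolding o(1,3) unfolding o(2) by (simp add: mult_ac)
  also have "\<dots> = Eul 4 * Eul 6 ^ 2"
    unfolding PDO_gf_Odd_prod o(4)[symmetric] by (simp add: power2_eq_square)
  finally show ?thesis .
qed

subsection \<open>A Lambert series with a product formula\<close>

lemma lagrange_interpolation:
  fixes p :: "'a::field poly" and x :: "'b \<Rightarrow> 'a"
  assumes "finite S" "inj_on x S" "degree p < card S"
  shows "poly p t = (\<Sum>i\<in>S. poly p (x i) * (\<Prod>j\<in>S - {i}. (t - x j) / (x i - x j)))"
proof -
  define b where "b i = smult (poly p (x i) * (\<Prod>j\<in>S - {i}. inverse (x i - x j))) (\<Prod>j\<in>S - {i}. [:- x j, 1:])" for i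
  have b: "poly (b i) t = poly p (x i) * (\<Prod>j\<in>S - {i}. (t - x j) / (x i - x j))" for i t
    by (simp add: b_def poly_prod divide_inverse prod.distrib mult_ac)
  have "p = (\<Sum>i\<in>S. b i)"
  proof (rule poly_eqI_degree)
    show "degree p < card (x ` S)" using assms by (simp add: card_image)
    have "degree (b i) < card S" if "i \<in> S" for i
    proof -
      have "degree (b i) \<le> degree (\<Prod>j\<in>S - {i}. [:- x j, 1:])"
        unfolding b_def by (rule degree_smult_le)
      also have "\<dots> \<le> sum (degree \<circ> (\<lambda>j. [:- x j, 1:])) (S - {i})"
        by (rule degree_prod_sum_le) (use assms in auto)
      also have "\<dots> = card S - 1" using assms(1) that by simp
      also have "\<dots> < card S" using assms(3) by simp
      finally show ?thesis .
    qed
    then show "degree (\<Sum>i\<in>S. b i) < card (x ` S)"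
      using assms by (simp add: card_image) (intro degree_sum_less, auto)
    fix y assume "y \<in> x ` S"
    then obtain k where k: "k \<in> S" "y = x k" by blast
    have "poly (\<Sum>i\<in>S. b i) y = (\<Sum>i\<in>S. if i = k then poly p y else 0)"
      unfolding poly_sum
    proof (rule sum.cong[OF refl])
      fix i assume i: "i \<in> S"
      show "poly (b i) y = (if i = k then poly p y else 0)"
      proof (cases "i = k")
        case True
        then have "(\<Prod>j\<in>S - {i}. (y - x j) / (x i - x j)) = 1"
          using k assms(2) by (intro prod.neutral) (auto simp: inj_on_def)
        then show ?thesis using True k by (simp add: b)
      next
        case False
        then have "(\<Prod>j\<in>S - {i}. (y - x j) / (x i - x j)) = 0"
          using k assms(1) by (intro prod_zero) auto
        then show ?thesis using False by (simp add: b)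
      qed
    qed
    then show "poly p y = poly (\<Sum>i\<in>S. b i) y" using k assms(1) by simp
  qed
  then have "poly p t = (\<Sum>i\<in>S. poly (b i) t)" by (metis poly_sum)
  then show ?thesis by (simp add: b)
qed

lemma lagrange_partial_fractions:
  fixes p :: "'a::field poly" and x :: "'b \<Rightarrow> 'a"
  assumes "finite S" "inj_on x S" "degree p < card S" "\<And>i. i \<in> S \<Longrightarrow> t \<noteq> x i"
  shows "poly p t / (\<Prod>j\<in>S. t - x j) = (\<Sum>i\<in>S. poly p (x i) / (\<Prod>j\<in>S - {i}. x i - x j) / (t - x i))"
proof -
  have "poly p (x i) * (\<Prod>j\<in>S - {i}. (t - x j) / (x i - x j)) / (\<Prod>j\<in>S. t - x j) =
     poly p (x i) / (\<Prod>j\<in>S - {i}. x i - x j) / (t - x i)" if "i \<in> S" for i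
  proof -
    have "(\<Prod>j\<in>S. t - x j) = (t - x i) * (\<Prod>j\<in>S - {i}. t - x j)"
      using assms(1) that by (simp add: prod.remove)
    moreover have "(\<Prod>j\<in>S - {i}. t - x j) \<noteq> 0" using assms(1,4) by (auto simp: prod_zero_iff)
    ultimately show ?thesis by (simp add: prod_dividef)
  qed
  then show ?thesis
    unfolding lagrange_interpolation[OF assms(1-3), of t] sum_divide_distrib by (intro sum.cong) auto
qed

definition qprod :: "nat \<Rightarrow> (nat \<Rightarrow> nat) \<Rightarrow> 'a::comm_ring_1 \<Rightarrow> 'a" where
  "qprod M e q = (\<Prod>u\<in>{1..M}. 1 - q ^ e u)"

lemma prod_diff_split:
  fixes q :: "'a::comm_ring_1"
  shows "(\<And>s. s \<in> S \<Longrightarrow> y s \<le> x s) \<Longrightarrow>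
      (\<Prod>s\<in>S. q ^ x s - q ^ y s) = (\<Prod>s\<in>S. - (q ^ y s)) * (\<Prod>s\<in>S. 1 - q ^ (x s - y s))"
    and "(\<And>s. s \<in> S \<Longrightarrow> x s \<le> y s) \<Longrightarrow>
      (\<Prod>s\<in>S. q ^ x s - q ^ y s) = (\<Prod>s\<in>S. q ^ x s) * (\<Prod>s\<in>S. 1 - q ^ (y s - x s))"
  by (auto simp: prod.distrib[symmetric] right_diff_distrib power_add[symmetric] intro!: prod.cong)

text \<open>Here and in \<open>prod_diff_above\<close> the smaller power of q is pulled out of each
  difference. The index is reversed, u = m - s, so that for increasing \<open>y\<close> the gap
  nearest to \<open>x\<close> comes first.\<close>

lemma prod_diff_below:
  fixes q :: "'a::comm_ring_1"
  assumes "\<And>s. s < m \<Longrightarrow> y s \<le> x" "\<And>u. 1 \<le> u \<Longrightarrow> u \<le> m \<Longrightarrow> x - y (m - u) = e u"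
  shows "(\<Prod>s\<in>{..<m}. q ^ x - q ^ y s) = (\<Prod>s\<in>{..<m}. - (q ^ y s)) * qprod m e q"
proof -
  have "(\<Prod>s\<in>{..<m}. 1 - q ^ (x - y s)) = qprod m e q"
    unfolding qprod_def
    by (rule prod.reindex_bij_witness[of _ "\<lambda>u. m - u" "\<lambda>s. m - s"])
       (use assms(2)[of "m - _"] in auto)
  then show ?thesis using prod_diff_split(1)[of "{..<m}" y "\<lambda>_. x" q] assms(1) by simp
qed

lemma prod_diff_above:
  fixes q :: "'a::comm_ring_1"
  assumes "\<And>s. m \<le> s \<Longrightarrow> s < m + k \<Longrightarrow> x \<le> y s" "\<And>u. 1 \<le> u \<Longrightarrow> u \<le> k \<Longrightarrow> y (m + u - 1) - x = e u"
  shows "(\<Prod>s\<in>{m..<m + k}. q ^ x - q ^ y s) = q ^ (x * k) * qprod k e q"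
proof -
  have *: "y s - x = e (Suc s - m)" if "m \<le> s" "s < m + k" for s
    using assms(2)[of "Suc s - m"] that by simp
  have "(\<Prod>s\<in>{m..<m + k}. 1 - q ^ (y s - x)) = qprod k e q"
    unfolding qprod_def
    by (rule prod.reindex_bij_witness[of _ "\<lambda>u. m + u - 1" "\<lambda>s. Suc s - m"]) (auto simp: *)
  then show ?thesis using prod_diff_split(2)[of "{m..<m + k}" "\<lambda>_. x" y q] assms(1)
    by (simp add: power_mult)
qed

lemma qprod_nz:
  fixes q :: "'a::field"
  assumes "\<And>m. m \<ge> 1 \<Longrightarrow> q ^ m \<noteq> 1" "\<And>u. u \<ge> 1 \<Longrightarrow> e u \<ge> 1"
  shows "qprod M e q \<noteq> 0"
proof
  assume "qprod M e q = 0"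
  then obtain u where "u \<in> {1..M}" "q ^ e u = 1" by (auto simp: qprod_def prod_zero_iff)
  with assms(1)[of "e u"] assms(2)[of u] show False by simp
qed

lemma prod_eq_union:
  "S = A \<union> B \<Longrightarrow> finite A \<Longrightarrow> finite B \<Longrightarrow> A \<inter> B = {} \<Longrightarrow> prod f A = x \<Longrightarrow> prod f B = y \<Longrightarrow>
    prod f S = x * y"
  by (simp add: prod.union_disjoint)

text \<open>The summands j and -j of the bilateral series of q^j / (1 - q^(lj+1)); the second is
  multiplied out so that its exponents are nonnegative for j >= 1.\<close>

abbreviation "qlam_term l q j \<equiv> (q ^ j / (1 - q ^ (l * j + 1)))"
abbreviation "qlam_term' l q j \<equiv> (- (q ^ ((l - 1) * j - 1)) / (1 - q ^ (l * j - 1)))"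

text \<open>
  Partial fractions of \<open>\<Prod>_{s<2N} (t - q Q^s) / \<Prod>_{j\<le>2N} (t - Q^j)\<close>, where \<open>Q = q^l\<close>, evaluated at
  \<open>t = Q^N / q\<close>; the index \<open>N + j\<close> corresponds to the summand \<open>j \<in> \<int>\<close> of the bilateral limit series.
\<close>

lemma finite_reciprocal_theta:
  fixes q :: "'a::field"
  assumes q0: "q \<noteq> 0" and q1: "\<And>m. m \<ge> 1 \<Longrightarrow> q ^ m \<noteq> 1" and l: "l \<ge> 3" and N: "N \<ge> 1"
  defines "a \<equiv> \<lambda>M. qprod M (\<lambda>u. l * (u - 1) + 1) q"
    and "b \<equiv> \<lambda>M. qprod M (\<lambda>u. l * u - 1) q"
    and "c \<equiv> \<lambda>M. qprod M (\<lambda>u. l * (u - 1) + 2) q"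
    and "d \<equiv> \<lambda>M. qprod M (\<lambda>u. l * u - 2) q"
    and "e \<equiv> \<lambda>M. qprod M (\<lambda>u. l * u) q"
  shows "c N * d N / (b N * a (N + 1)) =
    (\<Sum>i\<in>{0..2 * N}. b i * a (2 * N - i) / (e i * e (2 * N - i)) *
      (if N \<le> i then qlam_term l q (i - N) else qlam_term' l q (N - i)))"
proof -
  define p where "p = (\<Prod>s\<in>{..<2 * N}. [:- (q ^ (1 + l * s)), 1:])"
  define t where "t = q ^ (l * N - 1)"
  have lmul: "l * i + l \<le> l * j" if "i < j" for i j
    using that by (metis Suc_leI add.commute mult_Suc_right mult_le_mono2)
  have lu: "l * u \<ge> l" if "u \<ge> 1" for u using that by simp
  have qinj: "q ^ i \<noteq> q ^ j" if "i < j" for i j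
  proof
    assume "q ^ i = q ^ j"
    also have "\<dots> = q ^ i * q ^ (j - i)" using that by (simp add: power_add[symmetric])
    finally have "q ^ (j - i) = 1" using q0 by simp
    moreover have "j - i \<ge> 1" using that by simp
    ultimately show False using q1 by blast
  qed
  have inj: "inj_on (\<lambda>i. q ^ (l * i)) {0..2 * N}"
  proof (rule inj_onI, rule ccontr)
    fix i j assume "q ^ (l * i) = q ^ (l * j)" "i \<noteq> j"
    with qinj[of "l * i" "l * j"] qinj[of "l * j" "l * i"] lmul[of i j] lmul[of j i] l show False
      by (cases "i < j") auto
  qed
  have tne: "t \<noteq> q ^ (l * i)" for i
  proof (cases "i < N")
    case True
    then have "l * i < l * N - 1" using lmul[of i N] l by linarith
    from qinj[OF this] show ?thesis by (simp add: t_def)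
  next
    case False
    then have "l * N \<le> l * i" "l * N \<ge> l" using N by auto
    then have "l * N - 1 < l * i" using l by linarith
    from qinj[OF this] show ?thesis by (simp add: t_def)
  qed
  have deg: "degree p < card {0..2 * N}"
  proof -
    have "degree p \<le> sum (degree \<circ> (\<lambda>s. [:- (q ^ (1 + l * s)), 1:])) {..<2 * N}"
      unfolding p_def by (rule degree_prod_sum_le) auto
    then show ?thesis by simp
  qed
  have pp: "poly p y = (\<Prod>s\<in>{..<2 * N}. y - q ^ (1 + l * s))" for y
    by (simp add: p_def poly_prod)
  have splitN: "{..<2 * N} = {..<i} \<union> {i..<i + (2 * N - i)}" if "i \<le> 2 * N" for i using that by auto
  \<comment> \<open>For s < i the exponent 1 + l s lies below l i, for s >= i above it, so the
    product splits at i. Likewise the exponent l N - 1 of \<open>t\<close> separates the indices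
    below N from the others, which gives the splitting in \<open>P3\<close> and
    \<open>P4\<close>.\<close>
  have P1: "poly p (q ^ (l * i)) = (\<Prod>s\<in>{..<i}. - (q ^ (1 + l * s))) * b i * (q ^ (l * i * (2 * N - i)) * a (2 * N - i))"
    if "i \<le> 2 * N" for i
  proof -
    have lower: "(\<Prod>s\<in>{..<i}. q ^ (l * i) - q ^ (1 + l * s)) = (\<Prod>s\<in>{..<i}. - (q ^ (1 + l * s))) * b i"
      unfolding b_def
    proof (rule prod_diff_below)
      fix s assume "s < i" from lmul[OF this] l show "1 + l * s \<le> l * i" by simp
    next
      fix u assume "1 \<le> u" "u \<le> i"
      then have "l * i = l * (i - u) + l * u" by (simp add: distrib_left[symmetric])
      then show "l * i - (1 + l * (i - u)) = l * u - 1" by linarith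
    qed
    have upper: "(\<Prod>s\<in>{i..<i + (2 * N - i)}. q ^ (l * i) - q ^ (1 + l * s)) = q ^ (l * i * (2 * N - i)) * a (2 * N - i)"
      unfolding a_def
    proof (rule prod_diff_above)
      fix s assume "i \<le> s" then have "l * i \<le> l * s" by simp
      then show "l * i \<le> 1 + l * s" by linarith
    next
      fix u :: nat assume "1 \<le> u"
      then show "1 + l * (i + u - 1) - l * i = l * (u - 1) + 1"
        by (cases u) (auto simp: algebra_simps)
    qed
    show ?thesis
      unfolding pp by (rule prod_eq_union[OF splitN[OF that] _ _ _ lower upper]) auto
  qed
  have P2: "(\<Prod>j\<in>{0..2 * N} - {i}. q ^ (l * i) - q ^ (l * j)) =
      (\<Prod>s\<in>{..<i}. - (q ^ (l * s))) * e i * (q ^ (l * i * (2 * N - i)) * e (2 * N - i))" if "i \<le> 2 * N" for i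
  proof -
    have lower: "(\<Prod>s\<in>{..<i}. q ^ (l * i) - q ^ (l * s)) = (\<Prod>s\<in>{..<i}. - (q ^ (l * s))) * e i"
      unfolding e_def
    proof (rule prod_diff_below)
      fix s assume "s < i" then show "l * s \<le> l * i" by simp
    next
      fix u assume "1 \<le> u" "u \<le> i"
      then show "l * i - (l * (i - u)) = l * u" by (simp add: diff_mult_distrib2)
    qed
    have upper: "(\<Prod>s\<in>{Suc i..<Suc i + (2 * N - i)}. q ^ (l * i) - q ^ (l * s)) = q ^ (l * i * (2 * N - i)) * e (2 * N - i)"
      unfolding e_def
    proof (rule prod_diff_above)
      fix s assume "Suc i \<le> s" then show "l * i \<le> l * s" by simp
    next
      fix u :: nat assume "1 \<le> u"
      then show "l * (Suc i + u - 1) - l * i = l * u" by (simp add: algebra_simps)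
    qed
    have union: "{0..2 * N} - {i} = {..<i} \<union> {Suc i..<Suc i + (2 * N - i)}" using that by auto
    show ?thesis by (rule prod_eq_union[OF union _ _ _ lower upper]) auto
  qed
  have P3: "poly p t = (\<Prod>s\<in>{..<N}. - (q ^ (1 + l * s))) * d N * (q ^ ((l * N - 1) * N) * c N)"
  proof -
    have lower: "(\<Prod>s\<in>{..<N}. q ^ (l * N - 1) - q ^ (1 + l * s)) = (\<Prod>s\<in>{..<N}. - (q ^ (1 + l * s))) * d N"
      unfolding d_def
    proof (rule prod_diff_below)
      fix s assume "s < N" from lmul[OF this] l show "1 + l * s \<le> l * N - 1" by simp
    next
      fix u assume "1 \<le> u" "u \<le> N"
      then have "l * N = l * (N - u) + l * u" "l * u \<ge> 3"
        using le_trans[OF l lu[of u]] by (simp_all add: distrib_left[symmetric])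
      then show "l * N - 1 - (1 + l * (N - u)) = l * u - 2" by linarith
    qed
    have upper: "(\<Prod>s\<in>{N..<N + N}. q ^ (l * N - 1) - q ^ (1 + l * s)) = q ^ ((l * N - 1) * N) * c N"
      unfolding c_def
    proof (rule prod_diff_above)
      fix s assume "N \<le> s" then have "l * N \<le> l * s" by simp
      then show "l * N - 1 \<le> 1 + l * s" by linarith
    next
      fix u :: nat assume "1 \<le> u"
      then have "l * (N + u - 1) = l * N + l * (u - 1)" by (simp add: distrib_left[symmetric])
      with lu[OF N] l show "1 + l * (N + u - 1) - (l * N - 1) = l * (u - 1) + 2" by linarith
    qed
    have union: "{..<2 * N} = {..<N} \<union> {N..<N + N}" by auto
    show ?thesis
      unfolding pp t_def by (rule prod_eq_union[OF union _ _ _ lower upper]) auto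
  qed
  have P4: "(\<Prod>j\<in>{0..2 * N}. t - q ^ (l * j)) = (\<Prod>s\<in>{..<N}. - (q ^ (l * s))) * b N * (q ^ ((l * N - 1) * (N + 1)) * a (N + 1))"
  proof -
    have lower: "(\<Prod>s\<in>{..<N}. q ^ (l * N - 1) - q ^ (l * s)) = (\<Prod>s\<in>{..<N}. - (q ^ (l * s))) * b N"
      unfolding b_def
    proof (rule prod_diff_below)
      fix s assume "s < N" from lmul[OF this] l show "l * s \<le> l * N - 1" by simp
    next
      fix u assume "1 \<le> u" "u \<le> N"
      then have "l * N = l * (N - u) + l * u" by (simp add: distrib_left[symmetric])
      then show "l * N - 1 - (l * (N - u)) = l * u - 1" by linarith
    qed
    have upper: "(\<Prod>s\<in>{N..<N + (N + 1)}. q ^ (l * N - 1) - q ^ (l * s)) = q ^ ((l * N - 1) * (N + 1)) * a (N + 1)"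
      unfolding a_def
    proof (rule prod_diff_above)
      fix s assume "N \<le> s" then have "l * N \<le> l * s" by simp
      then show "l * N - 1 \<le> l * s" by linarith
    next
      fix u :: nat assume "1 \<le> u"
      then have "l * (N + u - 1) = l * N + l * (u - 1)" by (simp add: distrib_left[symmetric])
      with lu[OF N] l show "l * (N + u - 1) - (l * N - 1) = l * (u - 1) + 1" by linarith
    qed
    have union: "{0..2 * N} = {..<N} \<union> {N..<N + (N + 1)}" by auto
    show ?thesis
      unfolding t_def by (rule prod_eq_union[OF union _ _ _ lower upper]) auto
  qed
  have nz: "a M \<noteq> 0" "b M \<noteq> 0" "e M \<noteq> 0" for M
  proof -
    have "1 \<le> l * u - 1" "1 \<le> l * u" if "u \<ge> 1" for u using lu[OF that] l by (linarith, linarith)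
    then show "a M \<noteq> 0" "b M \<noteq> 0" "e M \<noteq> 0"
      unfolding a_def b_def e_def by (simp_all add: qprod_nz[OF q1])
  qed
  \<comment> \<open>Numerator and denominator have equally many lower factors, which differ by one q
    each; this leaves q^i at the node i and q^N at \<open>t\<close>.\<close>
  have pw: "(\<Prod>s\<in>{..<i}. - (q ^ (1 + l * s))) = q ^ i * (\<Prod>s\<in>{..<i}. - (q ^ (l * s)))" for i
  proof -
    have "(\<Prod>s\<in>{..<i}. - (q ^ (1 + l * s))) = (\<Prod>s\<in>{..<i}. q * - (q ^ (l * s)))" by (simp add: power_add)
    then show ?thesis by (simp only: prod.distrib) simp
  qed
  have pnz: "(\<Prod>s\<in>{..<i}. - (q ^ (l * s))) \<noteq> 0" for i using q0 by simp
  have L: "poly p t / (\<Prod>j\<in>{0..2 * N}. t - q ^ (l * j)) = q ^ N * (c N * d N / (b N * a (N + 1))) / q ^ (l * N - 1)"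
  proof -
    have "q ^ ((l * N - 1) * (N + 1)) = q ^ ((l * N - 1) * N) * q ^ (l * N - 1)"
      by (simp add: power_add distrib_left)
    then show ?thesis unfolding P3 P4 pw using pnz[of N] q0 by (simp add: divide_simps)
  qed
  have R: "poly p (q ^ (l * i)) / (\<Prod>j\<in>{0..2 * N} - {i}. q ^ (l * i) - q ^ (l * j)) / (t - q ^ (l * i)) =
     (b i * a (2 * N - i) / (e i * e (2 * N - i))) * (q ^ i / (t - q ^ (l * i)))" if "i \<le> 2 * N" for i
    unfolding P1[OF that] P2[OF that] pw using pnz[of i] q0 by (simp add: divide_simps)
  \<comment> \<open>The prefactor cancels the power of q in \<open>L\<close>. The part q^(l N - 1)
    is there because the denominator at \<open>t\<close> has N + 1 upper factors, the numerator only
    N.\<close>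
  have T: "q ^ (l * N - 1) / q ^ N * (q ^ i / (t - q ^ (l * i))) =
     (if N \<le> i then qlam_term l q (i - N) else qlam_term' l q (N - i))" for i
  proof (cases "N \<le> i")
    case True
    then obtain j where j: "i = N + j" by (metis le_add_diff_inverse)
    have "l * i = l * N + l * j" by (simp add: j distrib_left)
    then have "l * i = (l * N - 1) + (l * j + 1)" using lu[OF N] l by linarith
    then have e1: "q ^ (l * i) = t * q ^ (l * j + 1)"
      unfolding t_def power_add[symmetric] by simp
    have nz1: "1 - q ^ (l * j + 1) \<noteq> 0" using q1[of "l * j + 1"] by auto
    have t0: "t \<noteq> 0" using q0 by (simp add: t_def)
    have "t - q ^ (l * i) = t * (1 - q ^ (l * j + 1))" unfolding e1 by (simp add: right_diff_distrib)
    then have "q ^ (l * N - 1) / q ^ N * (q ^ i / (t - q ^ (l * i))) = q ^ j / (1 - q ^ (l * j + 1))"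
      using q0 t0 nz1 unfolding t_def[symmetric] by (simp add: j power_add)
    then show ?thesis using True j by simp
  next
    case False
    define j where "j = N - i"
    have j: "N = i + j" "j \<ge> 1" using False by (auto simp: j_def)
    have lj: "l * j \<ge> 3 * j" using l by simp
    have "l * N = l * i + l * j" by (simp add: j distrib_left)
    then have "l * N - 1 = l * i + (l * j - 1)" using lj j(2) by linarith
    then have e1: "t = q ^ (l * i) * q ^ (l * j - 1)"
      unfolding t_def power_add[symmetric] by simp
    have "l * j - 1 \<ge> 1" using lj j(2) by linarith
    then have nz1: "1 - q ^ (l * j - 1) \<noteq> 0" using q1[of "l * j - 1"] by auto
    have "(l - 1) * j = l * j - j" by (simp add: diff_mult_distrib)
    then have "l * j - 1 = ((l - 1) * j - 1) + j" using lj j(2) by linarith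
    then have e2: "q ^ (l * j - 1) = q ^ ((l - 1) * j - 1) * q ^ j"
      unfolding power_add[symmetric] by simp
    have "t - q ^ (l * i) = - (q ^ (l * i)) * (1 - q ^ (l * j - 1))" unfolding e1 by (simp add: algebra_simps)
    then have "q ^ (l * N - 1) / q ^ N * (q ^ i / (t - q ^ (l * i))) =
       t / q ^ N * (q ^ i / (- (q ^ (l * i)) * (1 - q ^ (l * j - 1))))" by (simp add: t_def)
    also have "\<dots> = q ^ (l * i) * (q ^ ((l - 1) * j - 1) * q ^ j) / (q ^ i * q ^ j) * (q ^ i / (- (q ^ (l * i)) * (1 - q ^ (l * j - 1))))"
      unfolding e1 unfolding e2 unfolding j(1) power_add ..
    also have "\<dots> = - (q ^ ((l - 1) * j - 1)) / (1 - q ^ (l * j - 1))"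
      using q0 nz1 by (simp add: divide_simps)
    finally show ?thesis using False by (simp add: j_def)
  qed
  have q3: "q ^ (l * N - 1) / q ^ N \<noteq> 0" "q ^ N \<noteq> 0" "q ^ (l * N - 1) \<noteq> 0" using q0 by auto
  have "c N * d N / (b N * a (N + 1)) =
     q ^ (l * N - 1) / q ^ N * (poly p t / (\<Prod>j\<in>{0..2 * N}. t - q ^ (l * j)))"
    unfolding L using q0 by simp
  also have "\<dots> = q ^ (l * N - 1) / q ^ N * (\<Sum>i\<in>{0..2 * N}. poly p (q ^ (l * i)) /
       (\<Prod>j\<in>{0..2 * N} - {i}. q ^ (l * i) - q ^ (l * j)) / (t - q ^ (l * i)))"
    using lagrange_partial_fractions[OF _ inj deg, of t] tne by simp
  also have "\<dots> = (\<Sum>i\<in>{0..2 * N}. b i * a (2 * N - i) / (e i * e (2 * N - i)) *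
      (q ^ (l * N - 1) / q ^ N * (q ^ i / (t - q ^ (l * i)))))"
    unfolding sum_distrib_left using R by (intro sum.cong) (auto simp: mult_ac)
  finally show ?thesis unfolding T .
qed

section \<open>From the finite identity to formal power series\<close>

lemma fps_to_fls_prod: "fps_to_fls (prod f S) = (\<Prod>j\<in>S. fps_to_fls (f j :: 'a::comm_ring_1 fps))"
  by (induction S rule: infinite_finite_induct) (auto simp: fls_times_fps_to_fls)

lemma fps_to_fls_sum: "fps_to_fls (sum f S) = (\<Sum>j\<in>S. fps_to_fls (f j))"
  by (induction S rule: infinite_finite_induct) auto

lemma fps_to_fls_inverse:
  "fps_nth f 0 \<noteq> 0 \<Longrightarrow> fps_to_fls (inverse f) = inverse (fps_to_fls (f :: 'a::field fps))"
  by (simp add: fls_inverse_fps_to_fls)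

definition fps_geom :: "nat \<Rightarrow> rat fps" where
  "fps_geom m = Abs_fps (\<lambda>k. if m dvd k then 1 else 0)"

lemma fps_geom_mult:
  assumes "m \<ge> 1"
  shows "(1 - fps_X ^ m) * fps_geom m = 1"
proof (rule fps_ext)
  fix n
  have "fps_nth ((1 - fps_X ^ m) * fps_geom m) n = fps_nth (fps_geom m) n - (if n < m then 0 else fps_nth (fps_geom m) (n - m))"
    by (simp add: left_diff_distrib fps_X_power_mult_nth)
  also have "\<dots> = fps_nth 1 n"
  proof (cases "n < m")
    case True
    then show ?thesis by (auto simp: fps_geom_def dest: dvd_imp_le)
  next
    case False
    then obtain k where "n = m + k" by (metis le_add_diff_inverse not_less)
    then show ?thesis using assms by (auto simp: fps_geom_def)
  qed
  finally show "fps_nth ((1 - fps_X ^ m) * fps_geom m) n = fps_nth 1 n" .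
qed

lemma qprod_nth_0 [simp]: "(\<And>u. u \<ge> 1 \<Longrightarrow> e u \<ge> 1) \<Longrightarrow> fps_nth (qprod M e (fps_X :: 'a::idom fps)) 0 = 1"
  unfolding qprod_def
proof (induction M)
  case (Suc M)
  moreover have "e (Suc M) > 0" using Suc.prems[of "Suc M"] by linarith
  ultimately show ?case by simp
qed simp

lemma fps_to_fls_qprod: "fps_to_fls (qprod M e fps_X) = qprod M e (fls_X :: 'a::comm_ring_1 fls)"
  by (simp add: qprod_def fps_to_fls_prod fps_to_fls_power)

text \<open>The field version is applied to Laurent series at q = \<open>fls_X\<close>, because the
  differences of powers of q in its proof are not units among power series. In the resulting
  identity every inverted series has constant term 1, so it descends.\<close>

lemma finite_reciprocal_theta_fps:
  assumes l: "l \<ge> 3" and N: "N \<ge> 1"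
  defines "a \<equiv> \<lambda>M. qprod M (\<lambda>u. l * (u - 1) + 1) (fps_X :: rat fps)"
    and "b \<equiv> \<lambda>M. qprod M (\<lambda>u. l * u - 1) (fps_X :: rat fps)"
    and "c \<equiv> \<lambda>M. qprod M (\<lambda>u. l * (u - 1) + 2) (fps_X :: rat fps)"
    and "d \<equiv> \<lambda>M. qprod M (\<lambda>u. l * u - 2) (fps_X :: rat fps)"
    and "e \<equiv> \<lambda>M. qprod M (\<lambda>u. l * u) (fps_X :: rat fps)"
  shows "c N * d N * inverse (b N * a (N + 1)) =
    (\<Sum>i\<in>{0..2 * N}. b i * a (2 * N - i) * inverse (e i * e (2 * N - i)) *
      (if N \<le> i then fps_X ^ (i - N) * fps_geom (l * (i - N) + 1)
       else - (fps_X ^ ((l - 1) * (N - i) - 1) * fps_geom (l * (N - i) - 1))))" (is "?L = ?R")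
proof -
  have pos: "1 \<le> l * u - 1" "1 \<le> l * u" "1 \<le> l * u - 2" if "u \<ge> 1" for u
  proof -
    have "l * u \<ge> l" using that by simp
    then show "1 \<le> l * u - 1" "1 \<le> l * u" "1 \<le> l * u - 2" using l by linarith+
  qed
  have a0: "fps_nth (a M) 0 = 1" for M unfolding a_def by (rule qprod_nth_0) simp
  have b0: "fps_nth (b M) 0 = 1" for M unfolding b_def by (rule qprod_nth_0) (erule pos)
  have e0: "fps_nth (e M) 0 = 1" for M unfolding e_def by (rule qprod_nth_0) (erule pos)
  have X1: "fls_X ^ m \<noteq> (1 :: rat fls)" if "m \<ge> 1" for m
  proof
    assume "fls_X ^ m = (1 :: rat fls)"
    then have "fps_to_fls (fps_X ^ m) = (fps_to_fls 1 :: rat fls)" by (simp add: fps_to_fls_power)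
    then have "fps_X ^ m = (1 :: rat fps)" by (simp only: fps_to_fls_eq_iff)
    then have "fps_nth (fps_X ^ m :: rat fps) 0 = fps_nth 1 0" by (rule arg_cong)
    then show False using that by (simp add: fps_X_power_nth)
  qed
  have geom: "fps_to_fls (fps_geom m) = 1 / (1 - fls_X ^ m)" if "m \<ge> 1" for m
  proof -
    have "(1 - fls_X ^ m) * fps_to_fls (fps_geom m) = (fps_to_fls ((1 - fps_X ^ m) * fps_geom m) :: rat fls)"
      by (simp add: fls_times_fps_to_fls fps_to_fls_power)
    also have "\<dots> = 1" using that by (simp add: fps_geom_mult)
    finally show ?thesis using X1[OF that] by (simp add: field_simps)
  qed
  have "fps_to_fls ?L = fps_to_fls (c N) * fps_to_fls (d N) / (fps_to_fls (b N) * fps_to_fls (a (N + 1)))"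
    using a0 b0 by (simp add: fls_times_fps_to_fls fps_to_fls_inverse divide_inverse)
  also have "\<dots> = (\<Sum>i\<in>{0..2 * N}. fps_to_fls (b i) * fps_to_fls (a (2 * N - i)) /
      (fps_to_fls (e i) * fps_to_fls (e (2 * N - i))) *
      (if N \<le> i then qlam_term l fls_X (i - N) else qlam_term' l fls_X (N - i)))"
    unfolding a_def b_def c_def d_def e_def fps_to_fls_qprod
    by (rule finite_reciprocal_theta) (use X1 l N in auto)
  also have "\<dots> = fps_to_fls ?R"
    unfolding fps_to_fls_sum
  proof (rule sum.cong[OF refl])
    fix i assume "i \<in> {0..2 * N}"
    have *: "(if N \<le> i then qlam_term l fls_X (i - N) else qlam_term' l fls_X (N - i)) =
      fps_to_fls (if N \<le> i then fps_X ^ (i - N) * fps_geom (l * (i - N) + 1)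
       else - (fps_X ^ ((l - 1) * (N - i) - 1) * fps_geom (l * (N - i) - 1)))"
    proof (cases "N \<le> i")
      case True
      then show ?thesis using geom[of "l * (i - N) + 1"] by (simp add: fls_times_fps_to_fls fps_to_fls_power)
    next
      case False
      then show ?thesis using geom[OF pos(1)[of "N - i"]] by (simp add: fls_times_fps_to_fls fps_to_fls_power)
    qed
    show "fps_to_fls (b i) * fps_to_fls (a (2 * N - i)) /
      (fps_to_fls (e i) * fps_to_fls (e (2 * N - i))) *
      (if N \<le> i then qlam_term l fls_X (i - N) else qlam_term' l fls_X (N - i)) =
      fps_to_fls (b i * a (2 * N - i) * inverse (e i * e (2 * N - i)) *
      (if N \<le> i then fps_X ^ (i - N) * fps_geom (l * (i - N) + 1)
       else - (fps_X ^ ((l - 1) * (N - i) - 1) * fps_geom (l * (N - i) - 1))))"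
      unfolding * fls_times_fps_to_fls using e0
      by (subst fps_to_fls_inverse) (simp_all add: fls_times_fps_to_fls divide_inverse)
  qed
  finally show ?thesis by (simp only: fps_to_fls_eq_iff)
qed

lemma fps_agree_inverse:
  fixes f :: "'a::field fps"
  assumes "fps_agree n f g" "fps_nth f 0 \<noteq> 0" "fps_nth g 0 \<noteq> 0"
  shows "fps_agree n (inverse f) (inverse g)"
proof (rule fps_agree_cancel)
  have "fps_agree n (f * inverse g) (g * inverse g)"
    by (rule fps_agree_mult[OF assms(1) fps_agree_refl])
  then show "fps_agree n (f * inverse f) (f * inverse g)"
    using inverse_mult_eq_1'[OF assms(2)] inverse_mult_eq_1'[OF assms(3)] by (simp add: fps_agree_sym)
qed fact

text \<open>The coefficients of the bilateral series of q^j / (1 - q^(lj+1)): divisors congruent to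
  1 come from j >= 0, those congruent to -1 from j < 0. For \<open>l = 3\<close> this sums the
  nontrivial character modulo 3 over the divisors of 3n + 1.\<close>

definition Lambert_series :: "nat \<Rightarrow> rat fps" where
  "Lambert_series l = Abs_fps (\<lambda>n. of_nat (card {d. d dvd l * n + 1 \<and> d mod l = 1}) -
      of_nat (card {d. d dvd l * n + 1 \<and> d mod l = l - 1}))"

text \<open>Expanding geometric series, q^i occurs in the summand j when l i + 1 = (l j + 1)(l k +
  1), and in the summand -j when l i + 1 = (l j - 1)(l k + l - 1), with k >= 0. Coprimality of
  \<open>l\<close> to the first factor turns this into plain divisibility of l i + 1.\<close>

lemma Lambert_series_agree:
  assumes l: "l \<ge> 3"
  shows "fps_agree n (Lambert_series l) ((\<Sum>j\<in>{0..n}. fps_X ^ j * fps_geom (l * j + 1)) -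
     (\<Sum>j\<in>{1..n}. fps_X ^ ((l - 1) * j - 1) * fps_geom (l * j - 1)))"
  unfolding fps_agree_def
proof (intro allI impI)
  fix i assume "i \<le> n"
  have cop: "coprime (l * j + 1) l" for j
    by (rule coprimeI) (metis dvd_add_right_iff dvd_mult2)
  have nth1: "fps_nth (fps_X ^ j * fps_geom (l * j + 1)) i = (if l * j + 1 dvd l * i + 1 then 1 else 0)" for j
  proof (cases "j \<le> i")
    case True
    have "l * i + 1 = l * (i - j) + (l * j + 1)" using True by (simp add: diff_mult_distrib2)
    then have "l * j + 1 dvd l * i + 1 \<longleftrightarrow> l * j + 1 dvd l * (i - j)" by (metis dvd_add_left_iff dvd_refl)
    also have "\<dots> \<longleftrightarrow> l * j + 1 dvd i - j" using cop[of j] by (simp add: coprime_dvd_mult_right_iff)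
    finally show ?thesis using True by (simp add: fps_X_power_mult_nth fps_geom_def)
  next
    case False
    then have "l * i + 1 < l * j + 1" using l by simp
    then have "\<not> l * j + 1 dvd l * i + 1" by (meson dvd_imp_le not_le zero_less_Suc add_is_0 gr0I one_neq_zero)
    then show ?thesis using False by (simp add: fps_X_power_mult_nth)
  qed
  have "(\<Sum>j\<in>{0..n}. fps_nth (fps_X ^ j * fps_geom (l * j + 1)) i) = of_nat (card {j\<in>{0..n}. l * j + 1 dvd l * i + 1})"
    unfolding nth1 by (simp add: sum.If_cases Int_def)
  also have "card {j\<in>{0..n}. l * j + 1 dvd l * i + 1} = card {d. d dvd l * i + 1 \<and> d mod l = 1}"
  proof (rule bij_betw_same_card[OF bij_betw_byWitness[where f = "\<lambda>j. l * j + 1" and f' = "\<lambda>d. d div l"]])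
    show "\<forall>j\<in>{j \<in> {0..n}. l * j + 1 dvd l * i + 1}. (l * j + 1) div l = j" using l by auto
    show "\<forall>d\<in>{d. d dvd l * i + 1 \<and> d mod l = 1}. l * (d div l) + 1 = d" using mult_div_mod_eq[of l] by (auto, metis)
    show "(\<lambda>j. l * j + 1) ` {j \<in> {0..n}. l * j + 1 dvd l * i + 1} \<subseteq> {d. d dvd l * i + 1 \<and> d mod l = 1}" using l by auto
    show "(\<lambda>d. d div l) ` {d. d dvd l * i + 1 \<and> d mod l = 1} \<subseteq> {j \<in> {0..n}. l * j + 1 dvd l * i + 1}"
    proof (clarify, intro conjI)
      fix d assume d: "d dvd l * i + 1" "d mod l = 1"
      then show "l * (d div l) + 1 dvd l * i + 1" by (metis mult_div_mod_eq)
      have "d \<le> l * i + 1" using d(1) by (intro dvd_imp_le) auto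
      then have "d div l \<le> (l * i + 1) div l" by (rule div_le_mono)
      also have "\<dots> = i" using l by simp
      finally show "d div l \<in> {0..n}" using \<open>i \<le> n\<close> by simp
    qed
  qed
  finally have sum1: "(\<Sum>j\<in>{0..n}. fps_nth (fps_X ^ j * fps_geom (l * j + 1)) i) = of_nat (card {d. d dvd l * i + 1 \<and> d mod l = 1})" .
  have nth2: "fps_nth (fps_X ^ ((l - 1) * j - 1) * fps_geom (l * j - 1)) i = (if l * j - 1 dvd l * i + 1 then 1 else 0)"
    if j: "j \<ge> 1" for j
  proof -
    have lj: "l * j \<ge> l" "(l - 1) * j = l * j - j" "3 * j \<le> l * j" using j l by (simp_all add: diff_mult_distrib)
    have cop': "coprime (l * j - 1) l"
    proof (rule coprimeI)
      fix c assume "c dvd l * j - 1" "c dvd l"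
      moreover have "l * j = (l * j - 1) + 1" using lj(1) l by linarith
      ultimately show "c dvd 1" by (metis dvd_add_right_iff dvd_mult2)
    qed
    have "l * j - 1 dvd l * i + 1 \<longleftrightarrow> l * j - 1 dvd l * i + 1 + (l * j - 1)" by simp
    also have "l * i + 1 + (l * j - 1) = l * (i + j)" using lj(1) l unfolding distrib_left by linarith
    also have "l * j - 1 dvd l * (i + j) \<longleftrightarrow> l * j - 1 dvd i + j" using cop' by (simp add: coprime_dvd_mult_right_iff)
    finally have iff: "l * j - 1 dvd l * i + 1 \<longleftrightarrow> l * j - 1 dvd i + j" .
    show ?thesis
    proof (cases "i < (l - 1) * j - 1")
      case True
      then have "i + j < l * j - 1" using lj j by linarith
      then have "\<not> l * j - 1 dvd i + j" using j by (auto dest: dvd_imp_le)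
      then show ?thesis using True iff by (simp add: fps_X_power_mult_nth)
    next
      case False
      then have "i + j = (i - ((l - 1) * j - 1)) + (l * j - 1)" using lj j by linarith
      then have "l * j - 1 dvd i + j \<longleftrightarrow> l * j - 1 dvd i - ((l - 1) * j - 1)" by (metis dvd_add_left_iff dvd_refl)
      then show ?thesis using False iff by (simp add: fps_X_power_mult_nth fps_geom_def)
    qed
  qed
  have "(\<Sum>j\<in>{1..n}. fps_nth (fps_X ^ ((l - 1) * j - 1) * fps_geom (l * j - 1)) i) = (\<Sum>j\<in>{1..n}. if l * j - 1 dvd l * i + 1 then 1 else 0)"
    using nth2 by (intro sum.cong) auto
  also have "\<dots> = of_nat (card {j\<in>{1..n}. l * j - 1 dvd l * i + 1})" by (simp add: sum.If_cases Int_def)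
  also have "card {j\<in>{1..n}. l * j - 1 dvd l * i + 1} = card {d. d dvd l * i + 1 \<and> d mod l = l - 1}"
  proof (rule bij_betw_same_card[OF bij_betw_byWitness[where f = "\<lambda>j. l * j - 1" and f' = "\<lambda>d. d div l + 1"]])
    have m1: "l * j - 1 = l * (j - 1) + (l - 1)" if "j \<ge> 1" for j
      using that l by (cases j) auto
    have m2: "(l * (j - 1) + (l - 1)) div l = j - 1" "(l * (j - 1) + (l - 1)) mod l = l - 1" for j
    proof -
      have "(l * a + r) div l = a" "(l * a + r) mod l = r" if "r < l" for a r using that by auto
      from this[of "l - 1"] l show "(l * (j - 1) + (l - 1)) div l = j - 1" "(l * (j - 1) + (l - 1)) mod l = l - 1"
        by auto
    qed
    show "\<forall>j\<in>{j \<in> {1..n}. l * j - 1 dvd l * i + 1}. (l * j - 1) div l + 1 = j" using m1 m2(1) by auto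
    have d1: "l * (d div l + 1) - 1 = d" if "d mod l = l - 1" for d
    proof -
      have "l * (d div l) + (l - 1) = d" using that mult_div_mod_eq[of l d] by simp
      moreover have "l * (d div l + 1) = l * (d div l) + l" by (simp only: distrib_left mult_1_right)
      ultimately show ?thesis using l by linarith
    qed
    then show "\<forall>d\<in>{d. d dvd l * i + 1 \<and> d mod l = l - 1}. l * (d div l + 1) - 1 = d" by blast
    show "(\<lambda>j. l * j - 1) ` {j \<in> {1..n}. l * j - 1 dvd l * i + 1} \<subseteq> {d. d dvd l * i + 1 \<and> d mod l = l - 1}"
      using m1 m2(2) by auto
    show "(\<lambda>d. d div l + 1) ` {d. d dvd l * i + 1 \<and> d mod l = l - 1} \<subseteq> {j \<in> {1..n}. l * j - 1 dvd l * i + 1}"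
    proof (clarify, intro conjI)
      fix d assume d: "d dvd l * i + 1" "d mod l = l - 1"
      then show "l * (d div l + 1) - 1 dvd l * i + 1" using d1 by simp
      \<comment> \<open>A divisor congruent to -1 is proper, as l i + 1 is congruent to 1 and l >=
        3. Hence it is at most half of l i + 1, which leaves room for the shifted index
        \<open>d div l + 1\<close>.\<close>
      obtain k where k: "l * i + 1 = d * k" using d(1) by blast
      have "i \<noteq> 0" using d l by (intro notI) auto
      have "d \<noteq> l * i + 1" using d(2) l by (intro notI) simp
      then have "k \<noteq> 1" using k by (intro notI) simp
      moreover have "k \<noteq> 0" using k by (intro notI) simp
      ultimately have "k \<ge> 2" by simp
      then have "d * 2 \<le> l * i + 1" using k by simp
      moreover have "d \<ge> 2" using d(2) l by (metis diff_le_mono le_trans mod_less_eq_dividend numeral_2_eq_2 numeral_3_eq_3 diff_Suc_1)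
      ultimately have "d < l * i" using \<open>i \<noteq> 0\<close> by linarith
      then have "d div l < i" using l by (simp add: less_mult_imp_div_less mult.commute)
      then show "d div l + 1 \<in> {1..n}" using \<open>i \<le> n\<close> by simp
    qed
  qed
  finally have sum2: "(\<Sum>j\<in>{1..n}. fps_nth (fps_X ^ ((l - 1) * j - 1) * fps_geom (l * j - 1)) i) =
     of_nat (card {d. d dvd l * i + 1 \<and> d mod l = l - 1})" .
  show "fps_nth (Lambert_series l) i = fps_nth ((\<Sum>j\<in>{0..n}. fps_X ^ j * fps_geom (l * j + 1)) -
     (\<Sum>j\<in>{1..n}. fps_X ^ ((l - 1) * j - 1) * fps_geom (l * j - 1))) i"
    by (simp add: fps_sum_nth sum1 sum2 Lambert_series_def)
qed

lemma fps_agree_X_power_mult: "n < j \<Longrightarrow> fps_agree n (g * (fps_X ^ j * h)) 0"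
  by (auto simp: fps_agree_def fps_X_power_mult_nth mult.left_commute[of g])

lemma fps_agree_qprod:
  assumes "\<And>u. u \<ge> 1 \<Longrightarrow> e u \<ge> u" "n \<le> M"
  shows "fps_agree n (qprod M e fps_X) (fps_infprod (\<lambda>u. 1 - fps_X ^ e u))"
  unfolding qprod_def by (rule fps_agree_sym, rule fps_agree_infprod, rule fps_admissible_one_minus) (use assms in auto)

lemma cross_multiply:
  fixes x y z :: "'a::comm_ring_1"
  assumes "x * i = y * j * z" "i * u = 1" "j * v = 1"
  shows "x * v = u * y * z"
proof -
  have "x * v = x * v * (i * u)" by (simp add: assms(2))
  also have "\<dots> = (x * i) * (v * u)" by (simp only: mult_ac)
  also have "\<dots> = u * y * z * (j * v)" unfolding assms(1) by (simp only: mult_ac)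
  finally show ?thesis by (simp add: assms(3))
qed

text \<open>Limit of the finite identity for N to infinity. Near the centre i = N all weights tend
  to the same series \<open>K\<close>; away from it the summands have high order in q, so their
  weights do not matter.\<close>

theorem Lambert_series_product:
  assumes l: "l \<ge> 3"
  defines "A \<equiv> fps_infprod (\<lambda>u. 1 - fps_X ^ (l * (u - 1) + 1))"
    and "B \<equiv> fps_infprod (\<lambda>u. 1 - fps_X ^ (l * u - 1))"
    and "C \<equiv> fps_infprod (\<lambda>u. 1 - fps_X ^ (l * (u - 1) + 2))"
    and "D \<equiv> fps_infprod (\<lambda>u. 1 - fps_X ^ (l * u - 2))"
  shows "Lambert_series l * (A * B) ^ 2 = C * D * Eul l ^ 2"
proof -
  define a where "a = (\<lambda>M. qprod M (\<lambda>u. l * (u - 1) + 1) (fps_X :: rat fps))"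
  define b where "b = (\<lambda>M. qprod M (\<lambda>u. l * u - 1) (fps_X :: rat fps))"
  define c where "c = (\<lambda>M. qprod M (\<lambda>u. l * (u - 1) + 2) (fps_X :: rat fps))"
  define d where "d = (\<lambda>M. qprod M (\<lambda>u. l * u - 2) (fps_X :: rat fps))"
  define e where "e = (\<lambda>M. qprod M (\<lambda>u. l * u) (fps_X :: rat fps))"
  have ge: "u \<le> l * (u - 1) + 1" "u \<le> l * u - 1" "u \<le> l * (u - 1) + 2" "u \<le> l * u - 2" "u \<le> l * u" if "u \<ge> 1" for u
  proof -
    have "3 * u \<le> l * u" "1 * (u - 1) \<le> l * (u - 1)" using l by (auto intro: mult_le_mono1)
    then show "u \<le> l * (u - 1) + 1" "u \<le> l * u - 1" "u \<le> l * (u - 1) + 2" "u \<le> l * u - 2" "u \<le> l * u"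
      using that by linarith+
  qed
  have lim: "fps_agree n (a M) A" "fps_agree n (b M) B" "fps_agree n (c M) C" "fps_agree n (d M) D"
    "fps_agree n (e M) (Eul l)" if "n \<le> M" for n M
    unfolding a_def b_def c_def d_def e_def A_def B_def C_def D_def Eul_eq_infprod
    by (rule fps_agree_qprod[OF _ that], erule ge)+
  have a0: "fps_nth (a M) 0 = 1" "fps_nth (b M) 0 = 1" "fps_nth (e M) 0 = 1" for M
    using fps_agree_nth[OF lim(1)[of 0 M], of 0] fps_agree_nth[OF lim(2)[of 0 M], of 0]
      fps_agree_nth[OF lim(5)[of 0 M], of 0] by (simp_all add: A_def B_def)
  have A0: "fps_nth A 0 = 1" "fps_nth B 0 = 1" by (simp_all add: A_def B_def)
  define K where "K = B * A * inverse (Eul l * Eul l)"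
  have "C * D * inverse (B * A) = K * Lambert_series l"
  proof (rule fps_agree_imp_eq)
    fix n :: nat
    \<comment> \<open>With this N both \<open>i\<close> and \<open>2 * N - i\<close> are at least n
      whenever \<open>i\<close> is within n of N, so there the weight \<open>G i\<close> agrees with
      \<open>K\<close> up to order n.\<close>
    define N where "N = 2 * n + 2"
    define G where "G i = b i * a (2 * N - i) * inverse (e i * e (2 * N - i))" for i
    have GK: "fps_agree n (G i) K" if "N - n \<le> i" "i \<le> N + n" for i
      unfolding G_def K_def using that a0
      by (intro fps_agree_mult fps_agree_inverse lim) (auto simp: N_def)
    have T: "fps_agree n (G i * (fps_X ^ s * h)) (K * (fps_X ^ s * h))" if "i \<le> N + s" "N \<le> i + s" for i s h
    proof (cases "s \<le> n")
      case True
      then show ?thesis using that by (intro fps_agree_mult GK fps_agree_refl) auto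
    next
      case False
      then show ?thesis
        using fps_agree_X_power_mult[of n s "G i" h] fps_agree_X_power_mult[of n s K h]
        by (blast intro: fps_agree_trans fps_agree_sym not_le_imp_less)
    qed
    have "c N * d N * inverse (b N * a (N + 1)) = (\<Sum>i\<in>{0..2 * N}. G i *
      (if N \<le> i then fps_X ^ (i - N) * fps_geom (l * (i - N) + 1)
       else - (fps_X ^ ((l - 1) * (N - i) - 1) * fps_geom (l * (N - i) - 1))))"
      using finite_reciprocal_theta_fps[OF l, of N] by (simp add: G_def a_def b_def c_def d_def e_def N_def)
    also have "\<dots> = (\<Sum>i\<in>{N..2 * N}. G i * (fps_X ^ (i - N) * fps_geom (l * (i - N) + 1)))
       - (\<Sum>i\<in>{0..<N}. G i * (fps_X ^ ((l - 1) * (N - i) - 1) * fps_geom (l * (N - i) - 1)))"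
    proof -
      have "{0..2 * N} = {N..2 * N} \<union> {0..<N}" by auto
      moreover have "{N..2 * N} \<inter> {0..<N} = {}" by auto
      ultimately show ?thesis by (simp add: sum.union_disjoint sum_negf)
    qed
    also have "(\<Sum>i\<in>{N..2 * N}. G i * (fps_X ^ (i - N) * fps_geom (l * (i - N) + 1))) =
        (\<Sum>j\<in>{0..N}. G (N + j) * (fps_X ^ j * fps_geom (l * j + 1)))"
      by (rule sum.reindex_bij_witness[of _ "\<lambda>j. N + j" "\<lambda>i. i - N"]) auto
    also have "(\<Sum>i\<in>{0..<N}. G i * (fps_X ^ ((l - 1) * (N - i) - 1) * fps_geom (l * (N - i) - 1))) =
        (\<Sum>j\<in>{1..N}. G (N - j) * (fps_X ^ ((l - 1) * j - 1) * fps_geom (l * j - 1)))"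
      by (rule sum.reindex_bij_witness[of _ "\<lambda>j. N - j" "\<lambda>i. N - i"]) auto
    finally have eq: "c N * d N * inverse (b N * a (N + 1)) =
        (\<Sum>j\<in>{0..N}. G (N + j) * (fps_X ^ j * fps_geom (l * j + 1))) -
        (\<Sum>j\<in>{1..N}. G (N - j) * (fps_X ^ ((l - 1) * j - 1) * fps_geom (l * j - 1)))" .
    have "fps_agree n (C * D * inverse (B * A)) (c N * d N * inverse (b N * a (N + 1)))"
      using a0 A0 by (intro fps_agree_mult fps_agree_inverse fps_agree_sym[OF lim(1)] fps_agree_sym[OF lim(2)]
          fps_agree_sym[OF lim(3)] fps_agree_sym[OF lim(4)]) (auto simp: N_def)
    also have "fps_agree n (c N * d N * inverse (b N * a (N + 1)))
       ((\<Sum>j\<in>{0..N}. K * (fps_X ^ j * fps_geom (l * j + 1))) -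
        (\<Sum>j\<in>{1..N}. K * (fps_X ^ ((l - 1) * j - 1) * fps_geom (l * j - 1))))"
      unfolding eq
    proof (intro fps_agree_diff fps_agree_sum T)
      \<comment> \<open>Since l >= 3, the summand -j has order (l - 1) j - 1 >= j, so its distance
        from the centre is covered by its order.\<close>
      fix j assume "j \<in> {1..N}"
      then have "3 * j \<le> l * j" "(l - 1) * j = l * j - j" "j \<ge> 1" using l by (auto intro: mult_le_mono1 simp: diff_mult_distrib)
      then have "j \<le> (l - 1) * j - 1" by linarith
      then show "N - j \<le> N + ((l - 1) * j - 1)" "N \<le> N - j + ((l - 1) * j - 1)" by linarith+
    qed auto
    also have "(\<Sum>j\<in>{0..N}. K * (fps_X ^ j * fps_geom (l * j + 1))) -
        (\<Sum>j\<in>{1..N}. K * (fps_X ^ ((l - 1) * j - 1) * fps_geom (l * j - 1))) =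
        K * ((\<Sum>j\<in>{0..N}. fps_X ^ j * fps_geom (l * j + 1)) -
        (\<Sum>j\<in>{1..N}. fps_X ^ ((l - 1) * j - 1) * fps_geom (l * j - 1)))"
      by (simp add: sum_distrib_left right_diff_distrib)
    also have "fps_agree n \<dots> (K * Lambert_series l)"
      by (intro fps_agree_mult fps_agree_refl fps_agree_sym[OF fps_agree_mono[OF Lambert_series_agree[OF l, of N]]])
         (simp add: N_def)
    finally show "fps_agree n (C * D * inverse (B * A)) (K * Lambert_series l)"
      by (blast intro: fps_agree_trans)
  qed
  moreover have "inverse (B * A) * (B * A) = 1" "inverse (Eul l * Eul l) * (Eul l * Eul l) = 1"
    using A0 by (auto intro!: inverse_mult_eq_1)
  ultimately have "C * D * (Eul l * Eul l) = (B * A) * (B * A) * Lambert_series l"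
    unfolding K_def by (rule cross_multiply)
  then show ?thesis by (simp add: power2_eq_square mult_ac)
qed

section \<open>Residue classes in Euler products, and the cases l = 3 and l = 6\<close>

definition residue_prod :: "nat \<Rightarrow> nat \<Rightarrow> rat fps" where
  "residue_prod l i = fps_infprod (\<lambda>u. 1 - fps_X ^ (l * (u - 1) + i))"

lemma residue_prod_nz: "residue_prod l i \<noteq> 0"
proof
  assume "residue_prod l i = 0"
  then have "fps_nth (residue_prod l i) 0 = 0" by simp
  then show False by (simp add: residue_prod_def)
qed

lemma Eul_residue_prod:
  assumes "a \<ge> 1" "b \<ge> 1"
  shows "Eul a = (\<Prod>i\<in>{1..b}. residue_prod (a * b) (a * i))"
proof -
  have adm: "fps_admissible (\<lambda>u. 1 - fps_X ^ (a * b * (u - 1) + a * i) :: rat fps)" if "i \<in> {1..b}" for i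
  proof (rule fps_admissible_one_minus)
    fix u :: nat assume "u \<ge> 1"
    have "1 * 1 \<le> a * b" "1 * 1 \<le> a * i" using assms that by (intro mult_le_mono; simp)+
    then have "1 * (u - 1) \<le> a * b * (u - 1)" "1 \<le> a * i" by (intro mult_le_mono1 | simp)+
    then show "u \<le> a * b * (u - 1) + a * i" using \<open>u \<ge> 1\<close> by linarith
  qed
  have "(\<Prod>i\<in>{1..b}. residue_prod (a * b) (a * i)) = fps_infprod (\<lambda>u. \<Prod>i\<in>{1..b}. 1 - fps_X ^ (a * b * (u - 1) + a * i))"
    unfolding residue_prod_def by (intro fps_infprod_prod[symmetric] adm) auto
  also have "\<dots> = fps_infprod (\<lambda>m. 1 - fps_X ^ (a * m))"
  proof (rule fps_infprod_blocks[where b = b, OF Eul_admissible[OF assms(1)] assms(2)])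
    show "fps_admissible (\<lambda>u. \<Prod>i\<in>{1..b}. 1 - fps_X ^ (a * b * (u - 1) + a * i) :: rat fps)"
      by (intro fps_admissible_prod adm) auto
  qed (simp add: distrib_left mult.assoc)
  finally show ?thesis by (simp add: Eul_eq_infprod)
qed

lemma Lambert_series_residue_prod:
  assumes "l \<ge> 3"
  shows "Lambert_series l * (residue_prod l 1 * residue_prod l (l - 1)) ^ 2 =
    residue_prod l 2 * residue_prod l (l - 2) * residue_prod l l ^ 2"
proof -
  have "l * (u - 1) + (l - i) = l * u - i" if "u \<ge> 1" "i \<le> l" for u i
    using that by (cases u) auto
  then have "residue_prod l (l - i) = fps_infprod (\<lambda>u. 1 - fps_X ^ (l * u - i))" if "i \<le> l" for i
    unfolding residue_prod_def using that by (intro fps_infprod_cong) simp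
  from this[of 1] this[of 2] show ?thesis
    using Lambert_series_product[OF assms] Eul_residue_prod[of l 1] assms by (simp add: residue_prod_def)
qed

text \<open>For l = 3 the residues 2 and l - 2 of the numerator are the residues l - 1 and 1 of the
  denominator, so one copy of each cancels.\<close>

lemma Lambert_series_3: "Lambert_series 3 * Eul 1 = Eul 3 ^ 3"
proof -
  let ?f = "residue_prod 3"
  have "{1..3::nat} = {1, 2, 3}" "{1..1::nat} = {1}" by auto
  then have E: "Eul 1 = ?f 1 * ?f 2 * ?f 3" "Eul 3 = ?f 3"
    using Eul_residue_prod[of 1 3] Eul_residue_prod[of 3 1] by (simp_all add: mult.assoc)
  have "Lambert_series 3 * (?f 1 * ?f 2) ^ 2 = ?f 2 * ?f 1 * ?f 3 ^ 2"
    using Lambert_series_residue_prod[of 3] by (simp add: One_nat_def)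
  then have "(?f 1 * ?f 2) * (Lambert_series 3 * (?f 1 * ?f 2)) = (?f 1 * ?f 2) * ?f 3 ^ 2"
    by (simp only: power2_eq_square mult_ac)
  then have "Lambert_series 3 * (?f 1 * ?f 2) = ?f 3 ^ 2"
    using residue_prod_nz[of 3 1] residue_prod_nz[of 3 2] by (simp only: mult_cancel_left mult_eq_0_iff) simp
  then show ?thesis by (simp add: E power3_eq_cube power2_eq_square mult.assoc[symmetric])
qed

text \<open>Multiplying both sides by the missing residue classes modulo 6 completes them to Euler
  products.\<close>

lemma Lambert_series_6: "Lambert_series 6 * (Eul 1 ^ 2 * Eul 6) = Eul 2 ^ 3 * Eul 3 ^ 2"
proof -
  let ?f = "residue_prod 6"
  have "{1..6::nat} = {1, 2, 3, 4, 5, 6}" "{1..3::nat} = {1, 2, 3}" "{1..2::nat} = {1, 2}" "{1..1::nat} = {1}" by auto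
  then have E: "Eul 1 = ?f 1 * ?f 2 * ?f 3 * ?f 4 * ?f 5 * ?f 6" "Eul 2 = ?f 2 * ?f 4 * ?f 6"
    "Eul 3 = ?f 3 * ?f 6" "Eul 6 = ?f 6"
    using Eul_residue_prod[of 1 6] Eul_residue_prod[of 2 3] Eul_residue_prod[of 3 2] Eul_residue_prod[of 6 1]
    by (simp_all add: mult.assoc)
  have "Lambert_series 6 * (?f 1 * ?f 5) ^ 2 = ?f 2 * ?f 4 * ?f 6 ^ 2"
    using Lambert_series_residue_prod[of 6] by simp
  then have "Lambert_series 6 * (?f 1 * ?f 5) ^ 2 * (?f 2 ^ 2 * ?f 3 ^ 2 * ?f 4 ^ 2 * ?f 6 ^ 3) =
      ?f 2 * ?f 4 * ?f 6 ^ 2 * (?f 2 ^ 2 * ?f 3 ^ 2 * ?f 4 ^ 2 * ?f 6 ^ 3)" by simp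
  then show ?thesis
    by (simp add: E power2_eq_square power3_eq_cube mult_ac)
qed

section \<open>The divisor function modulo 3 and its 2-dissection\<close>

definition div_count :: "nat \<Rightarrow> nat \<Rightarrow> nat" where
  "div_count r N = card {d. d dvd N \<and> d mod 3 = r}"

definition odd_div_count :: "nat \<Rightarrow> nat \<Rightarrow> nat" where
  "odd_div_count r N = card {d. d dvd N \<and> odd d \<and> d mod 3 = r}"

text \<open>An even divisor of 2N is twice a divisor of N, and an odd one already divides N.
  Doubling multiplies the residue modulo 3 by 2.\<close>

lemma div_count_double:
  assumes "N > 0" "r' = (2 * r) mod 3" "r < 3"
  shows "div_count r' (2 * N) = div_count r N + odd_div_count r' N"
proof -
  have "{d. d dvd 2 * N \<and> d mod 3 = r'} = (\<lambda>d. 2 * d) ` {d. d dvd N \<and> d mod 3 = r} \<union> {d. d dvd N \<and> odd d \<and> d mod 3 = r'}"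
  proof (intro equalityI subsetI)
    fix d assume d: "d \<in> {d. d dvd 2 * N \<and> d mod 3 = r'}"
    show "d \<in> (\<lambda>d. 2 * d) ` {d. d dvd N \<and> d mod 3 = r} \<union> {d. d dvd N \<and> odd d \<and> d mod 3 = r'}"
    proof (cases "even d")
      case True
      then obtain k where k: "d = 2 * k" by blast
      then have "(2 * k) mod 3 = (2 * r) mod 3" using d assms(2) by simp
      moreover have "r = 0 \<or> r = 1 \<or> r = 2" using assms(3) by auto
      ultimately have "k mod 3 = r" by (elim disjE; simp; presburger)
      then show ?thesis using d k by auto
    next
      case False
      then have "coprime d 2" by simp
      then show ?thesis using d False by (auto simp: coprime_dvd_mult_right_iff)
    qed
  next
    fix d assume "d \<in> (\<lambda>d. 2 * d) ` {d. d dvd N \<and> d mod 3 = r} \<union> {d. d dvd N \<and> odd d \<and> d mod 3 = r'}"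
    then show "d \<in> {d. d dvd 2 * N \<and> d mod 3 = r'}"
      using assms(2) by (auto simp: mod_mult_right_eq)
  qed
  moreover have "finite {d. d dvd N \<and> Q d}" for Q using assms(1) by (rule_tac finite_subset[OF _ finite_divisors_nat[of N]]) auto
  moreover have "(\<lambda>d. 2 * d) ` {d. d dvd N \<and> d mod 3 = r} \<inter> {d. d dvd N \<and> odd d \<and> d mod 3 = r'} = {}" by auto
  ultimately show ?thesis
    unfolding div_count_def odd_div_count_def
    by (simp add: card_Un_disjoint card_image inj_on_def)
qed

lemma odd_div_count_double: "odd_div_count r (2 * N) = odd_div_count r N"
proof -
  have "d dvd 2 * N \<longleftrightarrow> d dvd N" if "odd d" for d
    using that by (simp add: coprime_dvd_mult_right_iff)
  then have "{d. d dvd 2 * N \<and> odd d \<and> d mod 3 = r} = {d. d dvd N \<and> odd d \<and> d mod 3 = r}" by blast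
  then show ?thesis by (simp add: odd_div_count_def)
qed

text \<open>Each doubling exchanges the residues 1 and 2 and adds the odd divisors; after two
  doublings the residues are back and the odd contributions cancel in the difference.\<close>

lemma div_count_times_4:
  assumes "N > 0"
  shows "int (div_count 1 (4 * N)) - int (div_count 2 (4 * N)) = int (div_count 1 N) - int (div_count 2 N)"
  using div_count_double[of N 1 2] div_count_double[of N 2 1]
    div_count_double[of "2 * N" 1 2] div_count_double[of "2 * N" 2 1] assms
    odd_div_count_double[of 1 N] odd_div_count_double[of 2 N] by simp

lemma div_count_times_2_odd:
  assumes "odd N"
  shows "div_count 1 (2 * N) = div_count 2 (2 * N)"
proof -
  have "d dvd N \<Longrightarrow> odd d" for d using assms dvd_trans by blast
  then have "odd_div_count r N = div_count r N" for r
    unfolding odd_div_count_def div_count_def by (intro arg_cong[where f = card]) auto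
  moreover have "N > 0" using assms by (rule odd_pos)
  ultimately show ?thesis using div_count_double[of N 1 2] div_count_double[of N 2 1] by simp
qed

lemma Lambert_series_3_nth:
  "fps_nth (Lambert_series 3) n = of_int (int (div_count 1 (3 * n + 1)) - int (div_count 2 (3 * n + 1)))"
  by (simp add: Lambert_series_def div_count_def)

text \<open>By the class of n: for n = 2m the number 3n + 1 = 6m + 1 is odd, so residues of its
  divisors modulo 3 and modulo 6 correspond; for n = 4m + 1 it is 4(3m + 1); for n = 4m + 3 it is
  twice an odd number and the count vanishes.\<close>

lemma Lambert_series_3_bisect:
  "Lambert_series 3 = fps_dilate (Lambert_series 6) + fps_X * fps_dilate (fps_dilate (Lambert_series 3))"
proof (rule fps_ext)
  fix n :: nat
  have "n = 2 * (n div 2) \<or> n = 4 * (n div 4) + 1 \<or> n = 4 * (n div 4) + 3" by presburger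
  then consider m where "n = 2 * m" | m where "n = 4 * m + 1" | m where "n = 4 * m + 3" by blast
  then show "fps_nth (Lambert_series 3) n =
     fps_nth (fps_dilate (Lambert_series 6) + fps_X * fps_dilate (fps_dilate (Lambert_series 3))) n"
  proof cases
    case 1
    have odd: "odd d" if "d dvd 6 * m + 1" for d
      using that dvd_trans by (metis dvd_add_right_iff dvd_mult2 even_numeral odd_one even_add even_mult_iff)
    have "{d. d dvd 3 * n + 1 \<and> d mod 3 = 1} = {d. d dvd 6 * m + 1 \<and> d mod 6 = 1}"
    proof (rule Collect_cong, rule conj_cong)
      fix d assume "d dvd 6 * m + 1"
      from odd[OF this] show "d mod 3 = 1 \<longleftrightarrow> d mod 6 = 1" by presburger
    qed (simp add: 1)
    moreover have "{d. d dvd 3 * n + 1 \<and> d mod 3 = 2} = {d. d dvd 6 * m + 1 \<and> d mod 6 = 5}"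
    proof (rule Collect_cong, rule conj_cong)
      fix d assume "d dvd 6 * m + 1"
      from odd[OF this] show "d mod 3 = 2 \<longleftrightarrow> d mod 6 = 5" by presburger
    qed (simp add: 1)
    ultimately have "fps_nth (Lambert_series 3) n = fps_nth (Lambert_series 6) m"
      by (simp add: Lambert_series_def)
    then show ?thesis using 1 by (cases m) (auto simp: fps_dilate_nth fps_X_mult_nth)
  next
    case 2
    have "3 * n + 1 = 4 * (3 * m + 1)" using 2 by simp
    then have "fps_nth (Lambert_series 3) n = fps_nth (Lambert_series 3) m"
      unfolding Lambert_series_3_nth by (simp only: div_count_times_4[of "3 * m + 1"] zero_less_one add_pos_pos
        add_nonneg_pos zero_le)
    then show ?thesis using 2 by (simp add: fps_dilate_nth)
  next
    case 3
    have "3 * n + 1 = 2 * (6 * m + 5)" using 3 by simp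
    then have "fps_nth (Lambert_series 3) n = 0"
      unfolding Lambert_series_3_nth using div_count_times_2_odd[of "6 * m + 5"] by (simp only: diff_self) simp
    then show ?thesis using 3 by (simp add: fps_dilate_nth)
  qed
qed

declare fps_power_zeroth [simp]

text \<open>A nonzero constant term selects the square root; identities that can only be verified
  after squaring are resolved this way.\<close>

lemma fps_sq_eq_imp_eq:
  fixes a b :: "'a::{idom,ring_char_0} fps"
  assumes "a ^ 2 = b ^ 2" "fps_nth a 0 = fps_nth b 0" "fps_nth a 0 \<noteq> 0"
  shows "a = b"
proof -
  have "a = b \<or> a = - b" using assms(1) by (simp add: power2_eq_iff)
  moreover have "a \<noteq> - b"
  proof
    assume "a = - b"
    then have "fps_nth a 0 = - fps_nth b 0" by simp
    with assms(2,3) show False by simp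
  qed
  ultimately show ?thesis by blast
qed

subsection \<open>Eta quotients of level 12\<close>

definition eul :: "nat \<Rightarrow> rat fls" where "eul d = fps_to_fls (Eul d)"

lemma eul_nz [simp]: "eul d \<noteq> 0"
proof -
  have "Eul d \<noteq> 0"
  proof
    assume "Eul d = 0"
    then have "fps_nth (Eul d) 0 = 0" by simp
    then show False by simp
  qed
  then show ?thesis by (simp add: eul_def)
qed

text \<open>
  The six arguments are the exponents of \<open>E(q^d)\<close> for \<open>d = 1, 2, 3, 4, 6, 12\<close>. Laurent series are used
  because they form a field.
\<close>

definition eta_quot :: "int \<Rightarrow> int \<Rightarrow> int \<Rightarrow> int \<Rightarrow> int \<Rightarrow> int \<Rightarrow> rat fls" where
  "eta_quot r1 r2 r3 r4 r6 r12 = eul 1 powi r1 * eul 2 powi r2 * eul 3 powi r3 *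
     eul 4 powi r4 * eul 6 powi r6 * eul 12 powi r12"

lemma eta_quot_nz [simp]: "eta_quot r1 r2 r3 r4 r6 r12 \<noteq> 0"
  by (simp add: eta_quot_def)

lemma eta_quot_mult [simp]:
  "eta_quot r1 r2 r3 r4 r6 r12 * eta_quot s1 s2 s3 s4 s6 s12 =
   eta_quot (r1 + s1) (r2 + s2) (r3 + s3) (r4 + s4) (r6 + s6) (r12 + s12)"
  by (simp add: eta_quot_def power_int_add mult_ac)

lemma eta_quot_divide [simp]:
  "eta_quot r1 r2 r3 r4 r6 r12 / eta_quot s1 s2 s3 s4 s6 s12 =
   eta_quot (r1 - s1) (r2 - s2) (r3 - s3) (r4 - s4) (r6 - s6) (r12 - s12)"
  by (simp add: nonzero_divide_eq_eq)

lemma eta_quot_power [simp]: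
  "eta_quot r1 r2 r3 r4 r6 r12 ^ n =
   eta_quot (int n * r1) (int n * r2) (int n * r3) (int n * r4) (int n * r6) (int n * r12)"
  by (induction n) (simp_all add: distrib_right, simp add: eta_quot_def)

lemma eul_eta_quot:
  "eul 1 = eta_quot 1 0 0 0 0 0" "eul 2 = eta_quot 0 1 0 0 0 0" "eul 3 = eta_quot 0 0 1 0 0 0"
  "eul 4 = eta_quot 0 0 0 1 0 0" "eul 6 = eta_quot 0 0 0 0 1 0" "eul 12 = eta_quot 0 0 0 0 0 1"
  by (simp_all add: eta_quot_def)

text \<open>Solves for \<open>x\<close>: a product relation between Euler products, moved to Laurent
  series, becomes a vector of exponents.\<close>

lemma eta_quot_cancel:
  "x * eta_quot s1 s2 s3 s4 s6 s12 = eta_quot r1 r2 r3 r4 r6 r12 \<longleftrightarrow>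
    x = eta_quot (r1 - s1) (r2 - s2) (r3 - s3) (r4 - s4) (r6 - s6) (r12 - s12)"
  using eta_quot_divide by (metis eta_quot_nz nonzero_divide_eq_eq)

lemmas fls_transport = fls_times_fps_to_fls fps_to_fls_power fps_to_fls_plus fps_to_fls_minus

lemma fps_inverse_cancel:
  "fps_nth d 0 = (1::rat) \<Longrightarrow> f = n * inverse d \<Longrightarrow> f * d = n"
  using inverse_mult_eq_1[of d] by (simp add: mult.assoc)

text \<open>
  \<open>rho\<close> generates the function field of level 12. \<open>PDO2_eta\<close> will turn out to be the generating function
  of \<open>PDO (2 n)\<close>; this follows from \<open>4 M(q^2) - 2 = \<kappa> + 1 / \<kappa>\<close>, where \<open>\<kappa>\<close> is the quotient of the
  generating function of \<open>PDO\<close> at \<open>- q\<close> and at \<open>q\<close>.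
\<close>

definition g_eta :: "rat fps" where "g_eta = Eul 1 * Eul 2 * Eul 6 * inverse (Eul 3 ^ 3)"
text \<open>The factor by which g(q^2)^2 / g(q) differs from E(q^3)^3 / E(q). It is even in q, so it
  does not disturb the dissection of the Lambert series.\<close>

definition h_eta :: "rat fps" where "h_eta = Eul 2 * Eul 4 ^ 2 * Eul 12 ^ 2 * inverse (Eul 6 ^ 7)"
text \<open>q j(q^2) is the odd part of \<open>rho\<close>, and q j^2 equals
  \<open>xi * (xi - 1)\<close>.\<close>

definition j_eta :: "rat fps" where "j_eta = Eul 1 * Eul 2 * Eul 6 ^ 5 * inverse (Eul 3 ^ 7)"
definition kappa :: "rat fps" where "kappa = Eul 1 ^ 2 * Eul 3 ^ 2 * Eul 4 * Eul 12 * inverse (Eul 2 ^ 3 * Eul 6 ^ 3)"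
definition M_eta :: "rat fps" where "M_eta = Eul 4 ^ 4 * Eul 6 ^ 9 * inverse (Eul 1 * Eul 2 ^ 3 * Eul 3 ^ 5 * Eul 12 ^ 4)"
definition PDO2_eta :: "rat fps" where "PDO2_eta = Eul 4 ^ 2 * Eul 6 ^ 4 * inverse (Eul 1 ^ 2 * Eul 3 ^ 2 * Eul 12 ^ 2)"
definition rho :: "rat fps" where "rho = h_eta * Lambert_series 3"

lemma xi_mult: "xi * (Eul 1 * Eul 3 ^ 5) = Eul 2 ^ 5 * Eul 6"
  by (rule fps_inverse_cancel) (simp_all add: xi_def fps_divide_unit)

lemma xi_nth_0 [simp]: "fps_nth xi 0 = 1"
  by (simp add: xi_def fps_divide_unit)

lemma gamma_eq: "gamma = g_eta ^ 5"
proof -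
  have "gamma = Eul 1 ^ 5 * Eul 2 ^ 5 * Eul 6 ^ 5 * inverse (Eul 3 ^ 15)"
    by (simp add: gamma_def fps_divide_unit)
  also have "inverse (Eul 3 ^ 15) = inverse (Eul 3 ^ 3) ^ 5"
    by (simp add: fps_inverse_power power_mult[symmetric])
  finally show ?thesis by (simp add: g_eta_def power_mult_distrib)
qed

lemma g_eta_nth_0 [simp]: "fps_nth g_eta 0 = 1" by (simp add: g_eta_def)
lemma rho_nth_0 [simp]: "fps_nth rho 0 = 1"
proof -
  have "fps_nth (Lambert_series 3 * Eul 1) 0 = fps_nth (Eul 3 ^ 3) 0" by (simp only: Lambert_series_3)
  then show ?thesis by (simp add: rho_def h_eta_def)
qed

lemma eta_mults:
  "g_eta * Eul 3 ^ 3 = Eul 1 * Eul 2 * Eul 6"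
  "h_eta * Eul 6 ^ 7 = Eul 2 * Eul 4 ^ 2 * Eul 12 ^ 2"
  "j_eta * Eul 3 ^ 7 = Eul 1 * Eul 2 * Eul 6 ^ 5"
  "kappa * (Eul 2 ^ 3 * Eul 6 ^ 3) = Eul 1 ^ 2 * Eul 3 ^ 2 * Eul 4 * Eul 12"
  "M_eta * (Eul 1 * Eul 2 ^ 3 * Eul 3 ^ 5 * Eul 12 ^ 4) = Eul 4 ^ 4 * Eul 6 ^ 9"
  "PDO2_eta * (Eul 1 ^ 2 * Eul 3 ^ 2 * Eul 12 ^ 2) = Eul 4 ^ 2 * Eul 6 ^ 4"
  by (rule fps_inverse_cancel; simp add: g_eta_def h_eta_def j_eta_def kappa_def M_eta_def PDO2_eta_def)+

lemma transport_eq: "f = g \<Longrightarrow> fps_to_fls f = fps_to_fls g" by simp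

lemmas transport_simps = fls_times_fps_to_fls fps_to_fls_power eul_def[symmetric] eul_eta_quot eta_quot_cancel

lemma eta_quots:
  "fps_to_fls xi = eta_quot (-1) 5 (-5) 0 1 0"
  "fps_to_fls g_eta = eta_quot 1 1 (-3) 0 1 0"
  "fps_to_fls h_eta = eta_quot 0 1 0 2 (-7) 2"
  "fps_to_fls j_eta = eta_quot 1 1 (-7) 0 5 0"
  "fps_to_fls kappa = eta_quot 2 (-3) 2 1 (-3) 1"
  "fps_to_fls M_eta = eta_quot (-1) (-3) (-5) 4 9 (-4)"
  "fps_to_fls PDO2_eta = eta_quot (-2) 0 (-2) 2 4 (-2)"
  "fps_to_fls PDO_gf = eta_quot (-1) 0 (-1) 1 2 (-1)"
  "fps_to_fls (Lambert_series 3) = eta_quot (-1) 0 3 0 0 0"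
  using xi_mult[THEN transport_eq] eta_mults[THEN transport_eq] PDO_gf_Eul[THEN transport_eq]
    Lambert_series_3[THEN transport_eq]
  by (simp_all add: transport_simps)

lemma fps_dilate_Eul_simps [simp]:
  "fps_dilate (Eul 1) = Eul 2" "fps_dilate (Eul 2) = Eul 4" "fps_dilate (Eul 3) = Eul 6" "fps_dilate (Eul 6) = Eul 12"
  by (simp_all add: fps_dilate_Eul)

lemma eta_quots_dilate:
  "fps_to_fls (fps_dilate xi) = eta_quot 0 (-1) 0 5 (-5) 1"
  "fps_to_fls (fps_dilate g_eta) = eta_quot 0 1 0 1 (-3) 1"
  "fps_to_fls (fps_dilate j_eta) = eta_quot 0 1 0 1 (-7) 5"
  "fps_to_fls (fps_dilate (Lambert_series 6)) = eta_quot 0 (-2) 0 3 2 (-1)"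
  "fps_to_fls (fps_dilate (fps_dilate (Lambert_series 3))) = eta_quot 0 0 0 (-1) 0 3"
  using arg_cong[OF xi_mult, of fps_dilate, THEN transport_eq]
    arg_cong[OF eta_mults(1), of fps_dilate, THEN transport_eq]
    arg_cong[OF eta_mults(3), of fps_dilate, THEN transport_eq]
    arg_cong[OF Lambert_series_6, of fps_dilate, THEN transport_eq]
    arg_cong[OF Lambert_series_3, of "\<lambda>f. fps_dilate (fps_dilate f)", THEN transport_eq]
  by (simp_all add: transport_simps)

lemma fps_reflect_Eul_simps [simp]:
  "fps_reflect (Eul 2) = Eul 2" "fps_reflect (Eul 4) = Eul 4" "fps_reflect (Eul 6) = Eul 6" "fps_reflect (Eul 12) = Eul 12"
  by (simp_all add: fps_reflect_Eul_even)

lemma eta_quots_reflect_Eul: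
  "fps_to_fls (fps_reflect (Eul 1)) = eta_quot (-1) 3 0 (-1) 0 0"
  "fps_to_fls (fps_reflect (Eul 3)) = eta_quot 0 0 (-1) 0 3 (-1)"
  using fps_reflect_Eul_odd[of 1, THEN transport_eq] fps_reflect_Eul_odd[of 3, THEN transport_eq]
  by (simp_all add: transport_simps)

lemma eta_quots_reflect:
  "fps_to_fls (fps_reflect xi) = eta_quot 1 2 5 1 (-14) 5"
  "fps_to_fls (fps_reflect (Lambert_series 3)) = eta_quot 1 (-3) (-3) 1 9 (-3)"
  "fps_to_fls (fps_reflect PDO_gf) = eta_quot 1 (-3) 1 2 (-1) 0"
  using arg_cong[OF xi_mult, of fps_reflect, THEN transport_eq]
    arg_cong[OF Lambert_series_3, of fps_reflect, THEN transport_eq]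
    arg_cong[OF PDO_gf_Eul, of fps_reflect, THEN transport_eq]
  by (simp_all add: transport_simps eta_quots_reflect_Eul)

section \<open>Norm, trace and odd part of \<open>rho\<close>\<close>

abbreviation "xi2 \<equiv> fps_dilate xi"

lemma h_eta_reflect: "fps_reflect h_eta = h_eta"
proof -
  have "fps_reflect h_eta * Eul 6 ^ 7 = Eul 2 * Eul 4 ^ 2 * Eul 12 ^ 2"
    using arg_cong[OF eta_mults(2), of fps_reflect] by simp
  then have "fps_reflect h_eta * Eul 6 ^ 7 = h_eta * Eul 6 ^ 7" by (simp only: eta_mults(2))
  moreover have "Eul 6 ^ 7 \<noteq> 0" using eul_nz[of 6] by (simp add: eul_def)
  ultimately show ?thesis by simp
qed

lemma rho_reflect_mult: "rho * fps_reflect rho = xi2"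
proof -
  have "fps_to_fls (rho * fps_reflect rho) = fps_to_fls xi2"
    by (simp add: rho_def h_eta_reflect fls_times_fps_to_fls eta_quots eta_quots_dilate eta_quots_reflect)
  then show ?thesis by (simp only: fps_to_fls_eq_iff)
qed

lemma Lambert_series_3_reflect: "fps_reflect (Lambert_series 3) =
    fps_dilate (Lambert_series 6) - fps_X * fps_dilate (fps_dilate (Lambert_series 3))"
  by (subst Lambert_series_3_bisect) simp

text \<open>The even part of \<open>rho\<close> is \<open>h_eta\<close> times the even part of the
  Lambert series, and the exponents of this product are those of \<open>xi2\<close>.\<close>

lemma rho_reflect_add: "rho + fps_reflect rho = 2 * xi2"
proof -
  have "rho + fps_reflect rho = 2 * (h_eta * fps_dilate (Lambert_series 6))"
    unfolding rho_def fps_reflect_mult h_eta_reflect Lambert_series_3_reflect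
    by (subst Lambert_series_3_bisect) (simp add: algebra_simps)
  also have "h_eta * fps_dilate (Lambert_series 6) = xi2"
  proof -
    have "fps_to_fls (h_eta * fps_dilate (Lambert_series 6)) = fps_to_fls xi2"
      by (simp add: fls_times_fps_to_fls eta_quots eta_quots_dilate)
    then show ?thesis by (simp only: fps_to_fls_eq_iff)
  qed
  finally show ?thesis .
qed

lemma rho_minus_xi2: "rho - xi2 = fps_X * fps_dilate j_eta"
proof -
  have "2 * (rho - xi2) = rho - fps_reflect rho" using rho_reflect_add by (simp add: algebra_simps)
  also have "\<dots> = 2 * (fps_X * (h_eta * fps_dilate (fps_dilate (Lambert_series 3))))"
    unfolding rho_def fps_reflect_mult h_eta_reflect Lambert_series_3_reflect
    by (subst Lambert_series_3_bisect) (simp add: algebra_simps)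
  also have "h_eta * fps_dilate (fps_dilate (Lambert_series 3)) = fps_dilate j_eta"
  proof -
    have "fps_to_fls (h_eta * fps_dilate (fps_dilate (Lambert_series 3))) = fps_to_fls (fps_dilate j_eta)"
      by (simp add: fls_times_fps_to_fls eta_quots eta_quots_dilate)
    then show ?thesis by (simp only: fps_to_fls_eq_iff)
  qed
  finally have "2 * (rho - xi2) = 2 * (fps_X * fps_dilate j_eta)" .
  then show ?thesis by (metis mult_cancel_left zero_neq_numeral)
qed

lemma rho_square: "rho ^ 2 = 2 * xi2 * rho - xi2"
proof -
  have "fps_reflect rho = 2 * xi2 - rho" using rho_reflect_add by (simp add: algebra_simps)
  with rho_reflect_mult have "rho * (2 * xi2 - rho) = xi2" by simp
  then show ?thesis by (simp add: algebra_simps power2_eq_square)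
qed

text \<open>Completing the square in the equation of \<open>rho\<close> gives (\<rho> - y)^2 = y^2 -
  y. The left side is the square of the odd part of \<open>rho\<close>, so both sides are series in
  q^2 and can be undilated.\<close>

lemma xi_quadratic: "xi * (xi - 1) = fps_X * j_eta ^ 2"
proof -
  have "fps_dilate (xi * (xi - 1)) = (rho - xi2) ^ 2"
    using rho_square by (simp add: algebra_simps power2_eq_square)
  also have "\<dots> = fps_dilate (fps_X * j_eta ^ 2)"
    unfolding rho_minus_xi2 by (simp add: power_mult_distrib)
  finally show ?thesis by (simp only: fps_dilate_eq_iff)
qed

section \<open>Rational parametrisation by \<open>rho\<close> and the eta quotients it
  produces\<close>

abbreviation "rho_fls \<equiv> fps_to_fls rho"
abbreviation "xi2_fls \<equiv> fps_to_fls xi2"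

lemma rho_fls_eta: "rho_fls = eta_quot (-1) 1 3 2 (-7) 2"
  by (simp add: rho_def fls_times_fps_to_fls eta_quots)

lemma rho_fls_square: "rho_fls ^ 2 = xi2_fls * (2 * rho_fls - 1)"
  using transport_eq[OF rho_square] by (simp add: fls_transport algebra_simps)

lemma two_rho_minus_one: "2 * rho_fls - 1 = eta_quot (-2) 3 6 (-1) (-9) 3"
proof -
  have "(2 * rho_fls - 1) * xi2_fls = rho_fls ^ 2" using rho_fls_square by (simp add: mult.commute)
  then show ?thesis by (simp add: rho_fls_eta eta_quots_dilate eta_quot_cancel)
qed

text \<open>The quadratic equation gives y (\<rho> - 1) = \<rho> (\<rho> - y), and \<rho> - y is the
  odd part, already known as a product.\<close>

lemma rho_minus_one: "rho_fls - 1 = fls_X * eta_quot (-1) 3 3 (-2) (-9) 6"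
proof -
  have "(rho_fls - 1) * xi2_fls = rho_fls * (rho_fls - xi2_fls)" using rho_fls_square by (simp add: algebra_simps power2_eq_square)
  also have "rho_fls - xi2_fls = fls_X * eta_quot 0 1 0 1 (-7) 5"
    using transport_eq[OF rho_minus_xi2] by (simp add: fls_transport eta_quots_dilate)
  finally have "(rho_fls - 1) * xi2_fls = fls_X * (rho_fls * eta_quot 0 1 0 1 (-7) 5)" by simp
  also have "\<dots> = fls_X * eta_quot (-1) 3 3 (-2) (-9) 6 * xi2_fls" by (simp add: rho_fls_eta eta_quots_dilate mult.assoc)
  finally show ?thesis by (simp add: eta_quots_dilate)
qed

lemma two_rho_minus_one_nz: "2 * rho_fls - 1 \<noteq> 0" unfolding two_rho_minus_one by simp

text \<open>By exponents, q j^2 / \<xi> equals (\<rho> - 1)/(2\<rho> - 1)^2; by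
  \<open>xi_quadratic\<close> it also equals \<xi> - 1.\<close>

lemma xi_rational: "fps_to_fls xi = rho_fls * (4 * rho_fls - 3) / (2 * rho_fls - 1) ^ 2"
proof -
  have "(fps_to_fls xi - 1) * fps_to_fls xi = fls_X * eta_quot 2 2 (-14) 0 10 0"
    using transport_eq[OF xi_quadratic] by (simp add: fls_transport eta_quots mult.commute)
  also have "\<dots> = (rho_fls - 1) / (2 * rho_fls - 1) ^ 2 * fps_to_fls xi"
    unfolding rho_minus_one two_rho_minus_one by (simp add: eta_quots mult.assoc times_divide_eq_right[symmetric] del: times_divide_eq_right)
  finally have "fps_to_fls xi - 1 = (rho_fls - 1) / (2 * rho_fls - 1) ^ 2"
    using eta_quot_nz by (simp only: mult_cancel_right eta_quots) simp
  then have "fps_to_fls xi = 1 + (rho_fls - 1) / (2 * rho_fls - 1) ^ 2" by (simp add: algebra_simps)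
  also have "\<dots> = ((2 * rho_fls - 1) ^ 2 + (rho_fls - 1)) / (2 * rho_fls - 1) ^ 2"
    using two_rho_minus_one_nz by (simp add: add_divide_distrib)
  also have "(2 * rho_fls - 1) ^ 2 + (rho_fls - 1) = rho_fls * (4 * rho_fls - 3)" by (simp add: algebra_simps power2_eq_square)
  finally show ?thesis .
qed

lemma Y_rational: "xi2_fls = rho_fls ^ 2 / (2 * rho_fls - 1)"
  using rho_fls_square two_rho_minus_one_nz by (simp add: field_simps)

text \<open>Both \<xi> and y are rational functions of \<rho>, so this is a rational identity. It
  puts polynomials in \<xi> into the module spanned by 1 and \<rho> over polynomials in y, on which
  U can be read off.\<close>

lemma xi_eq_rho: "xi = 8 * xi2 - 8 * xi2 ^ 2 + (4 * xi2 - 3) * rho"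
proof -
  have "fps_to_fls xi = fps_to_fls (8 * xi2 - 8 * xi2 ^ 2 + (4 * xi2 - 3) * rho)"
    unfolding fls_transport fps_to_fls_numeral xi_rational Y_rational
    using two_rho_minus_one_nz by (simp add: divide_simps) algebra
  then show ?thesis by (simp only: fps_to_fls_eq_iff)
qed

lemma four_rho_minus_three: "4 * rho_fls - 3 = eta_quot (-4) 10 4 (-4) (-10) 4"
proof -
  have "fps_to_fls xi * (2 * rho_fls - 1) ^ 2 = (4 * rho_fls - 3) * rho_fls" using xi_rational two_rho_minus_one_nz by (simp add: field_simps)
  then have "(4 * rho_fls - 3) * rho_fls = fps_to_fls xi * (2 * rho_fls - 1) ^ 2" ..
  then show ?thesis unfolding two_rho_minus_one by (simp add: rho_fls_eta eta_quots eta_quot_cancel)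
qed

text \<open>Replacing \<rho> by its conjugate 2y - \<rho> in \<open>xi_eq_rho\<close> gives
  \<xi>(-q) = (3 - 2\<rho>) \<rho>, and \<xi>(-q) is an eta quotient.\<close>

lemma three_minus_two_rho: "3 - 2 * rho_fls = eta_quot 2 1 2 (-1) (-7) 3"
proof -
  have "fps_reflect rho = 2 * xi2 - rho" using rho_reflect_add by (simp add: algebra_simps)
  then have "fps_reflect xi = 8 * xi2 - 8 * xi2 ^ 2 + (4 * xi2 - 3) * (2 * xi2 - rho)"
    using arg_cong[OF xi_eq_rho, of fps_reflect] by simp
  also have "\<dots> = 2 * xi2 - (4 * xi2 - 3) * rho" by (simp add: algebra_simps power2_eq_square)
  also have "\<dots> = (3 - 2 * rho) * rho" using rho_square by algebra
  finally have "(3 - 2 * rho_fls) * rho_fls = fps_to_fls (fps_reflect xi)" by (simp add: fls_transport)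
  then show ?thesis by (simp add: rho_fls_eta eta_quots_reflect eta_quot_cancel)
qed

lemma nine_minus_xi: "9 - 8 * fps_to_fls xi = ((3 - 2 * rho_fls) / (2 * rho_fls - 1)) ^ 2"
  unfolding xi_rational using two_rho_minus_one_nz by (simp add: divide_simps) algebra

lemma g_eta_dilate: "fps_dilate g_eta ^ 2 = rho * g_eta"
proof -
  have "fps_to_fls (fps_dilate g_eta ^ 2) = fps_to_fls (rho * g_eta)"
    by (simp add: fls_transport rho_fls_eta eta_quots eta_quots_dilate)
  then show ?thesis by (simp only: fps_to_fls_eq_iff)
qed

text \<open>Makes the sixth power of \<open>g_eta\<close> a polynomial in \<xi>. It is needed to
  bring the two terms of \<open>Phi 3\<close> to the same power of \<open>g_eta\<close>.\<close>

lemma g_eta_sixth: "g_eta ^ 6 = xi ^ 2 * (9 - 8 * xi)"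
proof -
  have "fps_to_fls (g_eta ^ 6) = fps_to_fls (xi ^ 2 * (9 - 8 * xi))"
    unfolding fls_transport fps_to_fls_numeral nine_minus_xi three_minus_two_rho two_rho_minus_one by (simp add: eta_quots)
  then show ?thesis by (simp only: fps_to_fls_eq_iff)
qed

text \<open>\<open>M_eta\<close> involves the square root (3 - 2\<rho>)/(2\<rho> - 1) of 9 - 8\<xi>;
  squaring makes the relation rational in \<xi>.\<close>

lemma M_eta_relation: "(4 * M_eta - 2) ^ 2 * (9 - 8 * xi) = (6 - 4 * xi) ^ 2"
proof -
  have M: "fps_to_fls M_eta = rho_fls / ((2 * rho_fls - 1) * (3 - 2 * rho_fls))"
    unfolding three_minus_two_rho two_rho_minus_one by (simp add: rho_fls_eta eta_quots)
  have nz: "3 - 2 * rho_fls \<noteq> 0" unfolding three_minus_two_rho by simp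
  have "fps_to_fls ((4 * M_eta - 2) ^ 2 * (9 - 8 * xi)) = fps_to_fls ((6 - 4 * xi) ^ 2)"
    unfolding fls_transport fps_to_fls_numeral nine_minus_xi M xi_rational using two_rho_minus_one_nz nz
    by (simp add: divide_simps) algebra
  then show ?thesis by (simp only: fps_to_fls_eq_iff)
qed

lemma kappa_nth_0 [simp]: "fps_nth kappa 0 = 1" by (simp add: kappa_def)
lemma M_eta_nth_0 [simp]: "fps_nth M_eta 0 = 1" by (simp add: M_eta_def)
lemma PDO2_eta_nth_0 [simp]: "fps_nth PDO2_eta 0 = 1" by (simp add: PDO2_eta_def)

text \<open>The right-hand side is that of \<open>M_eta_relation\<close> at q^2, so \<kappa> +
  1/\<kappa> and 4 M(q^2) - 2 have equal squares.\<close>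

lemma kappa_relation: "(1 + kappa ^ 2) ^ 2 * (9 - 8 * xi2) = (6 - 4 * xi2) ^ 2 * kappa ^ 2"
proof -
  have K: "fps_to_fls kappa ^ 2 = (2 * rho_fls - 1) * (3 - 2 * rho_fls) / (4 * rho_fls - 3)"
    unfolding three_minus_two_rho two_rho_minus_one four_rho_minus_three by (simp add: eta_quots)
  have nz: "4 * rho_fls - 3 \<noteq> 0" unfolding four_rho_minus_three by simp
  have "fps_to_fls ((1 + kappa ^ 2) ^ 2 * (9 - 8 * xi2)) = fps_to_fls ((6 - 4 * xi2) ^ 2 * kappa ^ 2)"
    unfolding fls_transport fps_to_fls_numeral fps_one_to_fls K Y_rational using two_rho_minus_one_nz nz
    by (simp add: divide_simps) algebra
  then show ?thesis by (simp only: fps_to_fls_eq_iff)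
qed

lemma kappa_M_eta: "1 + kappa ^ 2 = (4 * fps_dilate M_eta - 2) * kappa"
proof (rule fps_sq_eq_imp_eq)
  have "(4 * fps_dilate M_eta - 2) ^ 2 * (9 - 8 * xi2) = (6 - 4 * xi2) ^ 2"
    using arg_cong[OF M_eta_relation, of fps_dilate] by simp
  then have "(1 + kappa ^ 2) ^ 2 * (9 - 8 * xi2) = ((4 * fps_dilate M_eta - 2) * kappa) ^ 2 * (9 - 8 * xi2)"
    unfolding kappa_relation by (simp add: power_mult_distrib mult_ac)
  moreover have "9 - 8 * xi2 \<noteq> 0"
  proof
    assume "9 - 8 * xi2 = 0"
    then have "fps_nth (9 - 8 * xi2) 0 = 0" by simp
    then show False by (simp add: fps_dilate_nth numeral_fps_const)
  qed
  ultimately show "(1 + kappa ^ 2) ^ 2 = ((4 * fps_dilate M_eta - 2) * kappa) ^ 2" by simp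
qed (simp_all add: fps_dilate_nth numeral_fps_const)

text \<open>With P the generating function, P(-q) = \<kappa> P, so the claim is (1 + \<kappa>) P = 2
  \<open>PDO2_eta\<close>(q^2). After squaring, 1 + \<kappa>^2 + 2\<kappa> = 4 M(q^2) \<kappa>
  reduces it to an identity of eta quotients; constant terms fix the sign.\<close>

lemma PDO_gf_bisect: "fps_bisect PDO_gf = PDO2_eta"
proof (rule fps_bisect_eqI)
  have refl: "fps_reflect PDO_gf = PDO_gf * kappa"
  proof -
    have "fps_to_fls (fps_reflect PDO_gf) = fps_to_fls (PDO_gf * kappa)"
      by (simp add: fls_transport eta_quots eta_quots_reflect)
    then show ?thesis by (simp only: fps_to_fls_eq_iff)
  qed
  have "PDO2_eta ^ 2 * (Eul 1 ^ 3 * Eul 6) = M_eta * (Eul 2 ^ 3 * Eul 3)"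
  proof -
    have "fps_to_fls (PDO2_eta ^ 2 * (Eul 1 ^ 3 * Eul 6)) = fps_to_fls (M_eta * (Eul 2 ^ 3 * Eul 3))"
      by (simp add: fls_transport eta_quots eul_def[symmetric] eul_eta_quot)
    then show ?thesis by (simp only: fps_to_fls_eq_iff)
  qed
  from arg_cong[OF this, of fps_dilate]
  have "fps_dilate PDO2_eta ^ 2 * (Eul 2 ^ 3 * Eul 12) = fps_dilate M_eta * (Eul 4 ^ 3 * Eul 6)" by simp
  also have "Eul 4 ^ 3 * Eul 6 = PDO_gf ^ 2 * kappa * (Eul 2 ^ 3 * Eul 12)"
  proof -
    have "fps_to_fls (Eul 4 ^ 3 * Eul 6) = fps_to_fls (PDO_gf ^ 2 * kappa * (Eul 2 ^ 3 * Eul 12))"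
      by (simp add: fls_transport eta_quots eul_def[symmetric] eul_eta_quot)
    then show ?thesis by (simp only: fps_to_fls_eq_iff)
  qed
  finally have "fps_dilate PDO2_eta ^ 2 * (Eul 2 ^ 3 * Eul 12) =
      (fps_dilate M_eta * PDO_gf ^ 2 * kappa) * (Eul 2 ^ 3 * Eul 12)" by (simp add: mult_ac)
  moreover have "Eul 2 ^ 3 * Eul 12 \<noteq> 0" using eul_nz[of 2] eul_nz[of 12] by (simp add: eul_def)
  ultimately have sq: "fps_dilate PDO2_eta ^ 2 = fps_dilate M_eta * PDO_gf ^ 2 * kappa" by simp
  have "fps_nth (PDO_gf * (Eul 1 * Eul 3 * Eul 12)) 0 = 1" unfolding PDO_gf_Eul by simp
  then have P0: "fps_nth PDO_gf 0 = 1" by simp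
  show "PDO_gf + fps_reflect PDO_gf = 2 * fps_dilate PDO2_eta"
  proof (rule fps_sq_eq_imp_eq)
    have "(PDO_gf + fps_reflect PDO_gf) ^ 2 = PDO_gf ^ 2 * ((1 + kappa ^ 2) + 2 * kappa)"
      unfolding refl by (simp add: algebra_simps power2_eq_square)
    also have "\<dots> = (2 * fps_dilate PDO2_eta) ^ 2"
      unfolding kappa_M_eta by (simp add: power_mult_distrib sq algebra_simps)
    finally show "(PDO_gf + fps_reflect PDO_gf) ^ 2 = (2 * fps_dilate PDO2_eta) ^ 2" .
  qed (simp_all add: P0 refl fps_dilate_nth numeral_fps_const)
qed

lemma PDO2_eta_dilate: "fps_dilate g_eta ^ 5 * PDO2_eta = xi2 * (xi * rho)"
proof -
  have "fps_to_fls (fps_dilate g_eta ^ 5 * PDO2_eta) = fps_to_fls (xi2 * (xi * rho))"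
    by (simp add: fls_transport rho_fls_eta eta_quots eta_quots_dilate)
  then show ?thesis by (simp only: fps_to_fls_eq_iff)
qed

subsection \<open>The recursion and its integral lattice\<close>

definition ipoly :: "int poly \<Rightarrow> 'a::comm_ring_1 \<Rightarrow> 'a" where
  "ipoly p z = poly (map_poly of_int p) z"

lemma map_poly_of_int_hom:
  "map_poly of_int (p + q) = (map_poly of_int p + map_poly of_int q :: 'a::comm_ring_1 poly)"
  "map_poly of_int (p - q) = (map_poly of_int p - map_poly of_int q :: 'a::comm_ring_1 poly)"
  "map_poly of_int (p * q) = (map_poly of_int p * map_poly of_int q :: 'a::comm_ring_1 poly)"
  by (rule poly_eqI, simp add: coeff_map_poly coeff_mult)+

lemma ipoly_simps [simp]:
  "ipoly (p + q) z = ipoly p z + ipoly q z" "ipoly (p - q) z = ipoly p z - ipoly q z"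
  "ipoly (p * q) z = ipoly p z * ipoly q z" "ipoly (pCons a p) z = of_int a + z * ipoly p z"
  "ipoly 0 z = 0" "ipoly 1 z = 1"
  by (simp_all add: ipoly_def map_poly_of_int_hom map_poly_pCons)

lemma ipoly_power [simp]: "ipoly (p ^ n) z = ipoly p z ^ n"
  by (induction n) simp_all

lemma ipoly_pcompose: "ipoly (p \<circ>\<^sub>p q) z = ipoly p (ipoly q z)"
  by (induction p) (simp_all add: pcompose_pCons)

lemma ipoly_nth_0: "fps_nth (ipoly p f) 0 = (ipoly p (fps_nth f 0) :: 'a::comm_ring_1)"
  by (induction p) (simp_all add: fps_of_int[symmetric])

lemma ipoly_of_int: "ipoly p (of_int m) = (of_int (poly p m) :: 'a::comm_ring_1)"
  by (induction p) simp_all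

definition PDO_sec :: "nat \<Rightarrow> rat fps" where
  "PDO_sec k = Abs_fps (\<lambda>n. of_nat (PDO (2 ^ k * n)))"

lemma PDO_sec_0: "PDO_sec 0 = PDO_gf" by (simp add: PDO_sec_def PDO_gf_def)

lemma PDO_sec_Suc: "PDO_sec (Suc k) = fps_bisect (PDO_sec k)"
  by (rule fps_ext) (simp add: PDO_sec_def mult_ac)

text \<open>Dilating \<open>g_eta ^ (2 * n)\<close> gives (\<rho> g)^n, which can be moved inside U.
  This is the whole mechanism of the recursion.\<close>

lemma bisect_step: "g_eta ^ (2 * n) * fps_bisect f = fps_bisect (rho ^ n * (g_eta ^ n * f))"
proof -
  have "fps_dilate (g_eta ^ (2 * n)) = rho ^ n * g_eta ^ n"
    by (simp add: power_mult g_eta_dilate power_mult_distrib)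
  then show ?thesis using fps_bisect_dilate_mult[of "g_eta ^ (2 * n)" f] by (simp add: mult.assoc)
qed

lemma bisect_rho: "fps_bisect rho = xi"
  by (rule fps_bisect_eqI) (rule rho_reflect_add)

lemma rho_sq_xi: "rho ^ 2 * xi = xi2 * (3 * rho - 2 * xi2)"
proof -
  have "rho * xi = (8 * xi2 - 8 * xi2 ^ 2) * rho + (4 * xi2 - 3) * rho ^ 2"
    by (subst xi_eq_rho) (simp add: algebra_simps power2_eq_square)
  also have "\<dots> = xi2 * (3 - 4 * xi2 + 2 * rho)"
    unfolding rho_square by (simp add: algebra_simps power2_eq_square)
  finally have rx: "rho * xi = xi2 * (3 - 4 * xi2 + 2 * rho)" .
  have "rho ^ 2 * xi = rho * (rho * xi)" by (simp add: power2_eq_square mult.assoc)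
  also have "\<dots> = xi2 * ((3 - 4 * xi2) * rho + 2 * rho ^ 2)"
    unfolding rx by (simp add: algebra_simps power2_eq_square)
  finally show ?thesis unfolding rho_square by (simp add: algebra_simps power2_eq_square)
qed

lemma rho_fourth_xi_sq: "rho ^ 4 * xi ^ 2 = xi2 ^ 3 * (6 * rho + 4 * xi2 - 9)"
proof -
  have "rho ^ 4 * xi ^ 2 = (rho ^ 2 * xi) ^ 2" by (simp add: power_mult_distrib)
  also have "\<dots> = xi2 ^ 2 * (9 * rho ^ 2 - 12 * xi2 * rho + 4 * xi2 ^ 2)"
    unfolding rho_sq_xi by (simp add: algebra_simps power2_eq_square)
  also have "\<dots> = xi2 ^ 3 * (6 * rho + 4 * xi2 - 9)"
    unfolding rho_square by (simp add: algebra_simps power2_eq_square power3_eq_cube)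
  finally show ?thesis .
qed

abbreviation "T_eta \<equiv> (2 * rho - 1) * (6 * rho + 4 * xi2 - 9)"

text \<open>Raising the exponent of \<rho> by 6 and that of \<xi> by 2 costs only the factor y^4,
  which leaves U as \<xi>^4, and \<open>T_eta\<close>, which is harmless modulo 4.\<close>

lemma rho_sixth_xi_sq: "rho ^ 6 * xi ^ 2 = xi2 ^ 4 * T_eta"
proof -
  have "rho ^ 6 * xi ^ 2 = rho ^ 2 * (rho ^ 4 * xi ^ 2)"
    by (simp only: mult.assoc[symmetric] power_add[symmetric]) simp
  also have "\<dots> = xi2 * (2 * rho - 1) * (xi2 ^ 3 * (6 * rho + 4 * xi2 - 9))"
    unfolding rho_fourth_xi_sq rho_square by (simp add: right_diff_distrib mult_ac)
  finally have "rho ^ 6 * xi ^ 2 = xi2 * xi2 ^ 3 * T_eta" by (simp only: mult_ac)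
  also have "xi2 * xi2 ^ 3 = xi2 ^ 4" using power_add[of xi2 1 3] by simp
  finally show ?thesis .
qed

text \<open>The shape for odd k, where 5 * 2^k = 6a + 4; \<open>even_step_eq\<close> treats even k
  >= 2, where 5 * 2^k = 6b + 2.\<close>

lemma odd_step_eq: "rho ^ (6 * a + 4) * xi ^ (2 * a + 2) =
    xi2 ^ (4 * a + 3) * (T_eta ^ a * (6 * rho + 4 * xi2 - 9))"
proof -
  have "rho ^ (6 * a + 4) * xi ^ (2 * a + 2) = (rho ^ 6 * xi ^ 2) ^ a * (rho ^ 4 * xi ^ 2)"
    by (simp only: power_mult_distrib power_mult[symmetric] power_add mult_ac)
  then show ?thesis unfolding rho_sixth_xi_sq rho_fourth_xi_sq
    by (simp only: power_mult_distrib power_mult[symmetric] power_add mult_ac)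
qed

lemma even_step_eq: "rho ^ (6 * b + 2) * xi ^ (2 * b + 1) =
    xi2 ^ (4 * b + 1) * (T_eta ^ b * (3 * rho - 2 * xi2))"
proof -
  have "rho ^ (6 * b + 2) * xi ^ (2 * b + 1) = (rho ^ 6 * xi ^ 2) ^ b * (rho ^ 2 * xi)"
    by (simp only: power_mult_distrib power_mult[symmetric] power_add mult_ac power_one_right)
  then show ?thesis unfolding rho_sixth_xi_sq rho_sq_xi
    by (simp only: power_mult_distrib power_mult[symmetric] power_add mult_ac power_one_right)
qed

section \<open>The doubled variables and their integral lattice\<close>

definition X2 :: "rat fps" where "X2 = 2 * xi"
definition Y2 :: "rat fps" where "Y2 = 2 * xi2"
definition R2 :: "rat fps" where "R2 = 2 * rho"

lemma X2_nth_0 [simp]: "fps_nth X2 0 = 2"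
  by (simp add: X2_def numeral_fps_const)

lemma fps_dilate_X2 [simp]: "fps_dilate X2 = Y2"
  by (simp add: X2_def Y2_def)

text \<open>The doubling pays off here: the equation stays integral and R^2 becomes divisible by
  2.\<close>

lemma R2_square: "R2 ^ 2 = 2 * Y2 * (R2 - 1)"
proof -
  have "R2 ^ 2 = 4 * rho ^ 2" by (simp add: R2_def power_mult_distrib)
  then show ?thesis unfolding rho_square by (simp add: R2_def Y2_def algebra_simps)
qed

lemma R2_mult: "(a + b * R2) * (c + d * R2) = (a * c - 2 * Y2 * b * d) + (a * d + b * c + 2 * Y2 * b * d) * R2"
proof -
  have "(a + b * R2) * (c + d * R2) = a * c + (a * d + b * c) * R2 + b * d * R2 ^ 2"
    by (simp add: algebra_simps power2_eq_square)
  then show ?thesis unfolding R2_square by (simp add: algebra_simps)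
qed

lemma X2_eq: "X2 = (2 * Y2 - 3) * R2 + 8 * Y2 - 4 * Y2 ^ 2"
  unfolding X2_def R2_def Y2_def by (subst xi_eq_rho) (simp add: algebra_simps power2_eq_square)

lemma T_eta_eq: "T_eta = (R2 - 1) * (3 * R2 + 2 * Y2 - 9)"
  unfolding R2_def Y2_def by simp

lemma bisect_R2: "fps_bisect R2 = X2"
  by (simp only: R2_def X2_def mult_2 fps_bisect_simps bisect_rho)

lemma bisect_normal_form: "fps_bisect (fps_dilate a + fps_dilate b * R2) = a + b * X2"
  by (simp add: fps_bisect_dilate_mult bisect_R2)

definition ZX :: "rat fps set" where "ZX = range (\<lambda>p. ipoly p X2)"

lemma ZX_intros [intro]:
  "a \<in> ZX \<Longrightarrow> b \<in> ZX \<Longrightarrow> a + b \<in> ZX" "a \<in> ZX \<Longrightarrow> b \<in> ZX \<Longrightarrow> a - b \<in> ZX"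
  "a \<in> ZX \<Longrightarrow> b \<in> ZX \<Longrightarrow> a * b \<in> ZX" "0 \<in> ZX" "1 \<in> ZX" "of_int m \<in> ZX" "X2 \<in> ZX"
proof -
  assume "a \<in> ZX" "b \<in> ZX"
  then obtain p q where "a = ipoly p X2" "b = ipoly q X2" by (auto simp: ZX_def)
  then have "a + b = ipoly (p + q) X2" "a - b = ipoly (p - q) X2" "a * b = ipoly (p * q) X2" by simp_all
  then show "a + b \<in> ZX" "a - b \<in> ZX" "a * b \<in> ZX" unfolding ZX_def by blast+
next
  have "0 = ipoly 0 X2" "1 = ipoly 1 X2" "of_int m = ipoly [:m:] X2" "X2 = ipoly [:0, 1:] X2"
    by simp_all
  then show "0 \<in> ZX" "1 \<in> ZX" "of_int m \<in> ZX" "X2 \<in> ZX" unfolding ZX_def by blast+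
qed

lemma ZX_numeral [intro]: "numeral k \<in> ZX"
  using ZX_intros(6)[of "numeral k"] by simp

text \<open>The value of X at q = 0 is 2, so the underlying polynomial has the root 2; the divisor
  is monic, so the quotient is integral.\<close>

lemma ZX_vanishing:
  assumes "a \<in> ZX" "fps_nth a 0 = 0"
  shows "\<exists>b\<in>ZX. a = (X2 - 2) * b"
proof -
  obtain p where p: "a = ipoly p X2" using assms by (auto simp: ZX_def)
  then have "fps_nth a 0 = ipoly p (of_int 2)" by (simp only: ipoly_nth_0 X2_nth_0 of_int_numeral)
  then have "poly p 2 = 0" using assms(2) by (simp only: ipoly_of_int of_int_eq_0_iff)
  then have "[:- 2, 1:] dvd p" by (simp only: poly_eq_0_iff_dvd)
  then obtain q where "p = [:- 2, 1:] * q" unfolding dvd_def by blast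
  then have "a = ipoly [:- 2, 1:] X2 * ipoly q X2" using p by (simp only: ipoly_simps(3))
  also have "ipoly [:- 2, 1:] X2 = X2 - 2" by simp
  finally have "a = (X2 - 2) * ipoly q X2" .
  then show ?thesis by (auto simp: ZX_def)
qed

text \<open>The coordinates are stored undilated, as polynomials in X, so that U sends the element
  to \<open>a + b * X2\<close>.\<close>

definition Lat :: "rat fps set" where
  "Lat = {fps_dilate a + fps_dilate b * R2 | a b. a \<in> ZX \<and> b \<in> ZX}"

lemma LatI: "f = fps_dilate a + fps_dilate b * R2 \<Longrightarrow> a \<in> ZX \<Longrightarrow> b \<in> ZX \<Longrightarrow> f \<in> Lat"
  by (auto simp: Lat_def)

lemma Lat_intros [intro]:
  "f \<in> Lat \<Longrightarrow> h \<in> Lat \<Longrightarrow> f + h \<in> Lat" "f \<in> Lat \<Longrightarrow> h \<in> Lat \<Longrightarrow> f - h \<in> Lat"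
  "f \<in> Lat \<Longrightarrow> h \<in> Lat \<Longrightarrow> f * h \<in> Lat"
proof -
  assume "f \<in> Lat" "h \<in> Lat"
  then obtain a b c d where ZX: "a \<in> ZX" "b \<in> ZX" "c \<in> ZX" "d \<in> ZX"
    and f: "f = fps_dilate a + fps_dilate b * R2" and h: "h = fps_dilate c + fps_dilate d * R2"
    by (auto simp: Lat_def)
  have "f + h = fps_dilate (a + c) + fps_dilate (b + d) * R2" by (simp add: f h algebra_simps)
  then show "f + h \<in> Lat" by (rule LatI) (use ZX in blast)+
  have "f - h = fps_dilate (a - c) + fps_dilate (b - d) * R2" by (simp add: f h algebra_simps)
  then show "f - h \<in> Lat" by (rule LatI) (use ZX in blast)+
  have "f * h = fps_dilate (a * c - 2 * X2 * b * d) + fps_dilate (a * d + b * c + 2 * X2 * b * d) * R2"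
    unfolding f h by (simp add: R2_mult)
  then show "f * h \<in> Lat" by (rule LatI) (use ZX in blast)+
qed

lemma fps_dilate_of_int: "fps_dilate (of_int m) = of_int m"
  by (induction m) (auto simp: fps_eq_iff fps_dilate_nth fps_of_int[symmetric])

lemma Lat_base [intro]: "a \<in> ZX \<Longrightarrow> fps_dilate a \<in> Lat" "R2 \<in> Lat" "Y2 \<in> Lat" "of_int m \<in> Lat"
  "numeral k \<in> Lat" "1 \<in> Lat" "0 \<in> Lat"
proof -
  show dil: "a \<in> ZX \<Longrightarrow> fps_dilate a \<in> Lat" for a by (rule LatI[of _ a 0]) auto
  show "R2 \<in> Lat" by (rule LatI[of _ 0 1]) auto
  show "Y2 \<in> Lat" using dil[of "X2"] by auto
  show of_int: "of_int m \<in> Lat" for m using dil[OF ZX_intros(6)[of m]] by (simp only: fps_dilate_of_int)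
  show "numeral k \<in> Lat" "1 \<in> Lat" "0 \<in> Lat" using of_int[of "numeral k"] of_int[of 1] of_int[of 0] by simp_all
qed

lemma Lat_power [intro]: "a \<in> Lat \<Longrightarrow> a ^ n \<in> Lat"
  by (induction n) auto

lemma X2_Lat [intro]: "X2 \<in> Lat"
  unfolding X2_eq by (intro Lat_intros Lat_base(2-7) Lat_power)

lemma ZX_Lat [intro]: "a \<in> ZX \<Longrightarrow> a \<in> Lat"
proof -
  have "ipoly p X2 \<in> Lat" for p
    by (induction p) (simp_all add: Lat_intros Lat_base X2_Lat)
  then show "a \<in> ZX \<Longrightarrow> a \<in> Lat" by (auto simp: ZX_def)
qed

lemma bisect_Lat: "f \<in> Lat \<Longrightarrow> fps_bisect f \<in> ZX"
proof -
  assume "f \<in> Lat"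
  then obtain a b where ab: "a \<in> ZX" "b \<in> ZX" and f: "f = fps_dilate a + fps_dilate b * R2"
    by (auto simp: Lat_def)
  have "fps_bisect f = a + b * X2" unfolding f by (rule bisect_normal_form)
  then show ?thesis using ab by auto
qed

lemma bisect_scalar: "fps_bisect (2 * f) = 2 * fps_bisect f" "fps_bisect (4 * f) = 4 * fps_bisect (f :: rat fps)"
  "fps_bisect (of_int m * f) = of_int m * fps_bisect f"
proof -
  show *: "fps_bisect (of_int m * f) = of_int m * fps_bisect f" for m
    using fps_bisect_dilate_mult[of "of_int m" f] by (simp only: fps_dilate_of_int)
  show "fps_bisect (2 * f) = 2 * fps_bisect f" "fps_bisect (4 * f) = 4 * fps_bisect f"
    using *[of 2] *[of 4] by simp_all
qed

text \<open>Reducing R^2 gives T = 1 + 4 (2 Y R - 2 Y - 3 R + 2), and elements 1 + 4 l are closed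
  under multiplication.\<close>

lemma T_eta_power: "\<exists>l\<in>Lat. T_eta ^ n = 1 + 4 * l"
proof (induction n)
  case (Suc n)
  then obtain l where l: "l \<in> Lat" "T_eta ^ n = 1 + 4 * l" by blast
  define m where "m = 2 * Y2 * R2 - 2 * Y2 - 3 * R2 + 2"
  have m: "m \<in> Lat" unfolding m_def by (intro Lat_intros Lat_base(2-7))
  have T: "T_eta = 1 + 4 * m" unfolding m_def T_eta_eq
    using R2_mult[of "-1" 1 "2 * Y2 - 9" 3] by (simp add: algebra_simps)
  have "T_eta ^ Suc n = (1 + 4 * m) * (1 + 4 * l)" unfolding power_Suc l(2) by (simp only: T)
  also have "\<dots> = 1 + 4 * (m + l + 4 * m * l)" by (simp add: algebra_simps)
  finally have "T_eta ^ Suc n = 1 + 4 * (m + l + 4 * m * l)" .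
  moreover have "m + l + 4 * m * l \<in> Lat" by (intro Lat_intros l(1) m Lat_base(2-7))
  ultimately show ?case by blast
qed (auto intro!: bexI[of _ 0])

text \<open>
  Modulo 2 the lattice satisfies \<open>X = R\<close> and \<open>X^2 = 0\<close>, so only the constant term of \<open>w\<close> survives.
\<close>

lemma odd_step:
  assumes "w \<in> ZX"
  shows "\<exists>m. \<exists>z\<in>ZX. fps_bisect (rho ^ (6 * a + 4) * (xi ^ (2 * a + 2) * ((X2 - 2) * w))) =
    xi ^ (4 * a + 3) * ((X2 - 2) * (of_int m + 2 * z))"
proof -
  obtain p where "w = ipoly p X2" using assms by (auto simp: ZX_def)
  then obtain m w1 where w1: "w1 \<in> ZX" and w: "w = of_int m + X2 * w1"
    by (cases p) (auto simp: ZX_def)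
  obtain l where l: "l \<in> Lat" "T_eta ^ a = 1 + 4 * l" using T_eta_power by blast
  define s where "s = 3 * R2 + 2 * Y2 - 9"
  \<comment> \<open>\<open>mu\<close> is half of s X - R, and \<open>v\<close> is half of X^2; both
    are lattice elements.\<close>
  define mu where "mu = R2 * (2 * Y2 ^ 2 - 9 * Y2 + 13) + 20 * Y2 ^ 2 - 4 * Y2 ^ 3 - 27 * Y2"
  define v where "v = (2 * Y2 - 3) ^ 2 * Y2 * (R2 - 1) + (2 * Y2 - 3) * (8 * Y2 - 4 * Y2 ^ 2) * R2
     + 8 * (2 * Y2 - Y2 ^ 2) ^ 2"
  have Lat: "s \<in> Lat" "mu \<in> Lat" "v \<in> Lat" unfolding s_def mu_def v_def by (intro Lat_intros Lat_base(2-7) Lat_power)+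
  have smu: "s * X2 = R2 + 2 * mu"
    using R2_mult[of "2 * Y2 - 9" 3 "8 * Y2 - 4 * Y2 ^ 2" "2 * Y2 - 3"]
    unfolding s_def mu_def X2_eq by (simp add: algebra_simps power2_eq_square power3_eq_cube)
  have xx: "X2 * X2 = 2 * v"
    using R2_mult[of "8 * Y2 - 4 * Y2 ^ 2" "2 * Y2 - 3" "8 * Y2 - 4 * Y2 ^ 2" "2 * Y2 - 3"]
    unfolding v_def X2_eq by (simp add: algebra_simps power2_eq_square)
  define r where "r = of_int m * mu + 2 * l * s * ((X2 - 2) * w) + s * (v * w1 - w)"
  have r: "r \<in> Lat" unfolding r_def
    by (intro Lat_intros Lat(1-3) l(1) ZX_Lat[OF w1] ZX_Lat[OF assms] X2_Lat Lat_base(4-7))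
  have "T_eta ^ a * (6 * rho + 4 * xi2 - 9) * ((X2 - 2) * w) = (1 + 4 * l) * (s * ((X2 - 2) * w))"
    unfolding l(2) s_def R2_def Y2_def by (simp add: mult_ac)
  also have "\<dots> = of_int m * (s * X2) + s * (X2 * X2 * w1) - 2 * s * w + 4 * l * s * ((X2 - 2) * w)"
    by (simp add: w algebra_simps)
  also have "\<dots> = of_int m * R2 + 2 * r"
    unfolding smu xx r_def by (simp add: algebra_simps)
  finally have eq: "T_eta ^ a * (6 * rho + 4 * xi2 - 9) * ((X2 - 2) * w) = of_int m * R2 + 2 * r" .
  have "fps_bisect (rho ^ (6 * a + 4) * (xi ^ (2 * a + 2) * ((X2 - 2) * w))) =
     fps_bisect (fps_dilate (xi ^ (4 * a + 3)) * (T_eta ^ a * (6 * rho + 4 * xi2 - 9) * ((X2 - 2) * w)))"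
    using odd_step_eq[of a] by (simp only: fps_dilate_power mult.assoc[symmetric])
  also have "\<dots> = xi ^ (4 * a + 3) * (of_int m * X2 + 2 * fps_bisect r)"
    unfolding fps_bisect_dilate_mult eq by (simp add: bisect_scalar bisect_R2)
  finally have eq2: "fps_bisect (rho ^ (6 * a + 4) * (xi ^ (2 * a + 2) * ((X2 - 2) * w))) =
      xi ^ (4 * a + 3) * (of_int m * X2 + 2 * fps_bisect r)" .
  \<comment> \<open>At q = 0 the factor X - 2 vanishes, hence so does m X + 2 U(r), whose value
    there is twice that of m + U(r). This makes m + U(r) divisible by X - 2.\<close>
  have "fps_nth (fps_bisect (rho ^ (6 * a + 4) * (xi ^ (2 * a + 2) * ((X2 - 2) * w)))) 0 = 0"
    by (simp add: numeral_fps_const)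
  then have "fps_nth (of_int m + fps_bisect r) 0 = 0"
    unfolding eq2 by (simp add: numeral_fps_const fps_of_int[symmetric])
  moreover have "of_int m + fps_bisect r \<in> ZX" using bisect_Lat[OF r] by auto
  ultimately obtain z where z: "z \<in> ZX" "of_int m + fps_bisect r = (X2 - 2) * z"
    using ZX_vanishing by blast
  have "of_int m * X2 + 2 * fps_bisect r = of_int m * (X2 - 2) + 2 * (of_int m + fps_bisect r)"
    by (simp add: algebra_simps)
  also have "\<dots> = (X2 - 2) * (of_int m + 2 * z)" unfolding z(2) by (simp add: algebra_simps)
  finally have "of_int m * X2 + 2 * fps_bisect r = (X2 - 2) * (of_int m + 2 * z)" .
  with eq2 z(1) show ?thesis by auto
qed

text \<open>The R-free component of the product is a multiple of Y, and U sends both Y and R to X.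
  So every image contains a factor X, needed to raise the exponent of \<xi> by one.\<close>

lemma bisect_three_rho: "f \<in> Lat \<Longrightarrow> \<exists>z\<in>ZX. fps_bisect ((3 * R2 - 2 * Y2) * f) = X2 * z"
proof -
  assume "f \<in> Lat"
  then obtain a b where ab: "a \<in> ZX" "b \<in> ZX" and f: "f = fps_dilate a + fps_dilate b * R2"
    by (auto simp: Lat_def)
  have "(3 * R2 - 2 * Y2) * f = fps_dilate (- (2 * X2 * a) - 6 * X2 * b) +
      fps_dilate (3 * a + 4 * X2 * b) * R2"
    unfolding f using R2_mult[of "- 2 * Y2" 3 "fps_dilate a" "fps_dilate b"] by (simp add: algebra_simps)
  then have "fps_bisect ((3 * R2 - 2 * Y2) * f) = X2 * (a + (4 * X2 - 6) * b)"
    by (simp only: bisect_normal_form) (simp add: algebra_simps)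
  moreover have "a + (4 * X2 - 6) * b \<in> ZX" by (intro ZX_intros ZX_numeral ab)
  ultimately show ?thesis by blast
qed

text \<open>
  Up to a unit, the multiplier is \<open>(3 R - 2 Y) / Y\<close>. After \<open>U\<close> it sends both 2 and \<open>X\<close> to 2 modulo 4, so that
  \<open>X - 2\<close> gains a factor 4.
\<close>

lemma even_step:
  assumes "z \<in> ZX"
  shows "\<exists>w\<in>ZX. fps_bisect (rho ^ (6 * b + 2) * (xi ^ (2 * b + 1) * ((X2 - 2) * (of_int m + 2 * z)))) =
    4 * (xi ^ (4 * b + 2) * ((X2 - 2) * w))"
proof -
  obtain l where l: "l \<in> Lat" "T_eta ^ b = 1 + 4 * l" using T_eta_power by blast
  define t where "t = 3 * R2 - 2 * Y2"
  \<comment> \<open>Chosen so that t X = 2 Y (1 + 2 \<open>mu\<close>).\<close>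
  define mu where "mu = 3 * R2 - Y2 * R2 - 7 * Y2 + 2 * Y2 ^ 2 + 4"
  have Lat: "mu \<in> Lat" unfolding mu_def by (intro Lat_intros Lat_base(2-7) Lat_power)
  have tx: "t * X2 = 2 * (Y2 * (1 + 2 * mu))"
    using R2_mult[of "- 2 * Y2" 3 "8 * Y2 - 4 * Y2 ^ 2" "2 * Y2 - 3"]
    unfolding t_def mu_def X2_eq by (simp add: algebra_simps power2_eq_square)
  \<comment> \<open>\<open>al\<close> and \<open>be\<close> collect the remaining terms as 4 (Y
    \<open>al\<close> + t \<open>be\<close>), sorted by their factor Y or t, since each of the two
    yields a factor X under U.\<close>
  define al where "al = of_int m * (mu + 2 * l * (1 + 2 * mu)) + z * (1 + 4 * l) * (1 + 2 * mu)"
  define be where "be = - (2 * of_int m * l) - z * (1 + 4 * l)"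
  have "be = 0 - (2 * of_int m * l) - z * (1 + 4 * l)" by (simp add: be_def)
  moreover have "0 - (2 * of_int m * l) - z * (1 + 4 * l) \<in> Lat"
    by (intro Lat_intros l(1) ZX_Lat[OF assms] Lat_base(4-7))
  moreover have "al \<in> Lat" unfolding al_def
    by (intro Lat_intros Lat l(1) ZX_Lat[OF assms] Lat_base(4-7))
  ultimately have ab: "al \<in> Lat" "be \<in> Lat" by simp_all
  have "T_eta ^ b * t * ((X2 - 2) * (of_int m + 2 * z)) =
      (1 + 4 * l) * (t * X2 - 2 * t) * (of_int m + 2 * z)"
    unfolding l(2) by (simp add: algebra_simps)
  also have "\<dots> = of_int m * (2 * Y2 - 2 * t) + 4 * (Y2 * al + t * be)"
    unfolding tx al_def be_def by (simp add: algebra_simps)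
  finally have eq: "T_eta ^ b * t * ((X2 - 2) * (of_int m + 2 * z)) = of_int m * (2 * Y2 - 2 * t) + 4 * (Y2 * al + t * be)" .
  \<comment> \<open>U(t) = 3X - 2X = X = U(Y), so the only term not divisible by 4, namely m (2Y -
    2t), is annihilated by U.\<close>
  have "t = fps_dilate (- (2 * X2)) + fps_dilate 3 * R2" by (simp add: t_def)
  then have bt: "fps_bisect t = X2" by (simp only: bisect_normal_form) simp
  have by': "fps_bisect (Y2 * f) = X2 * fps_bisect f" for f
    using fps_bisect_dilate_mult[of "X2" f] by simp
  have "fps_bisect Y2 = X2" using fps_bisect_dilate[of X2] by simp
  obtain z1 where z1: "z1 \<in> ZX" "fps_bisect (t * be) = X2 * z1"
    using bisect_three_rho[OF ab(2)] unfolding t_def by blast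
  \<comment> \<open>The factor 2 turns 3\<rho> - 2y into t; it is given back at the end through X =
    2\<xi>.\<close>
  have "2 * fps_bisect (rho ^ (6 * b + 2) * (xi ^ (2 * b + 1) * ((X2 - 2) * (of_int m + 2 * z)))) =
     fps_bisect (2 * (rho ^ (6 * b + 2) * xi ^ (2 * b + 1) * ((X2 - 2) * (of_int m + 2 * z))))"
    by (simp add: bisect_scalar mult.assoc)
  also have "2 * (rho ^ (6 * b + 2) * xi ^ (2 * b + 1) * ((X2 - 2) * (of_int m + 2 * z))) =
      fps_dilate (xi ^ (4 * b + 1)) * (T_eta ^ b * t * ((X2 - 2) * (of_int m + 2 * z)))"
    unfolding even_step_eq t_def R2_def Y2_def fps_dilate_power by (simp add: algebra_simps)
  also have "fps_bisect \<dots> = xi ^ (4 * b + 1) * (4 * (X2 * (fps_bisect al + z1)))"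
    unfolding fps_bisect_dilate_mult eq
    by (simp only: fps_bisect_simps bisect_scalar by' bt z1 \<open>fps_bisect Y2 = X2\<close>) (simp add: algebra_simps)
  also have "\<dots> = 2 * (4 * (xi ^ (4 * b + 2) * (fps_bisect al + z1)))"
    by (simp add: X2_def power_add power2_eq_square mult_ac)
  finally have "2 * fps_bisect (rho ^ (6 * b + 2) * (xi ^ (2 * b + 1) * ((X2 - 2) * (of_int m + 2 * z)))) =
     2 * (4 * (xi ^ (4 * b + 2) * (fps_bisect al + z1)))" .
  then have eq2: "fps_bisect (rho ^ (6 * b + 2) * (xi ^ (2 * b + 1) * ((X2 - 2) * (of_int m + 2 * z)))) =
     4 * (xi ^ (4 * b + 2) * (fps_bisect al + z1))" by (metis mult_cancel_left zero_neq_numeral)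
  have "fps_nth (fps_bisect (rho ^ (6 * b + 2) * (xi ^ (2 * b + 1) * ((X2 - 2) * (of_int m + 2 * z))))) 0 = 0"
    by (simp add: numeral_fps_const)
  then have "fps_nth (fps_bisect al + z1) 0 = 0" unfolding eq2 by (simp add: numeral_fps_const)
  moreover have "fps_bisect al + z1 \<in> ZX" using bisect_Lat[OF ab(1)] z1(1) by auto
  ultimately obtain w where "w \<in> ZX" "fps_bisect al + z1 = (X2 - 2) * w" using ZX_vanishing by blast
  with eq2 show ?thesis by auto
qed

subsection \<open>The initial case\<close>

text \<open>Normal form over integer polynomials in y, without doubling, for explicit computations
  with coefficient lists.\<close>

definition rho_nf :: "int poly \<Rightarrow> int poly \<Rightarrow> rat fps" where
  "rho_nf a b = ipoly a xi2 + ipoly b xi2 * rho"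

lemma rho_nf_mult: "rho_nf a b * rho_nf c d =
    rho_nf (a * c - [:0, 1:] * b * d) (a * d + b * c + [:0, 2:] * b * d)"
proof -
  have "rho_nf a b * rho_nf c d = ipoly a xi2 * ipoly c xi2 + (ipoly a xi2 * ipoly d xi2 + ipoly b xi2 * ipoly c xi2) * rho
      + ipoly b xi2 * ipoly d xi2 * rho ^ 2"
    by (simp add: rho_nf_def algebra_simps power2_eq_square)
  also have "\<dots> = rho_nf (a * c - [:0, 1:] * b * d) (a * d + b * c + [:0, 2:] * b * d)"
    unfolding rho_square rho_nf_def ipoly_simps by (simp add: algebra_simps)
  finally show ?thesis .
qed

lemma ipoly_shift: "xi ^ n * ipoly (pCons 0 p) xi = xi ^ Suc n * ipoly p xi"
  by (simp add: mult_ac)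

lemma ipoly_dilate: "fps_dilate (ipoly p f) = ipoly p (fps_dilate f)" for f :: "rat fps"
  by (induction p) (simp_all add: fps_dilate_of_int)

lemma bisect_rho_nf: "fps_bisect (xi2 ^ n * rho_nf a b) = xi ^ n * ipoly (a + [:0, 1:] * b) xi"
proof -
  have "fps_bisect (fps_dilate (xi ^ n) * (fps_dilate (ipoly a xi) + fps_dilate (ipoly b xi) * rho)) =
      xi ^ n * (ipoly a xi + ipoly b xi * xi)"
    unfolding fps_bisect_dilate_mult by (simp add: fps_bisect_dilate_mult bisect_rho)
  then show ?thesis by (simp add: rho_nf_def ipoly_dilate mult.commute)
qed

lemma rho_nf_basic:
  "xi = rho_nf [:0, 8, - 8:] [:- 3, 4:]" "rho = rho_nf 0 1" "of_int m = rho_nf [:m:] 0"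
  "6 * rho + 4 * xi2 - 9 = rho_nf [:- 9, 4:] [:6:]" "3 - 2 * xi = rho_nf [:3, - 16, 16:] [:6, - 8:]"
proof -
  show "xi = rho_nf [:0, 8, - 8:] [:- 3, 4:]"
    by (subst xi_eq_rho) (simp add: rho_nf_def algebra_simps power2_eq_square)
  show "3 - 2 * xi = rho_nf [:3, - 16, 16:] [:6, - 8:]"
    by (subst xi_eq_rho) (simp add: rho_nf_def algebra_simps power2_eq_square)
qed (simp_all add: rho_nf_def)

lemma three_rho_nf: "3 * rho - 2 * xi2 = rho_nf [:0, - 2:] [:3:]"
  by (simp add: rho_nf_def)

lemma T_eta_nf: "T_eta = rho_nf [:9, - 16:] [:- 24, 32:]"
proof -
  have "2 * rho - 1 = rho_nf [:- 1:] [:2:]" by (simp add: rho_nf_def)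
  then show ?thesis unfolding rho_nf_basic(4) by (simp only: rho_nf_mult) simp
qed

text \<open>Horner scheme for substituting the normal form of \<xi>, with one multiplication at a
  time.\<close>

lemma rho_nf_horner:
  assumes "ipoly p xi = rho_nf a b"
  shows "ipoly (pCons c p) xi = rho_nf ([:c:] + ([:0, 8, - 8:] * a - [:0, 1:] * [:- 3, 4:] * b))
    ([:0, 8, - 8:] * b + [:- 3, 4:] * a + [:0, 2:] * [:- 3, 4:] * b)"
proof -
  have "xi * ipoly p xi = rho_nf [:0, 8, - 8:] [:- 3, 4:] * rho_nf a b"
    unfolding assms by (subst rho_nf_basic(1)) (rule refl)
  then show ?thesis unfolding rho_nf_mult by (simp add: rho_nf_def)
qed

text \<open>The polynomial is the cofactor of \<xi>^7 in \<open>PDO_sec_4_eq\<close>.\<close>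

lemma base_poly_nf: "ipoly [:- 729, 7290, - 18720, 20352, - 10240, 2048:] xi = rho_nf [:- 729, 226800, - 5832144, 54919680, - 266205184, 758939648, - 1347354624, 1509949440, - 1040187392, 402653184, - 67108864:]
    [:- 21870, 1140264, - 14552064, 84728832, - 274423808, 536051712, - 647495680, 473956352, - 192937984, 33554432:]"
proof -
  have "ipoly [:2048:] xi = rho_nf [:2048:] 0" by (simp add: rho_nf_def)
  from rho_nf_horner[OF this, of "- 10240"] have "ipoly [:- 10240, 2048:] xi =
      rho_nf [:- 10240, 16384, - 16384:]
        [:- 6144, 8192:]" by simp
  from rho_nf_horner[OF this, of "20352"] have "ipoly [:20352, - 10240, 2048:] xi =
      rho_nf [:20352, - 100352, 262144, - 294912, 131072:]
        [:30720, - 102400, 131072, - 65536:]" by simp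
  from rho_nf_horner[OF this, of "- 18720"] have "ipoly [:- 18720, 20352, - 10240, 2048:] xi =
      rho_nf [:- 18720, 254976, - 1395712, 3702784, - 5177344, 3670016, - 1048576:]
        [:- 61056, 443904, - 1392640, 2195456, - 1703936, 524288:]" by simp
  from rho_nf_horner[OF this, of "7290"] have "ipoly [:7290, - 18720, 20352, - 10240, 2048:] xi =
      rho_nf [:7290, - 332928, 3765504, - 19159040, 52944896, - 84934656, 79167488, - 39845888, 8388608:]
        [:56160, - 961920, 6094848, - 19476480, 34734080, - 35127296, 18874368, - 4194304:]" by simp
  from rho_nf_horner[OF this, of "- 729"] have "ipoly [:- 729, 7290, - 18720, 20352, - 10240, 2048:] xi =
      rho_nf [:- 729, 226800, - 5832144, 54919680, - 266205184, 758939648, - 1347354624, 1509949440, - 1040187392, 402653184, - 67108864:]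
        [:- 21870, 1140264, - 14552064, 84728832, - 274423808, 536051712, - 647495680, 473956352, - 192937984, 33554432:]" by simp
  then show ?thesis .
qed

text \<open>The multiplier is that of \<open>even_step_eq\<close> at \<open>b = 3\<close>, belonging
  to \<rho>^20.\<close>

lemma base_poly_step: "T_eta ^ 3 * (3 * rho - 2 * xi2) * ipoly [:- 729, 7290, - 18720, 20352, - 10240, 2048:] xi =
    rho_nf [:0, 36137988, - 509710968, 2972290464, - 9613375488, 19447713792, - 26059309056, 23637393408, - 14415822848, 5679087616, - 1308622848, 134217728:]
      [:- 1594323, 109122552, - 899119440, 3398423040, - 7541102592, 10797318144, - 10323689472, 6574571520, - 2684354560, 637534208, - 67108864:]"
proof -
  have "(3 * rho - 2 * xi2) * ipoly [:- 729, 7290, - 18720, 20352, - 10240, 2048:] xi = rho_nf [:0, 67068, - 3874392, 55320480, - 364025856, 1355681792, - 3126034432, 4637196288, - 4441767936, 2659188736, - 905969664, 134217728:]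
      [:- 2187, 592920, - 12935376, 106550784, - 459700224, 1179123712, - 1897857024, 1939865600, - 1224736768, 436207616, - 67108864:]"
    unfolding base_poly_nf three_rho_nf rho_nf_mult by simp
  then have "T_eta * ((3 * rho - 2 * xi2) * ipoly [:- 729, 7290, - 18720, 20352, - 10240, 2048:] xi) = rho_nf [:0, 551124, - 21642552, 230452128, - 1190209536, 3583119360, - 6815842304, 8470790144, - 6882852864, 3531603968, - 1040187392, 134217728:]
      [:- 19683, 3866616, - 59373648, 373095936, - 1277540352, 2666987520, - 3558801408, 3059744768, - 1644167168, 503316480, - 67108864:]"
    unfolding T_eta_nf by (simp only: rho_nf_mult) simp
  then have "T_eta * (T_eta * ((3 * rho - 2 * xi2) * ipoly [:- 729, 7290, - 18720, 20352, - 10240, 2048:] xi)) = rho_nf [:0, 4487724, - 110172312, 871650720, - 3544860672, 8691388416, - 13783498752, 14535753728, - 10162798592, 4538236928, - 1174405120, 134217728:]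
      [:- 177147, 22832280, - 246028752, 1181827584, - 3236419584, 5562040320, - 6238961664, 4582277120, - 2130706432, 570425344, - 67108864:]"
    unfolding T_eta_nf by (simp only: rho_nf_mult) simp
  then have "T_eta * (T_eta * (T_eta * ((3 * rho - 2 * xi2) * ipoly [:- 729, 7290, - 18720, 20352, - 10240, 2048:] xi))) = rho_nf [:0, 36137988, - 509710968, 2972290464, - 9613375488, 19447713792, - 26059309056, 23637393408, - 14415822848, 5679087616, - 1308622848, 134217728:]
      [:- 1594323, 109122552, - 899119440, 3398423040, - 7541102592, 10797318144, - 10323689472, 6574571520, - 2684354560, 637534208, - 67108864:]"
    unfolding T_eta_nf by (simp only: rho_nf_mult) simp
  then show ?thesis by (simp only: power3_eq_cube mult.assoc)
qed

text \<open>Starts the chain in which \<open>PDO_sec (k + 2)\<close> carries the factor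
  \<open>g_eta ^ (5 * 2 ^ k)\<close>, the normalisation of \<open>Phi k\<close>.\<close>

lemma PDO_sec_2_eq: "g_eta ^ 5 * PDO_sec 2 = xi ^ 2 * (3 - 2 * xi)"
proof -
  have "PDO_sec 1 = PDO2_eta" using PDO_sec_Suc[of 0] by (simp add: PDO_sec_0 PDO_gf_bisect One_nat_def)
  then have "PDO_sec 2 = fps_bisect PDO2_eta" using PDO_sec_Suc[of 1] by (simp add: numeral_2_eq_2 One_nat_def)
  then have "g_eta ^ 5 * PDO_sec 2 = fps_bisect (fps_dilate (g_eta ^ 5) * PDO2_eta)"
    by (simp only: fps_bisect_dilate_mult)
  also have "\<dots> = fps_bisect (xi2 ^ 1 * (xi * rho))" by (simp add: PDO2_eta_dilate)
  also have "xi * rho = rho_nf [:0, 3, - 4:] [:0, 2:]"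
  proof -
    have "xi * rho = rho_nf [:0, 8, - 8:] [:- 3, 4:] * rho_nf 0 1"
      by (subst rho_nf_basic(1), subst rho_nf_basic(2)) (rule refl)
    then show ?thesis unfolding rho_nf_mult by simp
  qed
  finally show ?thesis unfolding bisect_rho_nf by (simp add: algebra_simps power2_eq_square)
qed

lemma PDO_sec_3_eq: "g_eta ^ 10 * PDO_sec 3 = xi ^ 4 * ipoly [:9, - 24, 16:] xi"
proof -
  have "g_eta ^ 10 * PDO_sec 3 = fps_bisect (rho ^ 5 * (xi ^ 2 * (3 - 2 * xi)))"
    using bisect_step[of 5 "PDO_sec 2"] PDO_sec_Suc[of 2] by (simp add: PDO_sec_2_eq)
  \<comment> \<open>The exponent 5 is not of the form 6a + 4, so one \<rho> stays behind and is
    absorbed into the normal form.\<close>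
  also have "rho ^ 5 * (xi ^ 2 * (3 - 2 * xi)) = rho ^ 4 * xi ^ 2 * (rho * (3 - 2 * xi))"
    using power_add[of rho 4 1] by (simp add: mult_ac)
  also have "\<dots> = xi2 ^ 3 * (rho_nf [:- 9, 4:] [:6:] * (rho_nf 0 1 * rho_nf [:3, - 16, 16:] [:6, - 8:]))"
    unfolding rho_fourth_xi_sq rho_nf_basic(4,5) by (subst rho_nf_basic(2)) (rule mult.assoc)
  also have "\<dots> = xi2 ^ 3 * rho_nf [:0, 36, - 72, 32:] [:- 27, 48, - 16:]"
    unfolding rho_nf_mult by simp
  also have "fps_bisect \<dots> = xi ^ 3 * ipoly [:0, 9, - 24, 16:] xi"
    unfolding bisect_rho_nf by simp
  finally show ?thesis unfolding ipoly_shift by simp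
qed

lemma PDO_sec_4_eq: "g_eta ^ 20 * PDO_sec 4 = xi ^ 7 * ipoly [:- 729, 7290, - 18720, 20352, - 10240, 2048:] xi"
proof -
  have "ipoly [:16:] xi = rho_nf [:16:] 0" by (simp add: rho_nf_def)
  from rho_nf_horner[OF this, of "- 24"] have "ipoly [:- 24, 16:] xi = rho_nf [:- 24, 128, - 128:] [:- 48, 64:]" by simp
  from rho_nf_horner[OF this, of 9] have sq: "ipoly [:9, - 24, 16:] xi = rho_nf [:9, - 336, 1600, - 2304, 1024:] [:72, - 576, 1024, - 512:]" by simp
  have "g_eta ^ 20 * PDO_sec 4 = fps_bisect (rho ^ 10 * (xi ^ 4 * ipoly [:9, - 24, 16:] xi))"
    using bisect_step[of 10 "PDO_sec 3"] PDO_sec_Suc[of 3] by (simp add: PDO_sec_3_eq del: ipoly_simps)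
  also have "rho ^ 10 * (xi ^ 4 * ipoly [:9, - 24, 16:] xi) = xi2 ^ 7 * (T_eta * (6 * rho + 4 * xi2 - 9) * ipoly [:9, - 24, 16:] xi)"
    using odd_step_eq[of 1] by (simp add: mult.assoc[symmetric] del: ipoly_simps)
  also have "T_eta * (6 * rho + 4 * xi2 - 9) * ipoly [:9, - 24, 16:] xi = rho_nf [:- 729, 10692, - 29952, 35328, - 19456, 4096:] [:- 3402, 11232, - 14976, 9216, - 2048:]"
    unfolding sq T_eta_nf unfolding rho_nf_basic(4) rho_nf_mult by simp
  finally show ?thesis unfolding bisect_rho_nf by simp
qed

lemma PDO_sec_5_eq: "g_eta ^ 40 * PDO_sec 5 = xi ^ 14 * ipoly [:34543665, - 400588416, 2073171024, - 6214952448, 11906611200, - 15261990912, 13313703936, - 7841251328, 2994733056, - 671088640, 67108864:] xi"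
proof -
  have "g_eta ^ 40 * PDO_sec 5 = fps_bisect (rho ^ 20 * (xi ^ 7 * ipoly [:- 729, 7290, - 18720, 20352, - 10240, 2048:] xi))"
    using bisect_step[of 20 "PDO_sec 4"] PDO_sec_Suc[of 4] by (simp add: PDO_sec_4_eq del: ipoly_simps)
  also have "rho ^ 20 * (xi ^ 7 * ipoly [:- 729, 7290, - 18720, 20352, - 10240, 2048:] xi) = xi2 ^ 13 * (T_eta ^ 3 * (3 * rho - 2 * xi2) * ipoly [:- 729, 7290, - 18720, 20352, - 10240, 2048:] xi)"
    using even_step_eq[of 3] by (simp add: mult.assoc[symmetric] del: ipoly_simps)
  also have "fps_bisect \<dots> = xi ^ 13 * ipoly [:0, 34543665, - 400588416, 2073171024, - 6214952448, 11906611200, - 15261990912, 13313703936, - 7841251328, 2994733056, - 671088640, 67108864:] xi"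
    unfolding base_poly_step bisect_rho_nf by simp
  finally show ?thesis unfolding ipoly_shift by simp
qed

section \<open>The recursion for \<open>Phi\<close> and its initial value\<close>

lemma Phi_eq: "Phi k = g_eta ^ (5 * 2 ^ k) * (PDO_sec (k + 2) - PDO_sec k)"
proof -
  have "Abs_fps (\<lambda>n. of_nat (PDO (2 ^ (k + 2) * n)) - of_nat (PDO (2 ^ k * n))) = (PDO_sec (k + 2) - PDO_sec k)"
    by (rule fps_ext) (simp add: PDO_sec_def)
  then show ?thesis by (simp add: Phi_def gamma_eq power_mult)
qed

lemma Phi_Suc: "Phi (Suc k) = fps_bisect (rho ^ (5 * 2 ^ k) * Phi k)"
proof -
  have "Phi (Suc k) = g_eta ^ (2 * (5 * 2 ^ k)) * fps_bisect (PDO_sec (k + 2) - PDO_sec k)"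
    by (simp add: Phi_eq PDO_sec_Suc mult.left_commute)
  then show ?thesis unfolding bisect_step by (simp add: Phi_eq)
qed

lemma Phi_3: "\<exists>w\<in>ZX. Phi 3 = 2 ^ 4 * (xi ^ 14 * ((X2 - 2) * w))"
proof -
  \<comment> \<open>The quotient by 16 (X - 2) of the difference of the two cofactors of \<xi>^14
    computed below, rewritten in X = 2\<xi>.\<close>
  define w :: "int poly" where "w = [:- 1062882, 5668704, - 13272903, 17565984, - 14434848, 7675776, - 2661120, 583680, - 73728, 4096:]"
  \<comment> \<open>40 = 6 * 5 + 10: the excess over the tenth power is a polynomial in \<xi> by
    \<open>g_eta_sixth\<close>.\<close>
  have "g_eta ^ 40 * PDO_sec 3 = (g_eta ^ 6) ^ 5 * (g_eta ^ 10 * PDO_sec 3)"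
    by (simp only: power_mult[symmetric] mult.assoc[symmetric] power_add[symmetric]) simp
  also have "\<dots> = xi ^ 14 * ipoly ([:9, - 8:] ^ 5 * [:9, - 24, 16:]) xi"
    unfolding g_eta_sixth PDO_sec_3_eq ipoly_simps(3) ipoly_power
    by (simp add: power_mult_distrib power_mult[symmetric] power_add[symmetric] mult.assoc[symmetric] del: mult.assoc)
       (simp add: mult_ac)
  finally have "Phi 3 = xi ^ 14 * ipoly ([:34543665, - 400588416, 2073171024, - 6214952448, 11906611200, - 15261990912, 13313703936, - 7841251328, 2994733056, - 671088640, 67108864:] - [:9, - 8:] ^ 5 * [:9, - 24, 16:]) xi"
    using PDO_sec_5_eq by (simp add: Phi_eq right_diff_distrib del: ipoly_simps(3,4) ipoly_power)
  also have "[:34543665, - 400588416, 2073171024, - 6214952448, 11906611200, - 15261990912, 13313703936, - 7841251328, 2994733056, - 671088640, 67108864:] - [:9, - 8:] ^ 5 * [:9, - 24, 16:] = [:16:] * ([:- 2, 2:] * (w \<circ>\<^sub>p [:0, 2:]))"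
  proof -
    have "w \<circ>\<^sub>p [:0, 2:] = [:- 1062882, 11337408, - 53091612, 140527872, - 230957568, 245624832, - 170311680, 74711040, - 18874368, 2097152:]"
      by (simp add: w_def pcompose_pCons)
    moreover have "[:9, - 8:] ^ 2 = ([:81, - 144, 64:] :: int poly)" by (simp add: power2_eq_square)
    then have "[:9, - 8:] ^ 4 = ([:6561, - 23328, 31104, - 18432, 4096:] :: int poly)"
      using power_mult[of "[:9, - 8:] :: int poly" 2 2] by (simp add: power2_eq_square)
    then have "[:9, - 8:] ^ 5 = ([:59049, - 262440, 466560, - 414720, 184320, - 32768:] :: int poly)"
      using power_add[of "[:9, - 8:] :: int poly" 4 1] by simp
    ultimately show ?thesis by simp
  qed
  also have "ipoly \<dots> xi = 16 * ((X2 - 2) * ipoly w X2)"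
    unfolding ipoly_simps(3) ipoly_pcompose by (simp add: X2_def mult.commute[of xi])
  finally have "Phi 3 = 2 ^ 4 * (xi ^ 14 * ((X2 - 2) * ipoly w X2))" by simp
  then show ?thesis by (auto simp: ZX_def)
qed

subsection \<open>Coefficients in terms of xi\<close>

lemma Phi_odd:
  assumes "K \<ge> 1"
  shows "\<exists>a. 5 * 2 ^ (2 * K + 1) = 6 * a + 4 \<and>
    (\<exists>w\<in>ZX. Phi (2 * K + 1) = 2 ^ (2 * K + 2) * (xi ^ (2 * a + 2) * ((X2 - 2) * w)))"
  using assms
proof (induction K rule: dec_induct)
  \<comment> \<open>5 * 2^3 = 40 = 6 * 6 + 4, and 2 * 6 + 2 = 14 is the exponent of \<xi> in
    \<open>Phi_3\<close>.\<close>
  case base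
  show ?case using Phi_3 by (intro exI[of _ 6]) (simp add: eval_nat_numeral One_nat_def)
next
  case (step K)
  then obtain a w where a: "5 * 2 ^ (2 * K + 1) = 6 * a + 4" and w: "w \<in> ZX"
    and Phi: "Phi (2 * K + 1) = 2 ^ (2 * K + 2) * (xi ^ (2 * a + 2) * ((X2 - 2) * w))" by blast
  have pw: "2 ^ n * f = of_int (2 ^ n) * f" for n and f :: "rat fps" by simp
  obtain m z where z: "z \<in> ZX" and step1: "fps_bisect (rho ^ (6 * a + 4) * (xi ^ (2 * a + 2) * ((X2 - 2) * w))) =
    xi ^ (4 * a + 3) * ((X2 - 2) * (of_int m + 2 * z))" using odd_step[OF w] by blast
  have "Phi (Suc (2 * K + 1)) = fps_bisect (of_int (2 ^ (2 * K + 2)) * (rho ^ (6 * a + 4) * (xi ^ (2 * a + 2) * ((X2 - 2) * w))))"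
    unfolding Phi_Suc a Phi pw by (simp only: mult.left_commute)
  then have Phi1: "Phi (Suc (2 * K + 1)) = of_int (2 ^ (2 * K + 2)) * (xi ^ (4 * a + 3) * ((X2 - 2) * (of_int m + 2 * z)))"
    by (simp only: bisect_scalar step1)
  \<comment> \<open>Doubling 6a + 4 gives 6(2a + 1) + 2, and the exponent 4a + 3 left by the odd
    step is 2b + 1, as the even step requires. Afterwards \<open>2 * b\<close> takes the role of
    \<open>a\<close>.\<close>
  define b where "b = 2 * a + 1"
  have "5 * 2 ^ Suc (2 * K + 1) = 2 * (6 * a + 4)" unfolding a[symmetric] power_Suc by (rule mult.left_commute)
  then have b: "5 * 2 ^ Suc (2 * K + 1) = 6 * b + 2" "4 * a + 3 = 2 * b + 1" unfolding b_def by simp_all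
  obtain w' where w': "w' \<in> ZX" and step2: "fps_bisect (rho ^ (6 * b + 2) * (xi ^ (2 * b + 1) * ((X2 - 2) * (of_int m + 2 * z)))) =
    4 * (xi ^ (4 * b + 2) * ((X2 - 2) * w'))" using even_step[OF z] by blast
  have "Phi (Suc (Suc (2 * K + 1))) = fps_bisect (of_int (2 ^ (2 * K + 2)) * (rho ^ (6 * b + 2) * (xi ^ (2 * b + 1) * ((X2 - 2) * (of_int m + 2 * z)))))"
    unfolding Phi_Suc[of "Suc (2 * K + 1)"] b(1) Phi1 b(2) by (simp only: mult.left_commute)
  then have "Phi (Suc (Suc (2 * K + 1))) = of_int (2 ^ (2 * K + 2)) * (4 * (xi ^ (4 * b + 2) * ((X2 - 2) * w')))"
    by (simp only: bisect_scalar step2)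
  then have "Phi (2 * Suc K + 1) = 2 ^ (2 * Suc K + 2) * (xi ^ (2 * (2 * b) + 2) * ((X2 - 2) * w'))"
    by (simp add: mult_ac)
  moreover have "5 * 2 ^ (2 * Suc K + 1) = 6 * (2 * b) + 4" using b(1) by simp
  ultimately show ?case using w' by blast
qed

text \<open>Since 4^(K-1) is 1 modulo 3, the division in \<open>tau\<close> is exact; writing
  4^(K-1) = 3t + 1, both sides are 40t + 14.\<close>

lemma tau_eq:
  assumes "K \<ge> 1" "5 * 2 ^ (2 * K + 1) = 6 * a + 4"
  shows "tau K = 2 * a + 2"
proof -
  obtain k where k: "K = Suc k" using assms(1) by (cases K) auto
  have "(4::nat) ^ k mod 3 = 1 mod 3" using power_mod[of "4::nat" 3 k] by simp
  then have "4 ^ k = 3 * (4 ^ k div 3) + (1::nat)" using mult_div_mod_eq[of 3 "4 ^ k :: nat"] by simp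
  then obtain t where t: "(4::nat) ^ k = 3 * t + 1" by blast
  have "(2::nat) ^ (2 * K - 1) = 2 * 4 ^ k" "(2::nat) ^ (2 * K + 1) = 8 * 4 ^ k"
    by (simp_all add: k power_mult)
  then show ?thesis using assms(2) t by (simp add: tau_def k)
qed

lemma ipoly_eq_map_poly: "ipoly p xi = poly (map_poly (\<lambda>c. fps_const (of_int c)) p) xi"
  by (simp add: ipoly_def fps_of_int)

text \<open>\<xi> is transcendental: \<xi> takes the value 1 at q = 0 but is not constant. Once the
  root 1 is split off with its full order, the other factor has a nonzero constant term and \<xi> -
  1 is nonzero.\<close>

lemma ipoly_xi_eq_0:
  assumes "ipoly p xi = 0"
  shows "p = 0"
proof (rule ccontr)
  assume "p \<noteq> 0"
  then obtain r where r: "p = [:- 1, 1:] ^ order 1 p * r" "\<not> [:- 1, 1:] dvd r"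
    using order_decomp[of p 1] by auto
  then have "poly r 1 \<noteq> 0" by (simp add: poly_eq_0_iff_dvd)
  moreover have "fps_nth (ipoly r xi) 0 = ipoly r (of_int 1)" by (simp add: ipoly_nth_0)
  ultimately have "fps_nth (ipoly r xi) 0 \<noteq> 0" by (simp only: ipoly_of_int of_int_eq_0_iff not_False_eq_True)
  then have "ipoly r xi \<noteq> 0" by auto
  moreover have "xi \<noteq> 1"
  proof
    assume "xi = 1"
    then have "fps_X * j_eta ^ 2 = 0" using xi_quadratic by simp
    then show False by (auto simp: j_eta_def dest: arg_cong[of _ _ "\<lambda>f. fps_nth f 0"])
  qed
  moreover have "ipoly p xi = (xi - 1) ^ order 1 p * ipoly r xi"
    by (subst r(1)) simp
  ultimately show False using assms by simp
qed

text \<open>Transcendence of \<xi> makes the polynomial unique, so the definite description in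
  \<open>F\<close> denotes any polynomial that represents \<open>Phi k\<close>.\<close>

lemma F_eq:
  assumes "ipoly p xi = Phi k"
  shows "F k m = coeff p m"
proof -
  have "(THE p :: int poly. poly (map_poly (\<lambda>c. fps_const (of_int c)) p) xi = Phi k) = p"
    unfolding ipoly_eq_map_poly[symmetric]
  proof (rule the_equality)
    show "ipoly p xi = Phi k" by (rule assms)
    fix q assume "ipoly q xi = Phi k"
    then have "ipoly (q - p) xi = 0" using assms by simp
    then show "q = p" using ipoly_xi_eq_0[of "q - p"] by simp
  qed
  then show ?thesis by (simp add: F_def)
qed

text \<open>The source of the factor 2^M, through X = 2\<xi>.\<close>

lemma coeff_pcompose_scale: "coeff (p \<circ>\<^sub>p [:0, c:]) n = coeff p n * c ^ n" for c :: int
proof (induction p arbitrary: n)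
  case (pCons a p)
  then show ?case by (cases n) (simp_all add: pcompose_pCons coeff_pCons mult_ac)
qed simp

lemma enat_le_nu: "2 ^ e dvd n \<Longrightarrow> enat e \<le> nu n"
  by (simp add: nu_def multiplicity_geI)

theorem theorem6p1:
  fixes K :: nat
  assumes "K \<ge> 2"
  shows "nu (F (2 * K + 1) (tau K)) \<ge> enat (2 * K + 3) \<and>
    (\<forall>M::nat. M \<ge> 1 \<longrightarrow> nu (F (2 * K + 1) (tau K + M)) \<ge> enat (2 * K + M + 2))"
proof -
  have K: "K \<ge> 1" using assms by simp
  from Phi_odd[OF this] obtain a w where a: "5 * 2 ^ (2 * K + 1) = 6 * a + 4" and "w \<in> ZX"
    and Phi: "Phi (2 * K + 1) = 2 ^ (2 * K + 2) * (xi ^ (2 * a + 2) * ((X2 - 2) * w))" by blast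
  then obtain q where q: "w = ipoly q X2" by (auto simp: ZX_def)
  have tau: "tau K = 2 * a + 2" using tau_eq[OF K a] .
  define p where "p = [:0, 1:] ^ tau K * ([:2:] ^ (2 * K + 2) * (([:- 2, 1:] * q) \<circ>\<^sub>p [:0, 2:]))"
  have "ipoly p xi = Phi (2 * K + 1)"
    unfolding Phi p_def q tau ipoly_simps(3) ipoly_power ipoly_pcompose by (simp add: X2_def mult_ac)
  then have F: "F (2 * K + 1) (tau K + M) = 2 ^ (2 * K + M + 2) * coeff ([:- 2, 1:] * q) M" for M
  proof -
    assume "ipoly p xi = Phi (2 * K + 1)"
    then have "F (2 * K + 1) (tau K + M) = coeff p (tau K + M)" by (rule F_eq)
    also have "p = monom 1 (tau K) * smult (2 ^ (2 * K + 2)) (([:- 2, 1:] * q) \<circ>\<^sub>p [:0, 2:])"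
      unfolding p_def by (simp add: monom_altdef poly_const_pow)
    also have "coeff \<dots> (tau K + M) = 2 ^ (2 * K + M + 2) * coeff ([:- 2, 1:] * q) M"
      by (simp only: coeff_monom_mult coeff_smult coeff_pcompose_scale) (simp add: power_add)
    finally show ?thesis .
  qed
  \<comment> \<open>The constant coefficient of (X - 2) w is even; this is the extra factor 2 in the
    bound at \<tau>.\<close>
  have "coeff ([:- 2, 1:] * q) 0 = 2 * (- coeff q 0)" by (simp add: coeff_mult)
  then have "F (2 * K + 1) (tau K) = 2 ^ (2 * K + 2) * (2 * (- coeff q 0))"
    using F[of 0] by (simp only: add_0_right)
  also have "\<dots> = 2 ^ (2 * K + 3) * (- coeff q 0)"
    by (simp add: power_add)
  finally have "F (2 * K + 1) (tau K) = 2 ^ (2 * K + 3) * (- coeff q 0)" .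
  then have "2 ^ (2 * K + 3) dvd F (2 * K + 1) (tau K)" by simp
  moreover have "2 ^ (2 * K + M + 2) dvd F (2 * K + 1) (tau K + M)" for M by (simp add: F)
  ultimately show ?thesis by (blast intro: enat_le_nu)
qed

end
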